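(* Let $\mathcal X,\mathcal Y$ be finite sets and let $\pi=\pi_{XY}$ be a probability distribution on $\mathcal X\times\mathcal Y$. Then the admissible region of shared randomness rate and communication rate for exact channel synthesis satisfies $$\mathcal R_{\mathrm{Exact}}(\pi)=\mathcal R(\pi).$$
   Context: All logarithms are natural; conventions $0\log 0=0$ and $0\cdot\infty=0$. $H$ denotes Shannon entropy and $I$ mutual information. Exact channel synthesis: let $\pi_X$ be the $X$-marginal of $\pi$ and $\pi_{Y|X}$ the conditional distribution, and let $\pi_X^{\otimes n}$, $\pi_{Y|X}^{\otimes n}$ denote the $n$-fold memoryless extensions. A sender and a receiver share $K$, uniformly distributed on $\{1,\dots,e^{nR_0}\}$ (where $R_0\ge0$ is such that $e^{nR_0}$ is an integer). The sender observes $X^n\sim\pi_X^{\otimes n}$, independent of $K$, and generates a discrete random variable $M$ through a random mapping $P_{M|X^nK}$; the receiver, given $(M,K)$, generates $Y^n\in\mathcal Y^n$ through a random mapping $P_{Y^n|MK}$. The induced joint distribution is $P_{X^nKMY^n}=P_{X^n}P_KP_{M|X^nK}P_{Y^n|MK}$. Define $$\mathcal R_{\mathrm{Exact}}(\pi):=\mathrm{cl}\bigcup_{n\ge1}\Big\{(R_0,R):\exists (P_{M|X^nK},P_{Y^n|MK})\text{ such that }P_{Y^n|X^n}=\pi_{Y|X}^{\otimes n}\text{ and }R\ge\tfrac1nH(M|K)\Big\},$$ where $\mathrm{cl}$ is the closure in $\mathbb R^2$; the condition $P_{Y^n|X^n}=\pi_{Y|X}^{\otimes n}$ means equivalently $P_{X^nY^n}=\pi^{\otimes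 n}$. The region $\mathcal R(\pi)$: for probability distributions $P$ on $\mathcal X$ and $Q$ on $\mathcal Y$, let $\mathcal C(P,Q)$ be the set of couplings of $P$ and $Q$. For a cost $c:\mathcal X\times\mathcal Y\to[0,\infty]$ define $$\mathcal T_c(P,Q):=\sup_{T\in\mathcal C(P,Q)}\mathbb E_T[c(X,Y)],\qquad \Phi_c(P,Q):=\mathcal T_c(P,Q)-H(P)-H(Q).$$ Put $c_\pi(x,y):=\log\frac1{\pi(x,y)}$, with $c_\pi(x,y)=+\infty$ when $\pi(x,y)=0$. Then $\mathcal R(\pi)$ is the set of pairs $(R_0,R)\in[0,\infty)^2$ for which there exists a joint distribution $P_{WXY}=P_WP_{X|W}P_{Y|W}$ (with $W$ taking values in some finite alphabet) such that $$P_{XY}=\pi,\qquad R\ge I(W;X),\qquad R+R_0\ge\mathbb E_W\big[\Phi_{c_\pi}(P_{X|W},P_{Y|W})\big]=\sum_wP_W(w)\Phi_{c_\pi}(P_{X|W=w},P_{Y|W=w}).$$ *)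

theory Defs
  imports "HOL-Probability.Probability"
begin

(* H(P) in [0, \<infinity>]. The library's entropy is real-valued and returns a junk value
   when the entropy is infinite, which can happen for a countably supported message. *)
definition shannon_entropy :: "'a pmf \<Rightarrow> ennreal" where
  "shannon_entropy P = (\<integral>\<^sup>+ x. ennreal (- (pmf P x * ln (pmf P x))) \<partial>count_space UNIV)"

(* P_{B|A=a} for a joint law P of (A,B); only meaningful when P(A=a) > 0. *)
definition cond_law :: "('a \<times> 'b) pmf \<Rightarrow> 'a \<Rightarrow> 'b pmf" where
  "cond_law P a = map_pmf snd (cond_pmf P {z. fst z = a})"

(* H(B|A) for a joint law P of (A,B): the conditioning variable is the first component. *)
definition cond_entropy :: "('a \<times> 'b) pmf \<Rightarrow> ennreal" where
  "cond_entropy P = (\<integral>\<^sup>+ a. shannon_entropy (cond_law P a) \<partial>measure_pmf (map_pmf fst P))"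

definition mutual_info :: "('a \<times> 'b) pmf \<Rightarrow> real" where
  "mutual_info P =
     prob_space.mutual_information (measure_pmf P) (exp 1) (count_space UNIV) (count_space UNIV) fst snd"

(* The memoryless extension of a kernel; n is the length of the input word.
   For a single law the corresponding notion is replicate_pmf. *)
primrec memoryless :: "('a \<Rightarrow> 'b pmf) \<Rightarrow> 'a list \<Rightarrow> 'b list pmf" where
  "memoryless V [] = return_pmf []"
| "memoryless V (x # xs) = do {y \<leftarrow> V x; ys \<leftarrow> memoryless V xs; return_pmf (y # ys)}"

(* The law of (X^n, K, M, Y^n) when K is uniform on {1..N}. Messages are encoded as naturals,
   which is no loss for a discrete M. *)
definition synthesis_law ::
  "nat \<Rightarrow> nat \<Rightarrow> 'x pmf \<Rightarrow> ('x list \<Rightarrow> nat \<Rightarrow> nat pmf) \<Rightarrow> (nat \<Rightarrow> nat \<Rightarrow> 'y list pmf)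
    \<Rightarrow> ('x list \<times> nat \<times> nat \<times> 'y list) pmf" where
  "synthesis_law n N PX enc dec =
     do {xs \<leftarrow> replicate_pmf n PX;
         k \<leftarrow> pmf_of_set {1..N};
         m \<leftarrow> enc xs k;
         ys \<leftarrow> dec m k;
         return_pmf (xs, k, m, ys)}"

definition exact_rates :: "('x \<times> 'y) pmf \<Rightarrow> nat \<Rightarrow> (real \<times> real) set" where
  "exact_rates \<pi> n =
     {(R0, R). R0 \<ge> 0 \<and>
        (\<exists>(N::nat) enc dec.
           real N = exp (real n * R0) \<and>
           (\<forall>m k. \<forall>ys \<in> set_pmf (dec m k). length ys = n) \<and>
           (let J = synthesis_law n N (map_pmf fst \<pi>) enc dec;
                JXY = map_pmf (\<lambda>(xs, k, m, ys). (xs, ys)) J;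
                JKM = map_pmf (\<lambda>(xs, k, m, ys). (k, m)) J
            in (\<forall>xs \<in> set_pmf (replicate_pmf n (map_pmf fst \<pi>)).
                  cond_law JXY xs = memoryless (cond_law \<pi>) xs) \<and>
               ereal R \<ge> ereal (1 / real n) * enn2ereal (cond_entropy JKM)))}"

definition R_exact :: "('x \<times> 'y) pmf \<Rightarrow> (real \<times> real) set" where
  "R_exact \<pi> = closure (\<Union>n\<in>{1..}. exact_rates \<pi> n)"

definition couplings :: "'x pmf \<Rightarrow> 'y pmf \<Rightarrow> ('x \<times> 'y) pmf set" where
  "couplings P Q = {T. map_pmf fst T = P \<and> map_pmf snd T = Q}"

definition max_transport :: "('x \<times> 'y \<Rightarrow> ennreal) \<Rightarrow> 'x pmf \<Rightarrow> 'y pmf \<Rightarrow> ennreal" where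
  "max_transport c P Q = (SUP T\<in>couplings P Q. \<integral>\<^sup>+ z. c z \<partial>measure_pmf T)"

(* On finite alphabets both entropies are finite, so no \<infinity> - \<infinity> arises. *)
definition Phi :: "('x \<times> 'y \<Rightarrow> ennreal) \<Rightarrow> 'x::finite pmf \<Rightarrow> 'y::finite pmf \<Rightarrow> ereal" where
  "Phi c P Q = enn2ereal (max_transport c P Q)
     - enn2ereal (shannon_entropy P) - enn2ereal (shannon_entropy Q)"

definition log_cost :: "('x \<times> 'y) pmf \<Rightarrow> 'x \<times> 'y \<Rightarrow> ennreal" where
  "log_cost \<pi> z = (if pmf \<pi> z = 0 then \<infinity> else ennreal (ln (1 / pmf \<pi> z)))"

(* The finite alphabet of W is encoded as a finite set of naturals. *)
definition R_region :: "('x::finite \<times> 'y::finite) pmf \<Rightarrow> (real \<times> real) set" where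
  "R_region \<pi> =
     {(R0, R). R0 \<ge> 0 \<and> R \<ge> 0 \<and>
        (\<exists>(PW::nat pmf) PX PY.
           finite (set_pmf PW) \<and>
           (let J = do {w \<leftarrow> PW; x \<leftarrow> PX w; y \<leftarrow> PY w; return_pmf (w, x, y)}
            in map_pmf (\<lambda>(w, x, y). (x, y)) J = \<pi> \<and>
               R \<ge> mutual_info (map_pmf (\<lambda>(w, x, y). (w, x)) J) \<and>
               ereal (R + R0) \<ge> (\<Sum>w\<in>set_pmf PW. ereal (pmf PW w) * Phi (log_cost \<pi>) (PX w) (PY w))))}"

end

theory Submission
  imports Defs
begin

text \<open>
  Converse. Put \<open>W = (K, M)\<close>. Exactness gives \<open>P(w) P(x|w) P(y|w) \<le> \<pi>\<^sup>n(x, y)\<close> pointwise; taking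
  logarithms and averaging over a worst coupling bounds \<open>\<Phi>\<close> for \<open>\<pi>\<^sup>n\<close> by \<open>log (1 / P(w))\<close>. The
  single-letter bound rests on a superadditivity of \<open>\<Phi>\<close>: draw \<open>X\<^sub>1\<close> and \<open>Y\<^sub>2\<close> independently, couple
  \<open>Y\<^sub>1\<close> to \<open>X\<^sub>1\<close> optimally given \<open>Y\<^sub>2\<close>, and \<open>X\<^sub>2\<close> to \<open>Y\<^sub>2\<close> optimally given \<open>X\<^sub>1\<close>. This is a coupling
  of \<open>X\<^sub>1X\<^sub>2\<close> and \<open>Y\<^sub>1Y\<^sub>2\<close>, the entropies split as \<open>H(X\<^sub>1) + H(X\<^sub>2|X\<^sub>1)\<close> and \<open>H(Y\<^sub>2) + H(Y\<^sub>1|Y\<^sub>2)\<close>, and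
  since \<open>X\<^sub>1\<close> and \<open>Y\<^sub>2\<close> are independent given \<open>W\<close>, the single-letter auxiliaries \<open>(W, Y\<^sub>2)\<close> and \<open>(W, X\<^sub>1)\<close>
  keep the two sides conditionally independent without changing the joint law.

  Achievability. A random codebook of typical words makes \<open>\<theta>\<close> times the induced law, with \<open>\<theta> < 1\<close>
  close to 1, a lower bound for \<open>\<pi>\<^sup>n\<close> pointwise; the small remainder is produced by sending the source
  word itself.
\<close>

section \<open>Finite-support laws and couplings\<close>

text \<open>Two obstacles shape the converse: the message may take infinitely many values, whereas
  the auxiliary of \<open>R_region\<close> has a finite alphabet, and the operational region is a
  closure. Both are met by passing to the convex hull of a compact set in a finite-dimensional
  space: averages over any law of \<open>W\<close> stay in the hull, a hull point is a finite convex
  combination and so supplies a finite auxiliary, and compactness gives closedness. The maximum over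
  couplings enters achievability because sender and receiver pick their words independently given
  the codeword: any two individually typical words may meet, whatever their joint type, and that
  type is nearly a coupling. "Nearly" is made precise by subcouplings, which also give the
  continuity of the transport value in its marginals. Exactness requires the domination by
  \<open>\<pi>^n\<close> at every pair of words, so closeness in total variation is too weak.
  Typicality caps each codeword's contribution relative to the target; with exponentially more
  codewords than the cap, a single constraint fails with doubly exponentially small probability,
  which survives the union over exponentially many words.\<close>

abbreviation expect :: "'a pmf \<Rightarrow> ('a \<Rightarrow> real) \<Rightarrow> real"
  where "expect \<equiv> measure_pmf.expectation"

lemma expect_finite:
  "finite (set_pmf P) \<Longrightarrow> expect P f = (\<Sum>x\<in>set_pmf P. pmf P x * f x)"
  by (subst integral_measure_pmf_real[of "set_pmf P"]) (auto simp: mult.commute)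

lemma expect_superset:
  assumes "finite A" "set_pmf P \<subseteq> A"
  shows "expect P f = (\<Sum>x\<in>A. pmf P x * f x)"
  using assms by (subst integral_measure_pmf_real[of A]) (auto simp: mult.commute)

lemma expect_bind:
  assumes "finite (set_pmf P)" "\<And>x. x \<in> set_pmf P \<Longrightarrow> finite (set_pmf (K x))"
  shows "expect (bind_pmf P K) f = expect P (\<lambda>x. expect (K x) f)"
  using assms by (subst pmf_expectation_bind[of "set_pmf P"]) (auto simp: expect_finite)

lemma expect_cong:
  "(\<And>x. x \<in> set_pmf P \<Longrightarrow> f x = g x) \<Longrightarrow> expect P f = expect P g"
  by (intro integral_cong_AE) (auto simp: AE_measure_pmf_iff)

lemma expect_mono_finite:
  assumes "finite (set_pmf P)" "\<And>x. x \<in> set_pmf P \<Longrightarrow> f x \<le> g x"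
  shows "expect P f \<le> expect P g"
  using assms by (auto simp: expect_finite intro!: sum_mono mult_left_mono)

lemma expect_add_finite:
  assumes "finite (set_pmf P)"
  shows "expect P (\<lambda>x. f x + g x) = expect P f + expect P g"
  using assms by (simp add: expect_finite sum.distrib algebra_simps)

lemma expect_diff_finite:
  assumes "finite (set_pmf P)"
  shows "expect P (\<lambda>x. f x - g x) = expect P f - expect P g"
  using assms by (simp add: expect_finite sum_subtractf algebra_simps)

text \<open>Real-valued, so that entropies can be added and subtracted freely. It agrees with
  \<open>shannon_entropy\<close> on finite supports; where the entropy is infinite the integral
  defaults to 0.\<close>

definition ent :: "'a pmf \<Rightarrow> real" where
  "ent P = expect P (\<lambda>x. - ln (pmf P x))"

lemma ent_nonneg: "0 \<le> ent P"
  unfolding ent_def by (intro integral_nonneg_AE) (auto simp: AE_measure_pmf_iff pmf_le_1 pmf_positive)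

lemma ent_map_inj:
  assumes "inj_on f (set_pmf P)"
  shows "ent (map_pmf f P) = ent P"
  unfolding ent_def using assms by (auto intro!: expect_cong simp: pmf_map_inj)

abbreviation joint_law :: "'a pmf \<Rightarrow> ('a \<Rightarrow> 'b pmf) \<Rightarrow> ('a \<times> 'b) pmf"
  where "joint_law P K \<equiv> bind_pmf P (\<lambda>a. map_pmf (Pair a) (K a))"

lemma pmf_bind_Pair: "pmf (joint_law P K) (a, b) = pmf P a * pmf (K a) b"
proof -
  have "pmf (map_pmf (Pair a') (K a')) (a, b) = indicator {a} a' * pmf (K a) b" for a'
  proof (cases "a' = a")
    case True
    then show ?thesis using pmf_map_inj'[of "Pair a" "K a" b] by (auto simp: inj_on_def)
  next
    case False
    then have "(a, b) \<notin> set_pmf (map_pmf (Pair a') (K a'))" by auto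
    then have "pmf (map_pmf (Pair a') (K a')) (a, b) = 0" by (simp only: set_pmf_iff not_not)
    then show ?thesis using False by simp
  qed
  then show ?thesis
    by (simp add: pmf_bind measure_pmf_single)
qed

text \<open>The chain rule for entropy: on the support the logarithm of
  \<open>pmf P a * pmf (K a) b\<close> splits.\<close>

lemma ent_bind_Pair:
  assumes "finite (set_pmf P)" "\<And>a. a \<in> set_pmf P \<Longrightarrow> finite (set_pmf (K a))"
  shows "ent (joint_law P K) = ent P + expect P (\<lambda>a. ent (K a))"
proof -
  have "ent (joint_law P K)
      = expect P (\<lambda>a. expect (K a) (\<lambda>b. - ln (pmf P a * pmf (K a) b)))"
    unfolding ent_def using assms by (subst expect_bind) (auto simp: pmf_bind_Pair)
  also have "\<dots> = expect P (\<lambda>a. - ln (pmf P a) + ent (K a))"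
  proof (rule expect_cong)
    fix a assume a: "a \<in> set_pmf P"
    have "expect (K a) (\<lambda>b. - ln (pmf P a * pmf (K a) b)) = expect (K a) (\<lambda>b. - ln (pmf P a) + - ln (pmf (K a) b))"
      using a by (intro expect_cong) (simp add: ln_mult_pos pmf_positive)
    then show "expect (K a) (\<lambda>b. - ln (pmf P a * pmf (K a) b)) = - ln (pmf P a) + ent (K a)"
      unfolding ent_def using assms(2)[OF a] by (subst (asm) expect_add_finite) simp_all
  qed
  also have "\<dots> = ent P + expect P (\<lambda>a. ent (K a))"
    unfolding ent_def using assms(1) by (subst expect_add_finite) simp_all
  finally show ?thesis .
qed

lemma pmf_cond_law:
  assumes "a \<in> set_pmf (map_pmf fst P)"
  shows "pmf (cond_law P a) b = pmf P (a, b) / pmf (map_pmf fst P) a"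
proof -
  have ne: "set_pmf P \<inter> {z. fst z = a} \<noteq> {}" using assms by auto
  have inj: "inj_on snd (set_pmf (cond_pmf P {z. fst z = a}))"
    using ne by (auto simp: inj_on_def)
  have "pmf (cond_law P a) b = pmf (cond_pmf P {z. fst z = a}) (a, b)"
  proof (cases "(a, b) \<in> set_pmf P")
    case True
    then show ?thesis unfolding cond_law_def
      using pmf_map_inj[OF inj, of "(a,b)"] ne by simp
  next
    case False
    then have "b \<notin> set_pmf (cond_law P a)" unfolding cond_law_def using ne by auto
    with False show ?thesis by (simp add: set_pmf_iff pmf_cond[OF ne])
  qed
  also have "\<dots> = pmf P (a, b) / pmf (map_pmf fst P) a"
    using ne by (simp add: pmf_cond pmf_map vimage_def)
  finally show ?thesis .
qed

text \<open>Disintegration. Off the support of the first marginal \<open>cond_law\<close> is a junk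
  value, but there it has weight 0.\<close>

lemma bind_cond_law: "joint_law (map_pmf fst P) (cond_law P) = P"
proof (rule pmf_eqI)
  fix z :: "'a \<times> 'b"
  obtain a b where z: "z = (a, b)" by force
  show "pmf (joint_law (map_pmf fst P) (cond_law P)) z = pmf P z"
  proof (cases "a \<in> set_pmf (map_pmf fst P)")
    case True
    then have "pmf (map_pmf fst P) a \<noteq> 0" by (simp only: set_pmf_iff not_False_eq_True)
    with True show ?thesis by (simp add: z pmf_bind_Pair pmf_cond_law del: pmf_eq_0_set_pmf)
  next
    case False
    then have "(a, b) \<notin> set_pmf P" by force
    with False have "pmf P (a, b) = 0" "pmf (map_pmf fst P) a = 0" by (simp_all only: set_pmf_iff not_not)
    then show ?thesis by (simp add: z pmf_bind_Pair del: pmf_eq_0_set_pmf)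
  qed
qed

text \<open>Both couplings can be glued at once because \<open>a\<close> and \<open>d\<close> are
  drawn independently: given \<open>d\<close>, the law of \<open>a\<close> is still
  \<open>P1\<close>, the first marginal of \<open>T1 d\<close>; given \<open>a\<close>, the law of
  \<open>d\<close> is still \<open>Q2\<close>, the second marginal of \<open>T2 a\<close>.\<close>

lemma couplings_triangular:
  assumes T1: "\<And>d. d \<in> set_pmf Q2 \<Longrightarrow> T1 d \<in> couplings P1 (Q1 d)"
    and T2: "\<And>a. a \<in> set_pmf P1 \<Longrightarrow> T2 a \<in> couplings (P2 a) Q2"
  obtains T where
    "T \<in> couplings (joint_law P1 P2)
                   (bind_pmf Q2 (\<lambda>d. map_pmf (\<lambda>c. (c, d)) (Q1 d)))"
    "map_pmf (\<lambda>((a, b), (c, d)). (a, c)) T = bind_pmf Q2 T1"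
    "map_pmf (\<lambda>((a, b), (c, d)). (b, d)) T = bind_pmf P1 T2"
proof -
  define K1 where "K1 d a = cond_law (T1 d) a" for d a
  \<comment> \<open>\<open>T2 a\<close> is swapped because \<open>cond_law\<close> conditions on the
    first component, and here \<open>b\<close> is to be drawn given \<open>d\<close>.\<close>
  define K2 where "K2 a d = cond_law (map_pmf prod.swap (T2 a)) d" for a d
  have K1: "joint_law P1 (K1 d) = T1 d" if "d \<in> set_pmf Q2" for d
    using bind_cond_law[of "T1 d"] T1[OF that] by (simp add: couplings_def K1_def)
  have K2: "bind_pmf Q2 (\<lambda>d. map_pmf (\<lambda>b. (b, d)) (K2 a d)) = T2 a" if "a \<in> set_pmf P1" for a
  proof -
    have "map_pmf fst (map_pmf prod.swap (T2 a)) = Q2"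
      using T2[OF that] by (simp add: couplings_def map_pmf_comp fst_swap)
    then have "joint_law Q2 (K2 a) = map_pmf prod.swap (T2 a)"
      using bind_cond_law[of "map_pmf prod.swap (T2 a)"] by (simp add: K2_def)
    then have "map_pmf prod.swap (joint_law Q2 (K2 a))
       = map_pmf prod.swap (map_pmf prod.swap (T2 a))" by simp
    then show ?thesis by (simp add: map_bind_pmf map_pmf_comp)
  qed
  define T where "T = do {a \<leftarrow> P1; d \<leftarrow> Q2; c \<leftarrow> K1 d a; b \<leftarrow> K2 a d; return_pmf ((a, b), (c, d))}"
  have ac: "map_pmf (\<lambda>((a, b), (c, d)). ((a, c), d)) T
      = bind_pmf Q2 (\<lambda>d. map_pmf (\<lambda>z. (z, d)) (T1 d))"
  proof -
    have "map_pmf (\<lambda>((a, b), (c, d)). ((a, c), d)) T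
        = do {a \<leftarrow> P1; d \<leftarrow> Q2; map_pmf (\<lambda>c. ((a, c), d)) (K1 d a)}"
      by (simp add: T_def map_bind_pmf map_pmf_def bind_assoc_pmf bind_return_pmf)
    also have "\<dots> = do {d \<leftarrow> Q2; a \<leftarrow> P1; map_pmf (\<lambda>c. ((a, c), d)) (K1 d a)}"
      by (rule bind_commute_pmf)
    also have "\<dots> = do {d \<leftarrow> Q2; map_pmf (\<lambda>z. (z, d)) (joint_law P1 (K1 d))}"
      by (simp add: map_bind_pmf map_pmf_comp)
    also have "\<dots> = do {d \<leftarrow> Q2; map_pmf (\<lambda>z. (z, d)) (T1 d)}"
      by (rule bind_pmf_cong) (simp_all add: K1)
    finally show ?thesis .
  qed
  have bd: "map_pmf (\<lambda>((a, b), (c, d)). (a, (b, d))) T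
      = joint_law P1 T2"
  proof -
    have "map_pmf (\<lambda>((a, b), (c, d)). (a, (b, d))) T
        = do {a \<leftarrow> P1; d \<leftarrow> Q2; map_pmf (\<lambda>b. (a, (b, d))) (K2 a d)}"
      by (simp add: T_def map_bind_pmf map_pmf_def bind_assoc_pmf bind_return_pmf)
    also have "\<dots> = do {a \<leftarrow> P1; map_pmf (Pair a) (bind_pmf Q2 (\<lambda>d. map_pmf (\<lambda>b. (b, d)) (K2 a d)))}"
      by (simp add: map_bind_pmf map_pmf_comp)
    also have "\<dots> = do {a \<leftarrow> P1; map_pmf (Pair a) (T2 a)}"
      by (rule bind_pmf_cong) (simp_all add: K2)
    finally show ?thesis .
  qed
  show ?thesis
  proof (rule that)
    have "map_pmf fst T = map_pmf (\<lambda>(a, (b, d)). (a, b)) (map_pmf (\<lambda>((a, b), (c, d)). (a, (b, d))) T)"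
      by (simp add: map_pmf_comp case_prod_unfold)
    also have "\<dots> = bind_pmf P1 (\<lambda>a. map_pmf (Pair a) (map_pmf fst (T2 a)))"
      unfolding bd by (simp add: map_bind_pmf map_pmf_comp case_prod_unfold)
    also have "\<dots> = joint_law P1 P2"
      using T2 by (intro bind_pmf_cong) (simp_all add: couplings_def)
    finally have 1: "map_pmf fst T = joint_law P1 P2" .
    have "map_pmf snd T = map_pmf (\<lambda>((a, c), d). (c, d)) (map_pmf (\<lambda>((a, b), (c, d)). ((a, c), d)) T)"
      by (simp add: map_pmf_comp case_prod_unfold)
    also have "\<dots> = bind_pmf Q2 (\<lambda>d. map_pmf (\<lambda>c. (c, d)) (map_pmf snd (T1 d)))"
      unfolding ac by (simp add: map_bind_pmf map_pmf_comp case_prod_unfold)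
    also have "\<dots> = bind_pmf Q2 (\<lambda>d. map_pmf (\<lambda>c. (c, d)) (Q1 d))"
      using T1 by (intro bind_pmf_cong) (simp_all add: couplings_def)
    finally have 2: "map_pmf snd T = bind_pmf Q2 (\<lambda>d. map_pmf (\<lambda>c. (c, d)) (Q1 d))" .
    show "T \<in> couplings (joint_law P1 P2)
                   (bind_pmf Q2 (\<lambda>d. map_pmf (\<lambda>c. (c, d)) (Q1 d)))"
      using 1 2 by (simp add: couplings_def)
    have "map_pmf (\<lambda>((a, b), (c, d)). (a, c)) T = map_pmf fst (map_pmf (\<lambda>((a, b), (c, d)). ((a, c), d)) T)"
      by (simp add: map_pmf_comp case_prod_unfold)
    then show "map_pmf (\<lambda>((a, b), (c, d)). (a, c)) T = bind_pmf Q2 T1"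
      unfolding ac by (simp add: map_bind_pmf map_pmf_comp)
    have "map_pmf (\<lambda>((a, b), (c, d)). (b, d)) T = map_pmf snd (map_pmf (\<lambda>((a, b), (c, d)). (a, (b, d))) T)"
      by (simp add: map_pmf_comp case_prod_unfold)
    then show "map_pmf (\<lambda>((a, b), (c, d)). (b, d)) T = bind_pmf P1 T2"
      unfolding bd by (simp add: map_bind_pmf map_pmf_comp)
  qed
qed

section \<open>Tensorization\<close>

text \<open>Real-valued counterpart of \<open>max_transport\<close>. A supremum of reals is
  meaningful only for a bounded set, whence the bound \<open>B\<close> on the cost in
  \<open>transport_sup_upper\<close>.\<close>

definition transport_sup :: "('a \<times> 'b \<Rightarrow> real) \<Rightarrow> 'a pmf \<Rightarrow> 'b pmf \<Rightarrow> real" where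
  "transport_sup c P Q = (SUP T\<in>couplings P Q. expect T c)"

lemma pair_pmf_in_couplings: "pair_pmf P Q \<in> couplings P Q"
  by (simp add: couplings_def map_fst_pair_pmf map_snd_pair_pmf)

lemma set_pmf_coupling:
  assumes "T \<in> couplings P Q"
  shows "set_pmf T \<subseteq> set_pmf P \<times> set_pmf Q"
  using assms unfolding couplings_def by (force simp: mem_Times_iff)

lemma finite_coupling:
  assumes "T \<in> couplings P Q" "finite (set_pmf P)" "finite (set_pmf Q)"
  shows "finite (set_pmf T)"
  using finite_subset[OF set_pmf_coupling[OF assms(1)]] assms by simp

lemma expect_le_const:
  assumes "finite (set_pmf P)" "\<And>x. x \<in> set_pmf P \<Longrightarrow> f x \<le> B"
  shows "expect P f \<le> B"
  using expect_mono_finite[OF assms(1), of f "\<lambda>_. B"] assms(2) by simp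

lemma expect_ge_const:
  assumes "finite (set_pmf P)" "\<And>x. x \<in> set_pmf P \<Longrightarrow> B \<le> f x"
  shows "B \<le> expect P f"
  using expect_mono_finite[OF assms(1), of "\<lambda>_. B" f] assms(2) by simp

lemma bdd_above_transport:
  assumes "finite (set_pmf P)" "finite (set_pmf Q)" "\<And>z. c z \<le> B"
  shows "bdd_above ((\<lambda>T. expect T c) ` couplings P Q)"
  using assms by (intro bdd_aboveI2[where M = B] expect_le_const) (auto dest: finite_coupling)

lemma transport_sup_upper:
  assumes "finite (set_pmf P)" "finite (set_pmf Q)" "\<And>z. c z \<le> B" "T \<in> couplings P Q"
  shows "expect T c \<le> transport_sup c P Q"
  unfolding transport_sup_def
  by (rule cSUP_upper[OF assms(4) bdd_above_transport[of P Q c B, OF assms(1-3)]])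

lemma transport_sup_least:
  assumes "\<And>T. T \<in> couplings P Q \<Longrightarrow> expect T c \<le> B"
  shows "transport_sup c P Q \<le> B"
  unfolding transport_sup_def using pair_pmf_in_couplings by (intro cSUP_least) (auto intro: assms)

text \<open>Couplings optimal up to \<open>e\<close> stand in for maximisers; the set of couplings
  is nonempty because it contains the product.\<close>

lemma transport_sup_approx:
  assumes "e > 0"
  obtains T where "T \<in> couplings P Q" "transport_sup c P Q - e \<le> expect T c"
proof -
  have ne: "(\<lambda>T. expect T c) ` couplings P Q \<noteq> {}" using pair_pmf_in_couplings by blast
  have "transport_sup c P Q - e < Sup ((\<lambda>T. expect T c) ` couplings P Q)"
    using assms by (simp add: transport_sup_def)
  then obtain x where x: "x \<in> (\<lambda>T. expect T c) ` couplings P Q" "transport_sup c P Q - e < x"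
    by (rule less_cSupE[OF _ ne])
  then obtain T where "T \<in> couplings P Q" "x = expect T c" by blast
  with x(2) show ?thesis by (intro that[of T]) auto
qed

text \<open>The two letters are coupled through the independent pair (first letter on the left, second
  letter on the right), so the averages on the left are over product measures.\<close>

lemma transport_sup_superadditive:
  fixes c1 :: "'a \<times> 'c \<Rightarrow> real" and c2 :: "'b \<times> 'd \<Rightarrow> real"
  assumes fin: "finite (set_pmf P1)" "finite (set_pmf Q2)"
    "\<And>a. a \<in> set_pmf P1 \<Longrightarrow> finite (set_pmf (P2 a))" "\<And>d. d \<in> set_pmf Q2 \<Longrightarrow> finite (set_pmf (Q1 d))"
    and B: "\<And>T. T \<in> couplings (joint_law P1 P2)
                   (bind_pmf Q2 (\<lambda>d. map_pmf (\<lambda>c. (c, d)) (Q1 d)))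
      \<Longrightarrow> expect T (\<lambda>((a, b), (c, d)). c1 (a, c) + c2 (b, d)) \<le> B"
  shows "expect Q2 (\<lambda>d. transport_sup c1 P1 (Q1 d)) + expect P1 (\<lambda>a. transport_sup c2 (P2 a) Q2) \<le> B"
proof (rule field_le_epsilon)
  fix e :: real assume e: "e > 0"
  define s1 where "s1 d = transport_sup c1 P1 (Q1 d)" for d
  define s2 where "s2 a = transport_sup c2 (P2 a) Q2" for a
  have "\<exists>T. T \<in> couplings P1 (Q1 d) \<and> s1 d - e/2 \<le> expect T c1" for d
    using transport_sup_approx[of "e/2" P1 "Q1 d" c1] e by (auto simp: s1_def)
  then obtain T1 where T1: "\<And>d. T1 d \<in> couplings P1 (Q1 d)" "\<And>d. s1 d - e/2 \<le> expect (T1 d) c1" by metis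
  have "\<exists>T. T \<in> couplings (P2 a) Q2 \<and> s2 a - e/2 \<le> expect T c2" for a
    using transport_sup_approx[of "e/2" "P2 a" Q2 c2] e by (auto simp: s2_def)
  then obtain T2 where T2: "\<And>a. T2 a \<in> couplings (P2 a) Q2" "\<And>a. s2 a - e/2 \<le> expect (T2 a) c2" by metis
  obtain T where T: "T \<in> couplings (joint_law P1 P2)
                   (bind_pmf Q2 (\<lambda>d. map_pmf (\<lambda>c. (c, d)) (Q1 d)))"
    "map_pmf (\<lambda>((a, b), (c, d)). (a, c)) T = bind_pmf Q2 T1"
    "map_pmf (\<lambda>((a, b), (c, d)). (b, d)) T = bind_pmf P1 T2"
    using couplings_triangular[of Q2 T1 P1 Q1 T2 P2, OF T1(1) T2(1)] by blast
  have finT: "finite (set_pmf T)"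
    using fin by (intro finite_coupling[OF T(1)]) auto
  have fT1: "finite (set_pmf (T1 d))" if "d \<in> set_pmf Q2" for d
    using finite_coupling[OF T1(1) fin(1) fin(4)[OF that]] .
  have fT2: "finite (set_pmf (T2 a))" if "a \<in> set_pmf P1" for a
    using finite_coupling[OF T2(1) fin(3)[OF that] fin(2)] .
  have "expect Q2 s1 - e/2 + (expect P1 s2 - e/2)
      = expect Q2 (\<lambda>d. s1 d - e/2) + expect P1 (\<lambda>a. s2 a - e/2)"
    using fin by (simp add: expect_diff_finite)
  also have "\<dots> \<le> expect Q2 (\<lambda>d. expect (T1 d) c1) + expect P1 (\<lambda>a. expect (T2 a) c2)"
    using fin T1 T2 by (intro add_mono expect_mono_finite) auto
  also have "\<dots> = expect (bind_pmf Q2 T1) c1 + expect (bind_pmf P1 T2) c2"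
    using fin fT1 fT2 by (simp add: expect_bind)
  also have "\<dots> = expect T (\<lambda>((a, b), (c, d)). c1 (a, c)) + expect T (\<lambda>((a, b), (c, d)). c2 (b, d))"
    unfolding T(2,3)[symmetric] by (simp add: case_prod_unfold)
  also have "\<dots> = expect T (\<lambda>((a, b), (c, d)). c1 (a, c) + c2 (b, d))"
    using expect_add_finite[OF finT] by (simp add: case_prod_unfold)
  also have "\<dots> \<le> B" by (rule B[OF T(1)])
  finally show "expect Q2 (\<lambda>d. transport_sup c1 P1 (Q1 d)) + expect P1 (\<lambda>a. transport_sup c2 (P2 a) Q2) \<le> B + e"
    by (simp add: s1_def[abs_def] s2_def[abs_def])
qed

text \<open>The convention \<open>ln 0 = 0\<close> makes the cost vanish, instead of being infinite, off the support of
  \<open>\<pi>\<close>; conditions on supports are therefore imposed separately.\<close>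

definition cost :: "('x \<times> 'y) pmf \<Rightarrow> 'x \<times> 'y \<Rightarrow> real" where
  "cost \<pi> z = - ln (pmf \<pi> z)"

section \<open>Single-letter triples of product law, entropy and \<Phi>\<close>

definition cost_max :: "('x::finite \<times> 'y::finite) pmf \<Rightarrow> real" where
  "cost_max \<pi> = Max (range (cost \<pi>))"

lemma cost_nonneg: "0 \<le> cost \<pi> z"
  by (cases "pmf \<pi> z = 0") (auto simp: cost_def pmf_le_1 pmf_positive)

lemma cost_le_max: "cost \<pi> z \<le> cost_max \<pi>"
  unfolding cost_max_def by (intro Max_ge) auto

lemma cost_max_nonneg: "0 \<le> cost_max \<pi>"
  using cost_le_max cost_nonneg order_trans by blast

text \<open>As vectors, product laws can be averaged: that a mixture of products over
  \<open>W\<close> equals \<pi> becomes a linear condition on a point of the convex hull.\<close>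

definition prod_vec :: "'x::finite pmf \<Rightarrow> 'y::finite pmf \<Rightarrow> real ^ ('x \<times> 'y)" where
  "prod_vec P Q = (\<chi> z. pmf P (fst z) * pmf Q (snd z))"

text \<open>Triples \<open>(P \<otimes> Q, - H(P), t)\<close> with \<open>\<Phi>(P, Q) \<le> t\<close>. The bound on \<open>t\<close> makes the set compact; it loses
  nothing, since finite values of \<open>\<Phi>\<close> are at most \<open>cost_max \<pi>\<close>.\<close>

definition rate_set :: "('x::finite \<times> 'y::finite) pmf \<Rightarrow> ((real ^ ('x \<times> 'y)) \<times> real \<times> real) set" where
  "rate_set \<pi> = {(prod_vec P Q, - ent P, t) | P Q t.
     set_pmf P \<times> set_pmf Q \<subseteq> set_pmf \<pi> \<and> transport_sup (cost \<pi>) P Q \<le> t + ent P + ent Q \<and> t \<le> cost_max \<pi>}"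

lemma rate_setI:
  assumes "set_pmf P \<times> set_pmf Q \<subseteq> set_pmf \<pi>"
  shows "(prod_vec P Q, - ent P, transport_sup (cost \<pi>) P Q - ent P - ent Q) \<in> rate_set \<pi>"
proof -
  have "transport_sup (cost \<pi>) P Q \<le> cost_max \<pi>"
    by (intro transport_sup_least expect_le_const) (auto intro: cost_le_max)
  then have "transport_sup (cost \<pi>) P Q - ent P - ent Q \<le> cost_max \<pi>"
    using ent_nonneg[of P] ent_nonneg[of Q] by linarith
  then show ?thesis unfolding rate_set_def using assms by force
qed

lemma rate_set_nonempty: "rate_set \<pi> \<noteq> {}"
proof -
  obtain x y where "(x, y) \<in> set_pmf \<pi>" using set_pmf_not_empty[of \<pi>] by force
  then show ?thesis using rate_setI[of "return_pmf x" "return_pmf y" \<pi>] by auto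
qed

section \<open>Reduction from words to letters\<close>

definition block_cost :: "('x \<times> 'y) pmf \<Rightarrow> nat \<Rightarrow> 'x list \<times> 'y list \<Rightarrow> real" where
  "block_cost \<pi> n z = (\<Sum>i<n. cost \<pi> (fst z ! i, snd z ! i))"

lemma finite_words: "finite {xs :: 'a::finite list. length xs = n}"
  using finite_lists_length_eq[of "UNIV :: 'a set" n] by simp

lemma finite_lists_pmf:
  assumes "set_pmf P \<subseteq> {xs :: 'x::finite list. length xs = n}"
  shows "finite (set_pmf P)"
  using finite_words assms by (auto intro: finite_subset)

lemma convex_expect:
  fixes C :: "((real ^ 'k::finite) \<times> real \<times> real) set"
  assumes "convex C" "finite (set_pmf P)" "\<And>a. a \<in> set_pmf P \<Longrightarrow> (v a, h a, t a) \<in> C"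
  shows "((\<chi> z. expect P (\<lambda>a. v a $ z)), expect P h, expect P t) \<in> C"
proof -
  have "(\<Sum>a\<in>set_pmf P. pmf P a *\<^sub>R (v a, h a, t a)) \<in> C"
    using assms by (intro convex_sum) (auto simp: sum_pmf_eq_1)
  also have "(\<Sum>a\<in>set_pmf P. pmf P a *\<^sub>R (v a, h a, t a)) = ((\<chi> z. expect P (\<lambda>a. v a $ z)), expect P h, expect P t)"
    using assms(2) by (auto simp: prod_eq_iff fst_sum snd_sum expect_finite vec_eq_iff)
  finally show ?thesis .
qed

text \<open>Each induction step splits off one letter and mixes single-letter triples over
  \<open>d\<close> with hull points for the tails over \<open>a\<close>. The average over
  \<open>d\<close> touches only the Y factor and that over \<open>a\<close> only the X factor, so
  products of unconditional letter marginals come out. The X entropy must be tracked exactly, since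
  it later yields the mutual information; the Y entropy enters only through \<open>t\<close>.
  Multiplying by \<open>n\<close> instead of dividing keeps the empty word inside the
  induction.\<close>

theorem rate_set_tensor:
  fixes \<pi> :: "('x::finite \<times> 'y::finite) pmf"
  assumes "set_pmf P \<subseteq> {xs. length xs = n}" "set_pmf Q \<subseteq> {ys. length ys = n}"
    and "\<And>xs ys i. xs \<in> set_pmf P \<Longrightarrow> ys \<in> set_pmf Q \<Longrightarrow> i < n \<Longrightarrow> (xs ! i, ys ! i) \<in> set_pmf \<pi>"
    and "\<And>T. T \<in> couplings P Q \<Longrightarrow> expect T (block_cost \<pi> n) \<le> t + ent P + ent Q"
  shows "\<exists>v h s. (v, h, s) \<in> convex hull (rate_set \<pi>) \<and>
    (\<forall>x y. real n * v $ (x, y) = (\<Sum>i<n. pmf (map_pmf (\<lambda>xs. xs ! i) P) x * pmf (map_pmf (\<lambda>ys. ys ! i) Q) y)) \<and>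
    real n * h = - ent P \<and> real n * s \<le> t"
  using assms
proof (induction n arbitrary: P Q t)
  case 0
  then have PQ: "P = return_pmf []" "Q = return_pmf []"
    by (simp_all add: set_pmf_subset_singleton)
  \<comment> \<open>For \<open>n = 0\<close> the other conclusions read 0 = 0, so any hull point
    will do; the cost and both entropies of the empty word vanish.\<close>
  have "0 \<le> t"
    using "0.prems"(4)[OF pair_pmf_in_couplings] by (simp add: PQ ent_def block_cost_def)
  moreover obtain v h s where "(v, h, s) \<in> convex hull (rate_set \<pi>)"
    using rate_set_nonempty[of \<pi>] by (metis convex_hull_eq_empty ex_in_conv prod_cases3)
  ultimately show ?case by (auto simp: PQ ent_def)
next
  case (Suc n)
  let ?C = "convex hull (rate_set \<pi>)"
  have finP: "finite (set_pmf P)" and finQ: "finite (set_pmf Q)"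
    using Suc.prems(1,2) by (auto intro: finite_lists_pmf)
  \<comment> \<open>\<open>P\<close> is disintegrated by its first letter and \<open>Q\<close> by
    its tail, as the triangular coupling requires; hence the opposite orders of head and
    tail.\<close>
  define P' where "P' = map_pmf (\<lambda>l. (hd l, tl l)) P"
  define Q' where "Q' = map_pmf (\<lambda>l. (tl l, hd l)) Q"
  define P1 where "P1 = map_pmf fst P'"
  define Q2 where "Q2 = map_pmf fst Q'"
  define P2 where "P2 = cond_law P'"
  define Q1 where "Q1 = cond_law Q'"
  define PP where "PP = joint_law P1 P2"
  define QQ where "QQ = bind_pmf Q2 (\<lambda>d. map_pmf (\<lambda>c. (c, d)) (Q1 d))"
  have PP: "PP = P'" unfolding PP_def P1_def P2_def by (rule bind_cond_law)
  have QQ': "QQ = map_pmf prod.swap Q'"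
  proof -
    have "map_pmf prod.swap Q' = map_pmf prod.swap (joint_law Q2 Q1)"
      unfolding Q2_def Q1_def by (simp only: bind_cond_law)
    then show ?thesis by (simp add: map_bind_pmf map_pmf_comp QQ_def)
  qed
  have P_eq: "P = map_pmf (\<lambda>(a, b). a # b) PP"
  proof -
    have "map_pmf (\<lambda>l. hd l # tl l) P = map_pmf (\<lambda>l. l) P"
      using Suc.prems(1) by (intro map_pmf_cong) (auto simp: hd_Cons_tl length_Suc_conv)
    then show ?thesis by (simp add: PP P'_def map_pmf_comp)
  qed
  have Q_eq: "Q = map_pmf (\<lambda>(a, b). a # b) QQ"
  proof -
    have "map_pmf (\<lambda>l. hd l # tl l) Q = map_pmf (\<lambda>l. l) Q"
      using Suc.prems(2) by (intro map_pmf_cong) (auto simp: hd_Cons_tl length_Suc_conv)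
    then show ?thesis by (simp add: QQ' Q'_def map_pmf_comp)
  qed
  have finP': "finite (set_pmf P')" and finQ': "finite (set_pmf Q')"
    using finP finQ by (simp_all add: P'_def Q'_def)
  have setPP: "set_pmf PP = {(a, b). a \<in> set_pmf P1 \<and> b \<in> set_pmf (P2 a)}"
    by (auto simp: PP_def)
  have setQQ: "set_pmf QQ = {(c, d). d \<in> set_pmf Q2 \<and> c \<in> set_pmf (Q1 d)}"
    by (auto simp: QQ_def)
  have fin1: "finite (set_pmf P1)" "finite (set_pmf Q2)"
    using finP' finQ' by (simp_all add: P1_def Q2_def)
  have fin2: "finite (set_pmf (P2 a))" if "a \<in> set_pmf P1" for a
  proof -
    have "set_pmf (P2 a) \<subseteq> snd ` set_pmf PP" using that by (force simp: setPP)
    then show ?thesis using finP' PP finite_subset by blast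
  qed
  have setP: "a # b \<in> set_pmf P" if "a \<in> set_pmf P1" "b \<in> set_pmf (P2 a)" for a b
    using that by (auto simp: P_eq setPP)
  have setQ: "c # d \<in> set_pmf Q" if "d \<in> set_pmf Q2" "c \<in> set_pmf (Q1 d)" for c d
    using that by (auto simp: Q_eq setQQ)
  have entP: "ent P = ent P1 + expect P1 (\<lambda>a. ent (P2 a))"
  proof -
    have "ent P = ent PP" unfolding P_eq by (rule ent_map_inj) (auto simp: inj_on_def)
    then show ?thesis unfolding PP_def using fin1 fin2 by (simp add: ent_bind_Pair)
  qed
  have entQ: "ent Q = ent Q2 + expect Q2 (\<lambda>d. ent (Q1 d))"
  proof -
    have "ent Q = ent QQ" unfolding Q_eq by (rule ent_map_inj) (auto simp: inj_on_def)
    also have "\<dots> = ent Q'" unfolding QQ' by (rule ent_map_inj) (auto simp: inj_on_def)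
    also have "Q' = joint_law Q2 Q1"
      unfolding Q2_def Q1_def by (simp only: bind_cond_law)
    finally show ?thesis using fin1 by (simp add: ent_bind_Pair)
  qed
  define s1 where "s1 d = transport_sup (cost \<pi>) P1 (Q1 d)" for d
  define s2 where "s2 a = transport_sup (block_cost \<pi> n) (P2 a) Q2" for a
  have super: "expect Q2 s1 + expect P1 s2 \<le> t + ent P + ent Q"
    unfolding s1_def s2_def
  proof (rule transport_sup_superadditive)
    fix T assume T: "T \<in> couplings (joint_law P1 P2)
                   (bind_pmf Q2 (\<lambda>d. map_pmf (\<lambda>c. (c, d)) (Q1 d)))"
    define T' where "T' = map_pmf (\<lambda>((a, b), (c, d)). (a # b, c # d)) T"
    have "T' \<in> couplings P Q"
      using T unfolding couplings_def P_eq Q_eq PP_def[symmetric] QQ_def[symmetric] T'_def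
      by (auto simp: map_pmf_comp case_prod_unfold)
    then have "expect T' (block_cost \<pi> (Suc n)) \<le> t + ent P + ent Q" by (rule Suc.prems(4))
    then show "expect T (\<lambda>((a, b), c, d). cost \<pi> (a, c) + block_cost \<pi> n (b, d)) \<le> t + ent P + ent Q"
      by (simp add: T'_def case_prod_unfold block_cost_def sum.lessThan_Suc_shift del: sum.lessThan_Suc)
  qed (use fin1 fin2 in auto)
  \<comment> \<open>The induction hypothesis is used with
    \<open>t = s2 a - ent (P2 a) - ent Q2\<close>, the value of \<Phi> on the tails, so that its
    coupling condition is the upper bound property of the supremum \<open>s2 a\<close>.\<close>
  have IH: "\<exists>v h s. (v, h, s) \<in> ?C \<and>
    (\<forall>x y. real n * v $ (x, y) = (\<Sum>i<n. pmf (map_pmf (\<lambda>xs. xs ! i) (P2 a)) x * pmf (map_pmf (\<lambda>ys. ys ! i) Q2) y)) \<and>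
    real n * h = - ent (P2 a) \<and> real n * s \<le> s2 a - ent (P2 a) - ent Q2" if a: "a \<in> set_pmf P1" for a
  proof (rule Suc.IH)
    show "set_pmf (P2 a) \<subseteq> {xs. length xs = n}"
      using setP[OF a] Suc.prems(1) by force
    show "set_pmf Q2 \<subseteq> {ys. length ys = n}"
    proof
      fix d assume d: "d \<in> set_pmf Q2"
      obtain c where "c \<in> set_pmf (Q1 d)" using set_pmf_not_empty by fast
      then show "d \<in> {ys. length ys = n}" using setQ[OF d] Suc.prems(2) by force
    qed
    show "(xs ! i, ys ! i) \<in> set_pmf \<pi>" if "xs \<in> set_pmf (P2 a)" "ys \<in> set_pmf Q2" "i < n" for xs ys i
    proof -
      obtain c where "c \<in> set_pmf (Q1 ys)" using set_pmf_not_empty by fast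
      then show ?thesis using Suc.prems(3)[OF setP[OF a that(1)] setQ[OF that(2)], of c "Suc i"] that by simp
    qed
    fix T assume T: "T \<in> couplings (P2 a) Q2"
    have "block_cost \<pi> n z \<le> real n * cost_max \<pi>" for z
      unfolding block_cost_def using sum_bounded_above[of "{..<n}" "\<lambda>i. cost \<pi> (fst z ! i, snd z ! i)" "cost_max \<pi>"]
      by (simp add: cost_le_max)
    then have "expect T (block_cost \<pi> n) \<le> s2 a"
      unfolding s2_def using T fin1 fin2[OF a] by (intro transport_sup_upper) auto
    then show "expect T (block_cost \<pi> n) \<le> s2 a - ent (P2 a) - ent Q2 + ent (P2 a) + ent Q2" by simp
  qed
  define good where "good a z \<longleftrightarrow> z \<in> ?C \<and>
    (\<forall>x y. real n * fst z $ (x, y) = (\<Sum>i<n. pmf (map_pmf (\<lambda>xs. xs ! i) (P2 a)) x * pmf (map_pmf (\<lambda>ys. ys ! i) Q2) y)) \<and>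
    real n * fst (snd z) = - ent (P2 a) \<and> real n * snd (snd z) \<le> s2 a - ent (P2 a) - ent Q2" for a z
  have "\<forall>a. \<exists>z. a \<in> set_pmf P1 \<longrightarrow> good a z"
  proof
    fix a
    show "\<exists>z. a \<in> set_pmf P1 \<longrightarrow> good a z"
    proof (cases "a \<in> set_pmf P1")
      case True
      from IH[OF True] obtain v h s where "good a (v, h, s)" unfolding good_def fst_conv snd_conv by blast
      then show ?thesis by blast
    qed simp
  qed
  from choice[OF this] obtain z where z: "\<And>a. a \<in> set_pmf P1 \<Longrightarrow> good a (z a)"
    by blast
  define v h s where "v = fst \<circ> z" and "h = fst \<circ> snd \<circ> z" and "s = snd \<circ> snd \<circ> z"
  have vhs: "(v a, h a, s a) \<in> ?C"
    "real n * v a $ (x, y) = (\<Sum>i<n. pmf (map_pmf (\<lambda>xs. xs ! i) (P2 a)) x * pmf (map_pmf (\<lambda>ys. ys ! i) Q2) y)"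
    "real n * h a = - ent (P2 a)" "real n * s a \<le> s2 a - ent (P2 a) - ent Q2" if "a \<in> set_pmf P1" for a x y
    using z[OF that] unfolding good_def by (simp_all add: v_def h_def s_def)
  have tail: "((\<chi> z. expect P1 (\<lambda>a. v a $ z)), expect P1 h, expect P1 s) \<in> ?C"
    using fin1 vhs(1) by (intro convex_expect) auto
  have "(prod_vec P1 (Q1 d), - ent P1, s1 d - ent P1 - ent (Q1 d)) \<in> rate_set \<pi>" if d: "d \<in> set_pmf Q2" for d
    unfolding s1_def
  proof (rule rate_setI, clarify)
    fix x y assume x: "x \<in> set_pmf P1" and y: "y \<in> set_pmf (Q1 d)"
    obtain b where "b \<in> set_pmf (P2 x)" using set_pmf_not_empty by fast
    from Suc.prems(3)[OF setP[OF x this] setQ[OF d y], of 0] show "(x, y) \<in> set_pmf \<pi>" by simp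
  qed
  then have head: "((\<chi> z. expect Q2 (\<lambda>d. prod_vec P1 (Q1 d) $ z)), expect Q2 (\<lambda>d. - ent P1),
      expect Q2 (\<lambda>d. s1 d - ent P1 - ent (Q1 d))) \<in> ?C"
    using fin1 by (intro convex_expect) (auto intro: hull_inc)
  \<comment> \<open>Weight \<open>1 / (n + 1)\<close> for the split-off letter and
    \<open>n / (n + 1)\<close> for the tail, each already averaged over \<open>d\<close> or
    \<open>a\<close>.\<close>
  define V where "V = (\<chi> z. (expect Q2 (\<lambda>d. prod_vec P1 (Q1 d) $ z) + real n * expect P1 (\<lambda>a. v a $ z)) / real (Suc n))"
  define H where "H = (- ent P1 + real n * expect P1 h) / real (Suc n)"
  define S where "S = (expect Q2 (\<lambda>d. s1 d - ent P1 - ent (Q1 d)) + real n * expect P1 s) / real (Suc n)"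
  have "(V, H, S) \<in> ?C"
  proof -
    have "(1 / real (Suc n)) *\<^sub>R ((\<chi> z. expect Q2 (\<lambda>d. prod_vec P1 (Q1 d) $ z)), expect Q2 (\<lambda>d. - ent P1),
      expect Q2 (\<lambda>d. s1 d - ent P1 - ent (Q1 d))) + (real n / real (Suc n)) *\<^sub>R
      ((\<chi> z. expect P1 (\<lambda>a. v a $ z)), expect P1 h, expect P1 s) \<in> ?C"
      by (rule convexD[OF convex_convex_hull head tail]) (auto simp: field_simps)
    also have "(1 / real (Suc n)) *\<^sub>R ((\<chi> z. expect Q2 (\<lambda>d. prod_vec P1 (Q1 d) $ z)), expect Q2 (\<lambda>d. - ent P1),
      expect Q2 (\<lambda>d. s1 d - ent P1 - ent (Q1 d))) + (real n / real (Suc n)) *\<^sub>R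
      ((\<chi> z. expect P1 (\<lambda>a. v a $ z)), expect P1 h, expect P1 s) = (V, H, S)"
      by (simp add: V_def H_def S_def vec_eq_iff add_divide_distrib diff_divide_distrib)
    finally show ?thesis .
  qed
  moreover have "real (Suc n) * V $ (x, y) =
      (\<Sum>i<Suc n. pmf (map_pmf (\<lambda>xs. xs ! i) P) x * pmf (map_pmf (\<lambda>ys. ys ! i) Q) y)" for x y
  proof -
    have P0: "map_pmf (\<lambda>xs. xs ! 0) P = P1"
      unfolding P_eq PP P1_def by (simp add: map_pmf_comp case_prod_unfold)
    have Q0: "map_pmf (\<lambda>ys. ys ! 0) Q = bind_pmf Q2 Q1"
      unfolding Q_eq QQ_def by (simp add: map_bind_pmf map_pmf_comp case_prod_unfold)
    have Pi: "map_pmf (\<lambda>xs. xs ! Suc i) P = bind_pmf P1 (\<lambda>a. map_pmf (\<lambda>xs. xs ! i) (P2 a))" for i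
      unfolding P_eq PP_def by (simp add: map_bind_pmf map_pmf_comp case_prod_unfold)
    have Qi: "map_pmf (\<lambda>ys. ys ! Suc i) Q = map_pmf (\<lambda>ys. ys ! i) Q2" for i
    proof -
      have "map_pmf (\<lambda>ys. ys ! i) Q2 = map_pmf (\<lambda>ys. ys ! i) (map_pmf snd QQ)"
        by (simp add: QQ' Q2_def map_pmf_comp)
      then show ?thesis unfolding Q_eq by (simp add: map_pmf_comp case_prod_unfold)
    qed
    have "real (Suc n) * V $ (x, y)
        = expect Q2 (\<lambda>d. pmf P1 x * pmf (Q1 d) y) + expect P1 (\<lambda>a. real n * v a $ (x, y))"
      by (simp add: V_def prod_vec_def)
    also have "expect Q2 (\<lambda>d. pmf P1 x * pmf (Q1 d) y) = pmf P1 x * pmf (bind_pmf Q2 Q1) y"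
      by (simp add: pmf_bind)
    also have "expect P1 (\<lambda>a. real n * v a $ (x, y)) =
      expect P1 (\<lambda>a. \<Sum>i<n. pmf (map_pmf (\<lambda>xs. xs ! i) (P2 a)) x * pmf (map_pmf (\<lambda>ys. ys ! i) Q2) y)"
      by (intro expect_cong vhs(2))
    also have "\<dots> = (\<Sum>i<n. pmf (bind_pmf P1 (\<lambda>a. map_pmf (\<lambda>xs. xs ! i) (P2 a))) x * pmf (map_pmf (\<lambda>ys. ys ! i) Q2) y)"
      using fin1 by (simp add: pmf_bind expect_finite sum_distrib_left sum_distrib_right sum.swap[of _ "{..<n}"] mult.assoc)
    finally show ?thesis
      by (simp only: sum.lessThan_Suc_shift P0 Q0 Pi Qi)
  qed
  moreover have "real (Suc n) * H = - ent P"
  proof -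
    have "real n * expect P1 h = expect P1 (\<lambda>a. - ent (P2 a))"
      using vhs(3) by (subst integral_mult_right_zero[symmetric]) (rule expect_cong)
    then show ?thesis by (simp add: H_def entP)
  qed
  \<comment> \<open>The entropies subtracted in the two blocks add up, by the two chain rules
    \<open>entP\<close> and \<open>entQ\<close>, to \<open>ent P + ent Q\<close>; then
    \<open>super\<close> applies.\<close>
  moreover have "real (Suc n) * S \<le> t"
  proof -
    have "real n * expect P1 s \<le> expect P1 (\<lambda>a. s2 a - ent (P2 a) - ent Q2)"
      using fin1 vhs(4) by (subst integral_mult_right_zero[symmetric]) (rule expect_mono_finite)
    then show ?thesis using super entP entQ fin1 by (simp add: S_def expect_diff_finite)
  qed
  ultimately show ?case by blast
qed

section \<open>Compactness of the rate set\<close>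

lemma pmf_of_function:
  assumes "finite A" "\<And>x. 0 \<le> f x" "\<And>x. x \<notin> A \<Longrightarrow> f x = 0" "(\<Sum>x\<in>A. f x) = 1"
  obtains P where "pmf P = f"
proof -
  have "(\<integral>\<^sup>+x. f x \<partial>count_space UNIV) = (\<Sum>x\<in>A. ennreal (f x))"
    using assms by (intro nn_integral_count_space') auto
  also have "\<dots> = 1" using assms by (simp add: sum_ennreal)
  finally show ?thesis
    using assms(2) that[of "embed_pmf f"] by (simp add: pmf_embed_pmf fun_eq_iff)
qed

lemma sum_pmf_UNIV: "(\<Sum>x\<in>UNIV. pmf (P :: 'a::finite pmf) x) = 1"
  by (rule sum_pmf_eq_1) auto

lemma expect_UNIV: "expect P f = (\<Sum>x\<in>UNIV. pmf P x * f x)" for P :: "'a::finite pmf"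
  by (rule expect_superset) auto

lemma pmf_map_fst: "pmf (map_pmf fst T) x = (\<Sum>y\<in>UNIV. pmf T (x, y))" for T :: "('a::finite \<times> 'b::finite) pmf"
proof -
  have "pmf (map_pmf fst T) x = (\<Sum>z\<in>fst -` {x}. pmf T z)"
    by (simp add: pmf_map measure_measure_pmf_finite)
  also have "fst -` {x} = Pair x ` (UNIV :: 'b set)" by auto
  finally show ?thesis by (simp add: sum.reindex inj_on_def)
qed

lemma pmf_map_snd: "pmf (map_pmf snd T) y = (\<Sum>x\<in>UNIV. pmf T (x, y))" for T :: "('a::finite \<times> 'b::finite) pmf"
proof -
  have "pmf (map_pmf snd T) y = (\<Sum>z\<in>snd -` {y}. pmf T z)"
    by (simp add: pmf_map measure_measure_pmf_finite)
  also have "snd -` {y} = (\<lambda>x. (x, y)) ` (UNIV :: 'a set)" by auto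
  finally show ?thesis by (simp add: sum.reindex inj_on_def)
qed

text \<open>A subcoupling is completed to a coupling by the normalised product of the residual
  marginals; for total mass 1 the residuals vanish and the junk value \<open>0 / 0 = 0\<close> is harmless.\<close>

lemma subcoupling_le_transport_sup:
  fixes P :: "'x::finite pmf" and Q :: "'y::finite pmf"
  assumes nn: "\<And>z. 0 \<le> \<tau> z"
    and P: "\<And>x. (\<Sum>y\<in>UNIV. \<tau> (x, y)) \<le> pmf P x"
    and Q: "\<And>y. (\<Sum>x\<in>UNIV. \<tau> (x, y)) \<le> pmf Q y"
    and c: "\<And>z. 0 \<le> c z"
  shows "(\<Sum>z\<in>UNIV. \<tau> z * c z) \<le> transport_sup c P Q"
proof -
  define r where "r x = pmf P x - (\<Sum>y\<in>UNIV. \<tau> (x, y))" for x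
  define q where "q y = pmf Q y - (\<Sum>x\<in>UNIV. \<tau> (x, y))" for y
  define m where "m = (\<Sum>z\<in>UNIV. \<tau> z)"
  have m1: "m = (\<Sum>x\<in>UNIV. \<Sum>y\<in>UNIV. \<tau> (x, y))" 
    by (simp add: m_def sum.cartesian_product)
  have m2: "m = (\<Sum>y\<in>UNIV. \<Sum>x\<in>UNIV. \<tau> (x, y))" 
    unfolding m1 by (rule sum.swap)
  have r0: "0 \<le> r x" for x using P by (simp add: r_def)
  have q0: "0 \<le> q y" for y using Q by (simp add: q_def)
  have rs: "(\<Sum>x\<in>UNIV. r x) = 1 - m" by (simp add: r_def sum_subtractf sum_pmf_UNIV m1)
  have qs: "(\<Sum>y\<in>UNIV. q y) = 1 - m" by (simp add: q_def sum_subtractf sum_pmf_UNIV m2)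
  have m_le: "m \<le> 1" using rs r0 by (metis diff_ge_0_iff_ge sum_nonneg)
  have rz: "r x * (1 - m) / (1 - m) = r x" for x
  proof (cases "m = 1")
    case True
    then have "r x = 0" using rs r0 by (simp add: sum_nonneg_eq_0_iff)
    then show ?thesis by simp
  qed simp
  have qz: "q y * (1 - m) / (1 - m) = q y" for y
  proof (cases "m = 1")
    case True
    then have "q y = 0" using qs q0 by (simp add: sum_nonneg_eq_0_iff)
    then show ?thesis by simp
  qed simp
  define f where "f z = \<tau> z + r (fst z) * q (snd z) / (1 - m)" for z
  have f0: "0 \<le> f z" for z using nn r0 q0 m_le by (simp add: f_def)
  have fx: "(\<Sum>y\<in>UNIV. f (x, y)) = pmf P x" for x
  proof -
    have "(\<Sum>y\<in>UNIV. f (x, y)) = (\<Sum>y\<in>UNIV. \<tau> (x, y)) + r x * (\<Sum>y\<in>UNIV. q y) / (1 - m)"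
      by (simp add: f_def sum.distrib sum_distrib_left sum_divide_distrib)
    then show ?thesis by (simp add: qs rz) (simp add: r_def)
  qed
  have fy: "(\<Sum>x\<in>UNIV. f (x, y)) = pmf Q y" for y
  proof -
    have "(\<Sum>x\<in>UNIV. f (x, y)) = (\<Sum>x\<in>UNIV. \<tau> (x, y)) + q y * (\<Sum>x\<in>UNIV. r x) / (1 - m)"
      by (simp add: f_def sum.distrib sum_distrib_left sum_divide_distrib mult.commute)
    then show ?thesis by (simp add: rs qz) (simp add: q_def)
  qed
  have "(\<Sum>z\<in>UNIV. f z) = (\<Sum>x\<in>UNIV. \<Sum>y\<in>UNIV. f (x, y))" 
    by (simp add: sum.cartesian_product)
  then have "(\<Sum>z\<in>UNIV. f z) = 1" by (simp add: fx sum_pmf_UNIV)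
  then obtain T where T: "pmf T = f"
    using pmf_of_function[of UNIV f] f0 by auto
  have "T \<in> couplings P Q"
    unfolding couplings_def by (auto intro!: pmf_eqI simp: pmf_map_fst pmf_map_snd T fx fy)
  moreover have "c z \<le> Max (range c)" for z by (intro Max_ge) auto
  ultimately have "expect T c \<le> transport_sup c P Q"
    by (intro transport_sup_upper[where B = "Max (range c)"]) auto
  moreover have "(\<Sum>z\<in>UNIV. \<tau> z * c z) \<le> expect T c"
    unfolding expect_UNIV T f_def using c r0 q0 m_le by (intro sum_mono mult_right_mono) auto
  ultimately show ?thesis by linarith
qed

text \<open>With \<open>y = sqrt x\<close> one has \<open>x * ln x = 2 * y * (y * ln y)\<close>, and
  \<open>- y * ln y \<le> 1 - y\<close>. This gives both boundedness of the entropy and continuity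
  of \<open>x * ln x\<close> at 0.\<close>

lemma abs_x_ln_x_le:
  assumes "0 \<le> x" "x \<le> (1::real)"
  shows "\<bar>x * ln x\<bar> \<le> 2 * sqrt x"
proof (cases "x = 0")
  case False
  define y where "y = sqrt x"
  have y: "0 < y" "y \<le> 1" "x = y\<^sup>2" using assms False by (auto simp: y_def)
  have "- ln y \<le> 1 / y - 1" using ln_le_minus_one[of "1 / y"] y by (simp add: ln_div)
  then have "y * (- ln y) \<le> y * (1 / y - 1)" using y by (intro mult_left_mono) auto
  also have "\<dots> \<le> 1" using y by (simp add: field_simps)
  finally have "2 * y * (y * (- ln y)) \<le> 2 * y * 1" using y by (intro mult_left_mono) auto
  moreover have "x * ln x = - (2 * y * (y * (- ln y)))"
    using y by (simp add: power2_eq_square ln_mult)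
  moreover have "x * ln x \<le> 0" using assms False by (simp add: mult_nonneg_nonpos)
  ultimately show ?thesis by (simp add: y_def)
qed simp

lemma tendsto_x_ln_x:
  fixes f :: "'a \<Rightarrow> real"
  assumes f: "(f \<longlongrightarrow> l) F" and nn: "\<And>a. 0 \<le> f a"
  shows "((\<lambda>a. f a * ln (f a)) \<longlongrightarrow> l * ln l) F"
proof (cases "l = 0")
  case True
  have "((\<lambda>a. 2 * sqrt (f a)) \<longlongrightarrow> 2 * sqrt 0) F"
    using f True by (intro tendsto_intros) auto
  moreover have "eventually (\<lambda>a. f a < 1) F" using f True by (intro order_tendstoD) auto
  then have *: "eventually (\<lambda>a. norm (f a * ln (f a)) \<le> 2 * sqrt (f a)) F"
    by eventually_elim (use nn in \<open>simp add: abs_x_ln_x_le\<close>)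
  ultimately have "((\<lambda>a. f a * ln (f a)) \<longlongrightarrow> 0) F" using Lim_null_comparison[OF *] by simp
  then show ?thesis using True by simp
next
  case False
  then show ?thesis using f by (intro tendsto_intros) auto
qed

lemma ent_UNIV: "ent P = (\<Sum>x\<in>UNIV. - (pmf P x * ln (pmf P x)))" for P :: "'a::finite pmf"
  unfolding ent_def expect_UNIV by simp

lemma tendsto_ent:
  fixes P :: "'b \<Rightarrow> 'a::finite pmf"
  assumes "\<And>x. ((\<lambda>n. pmf (P n) x) \<longlongrightarrow> pmf P' x) F"
  shows "((\<lambda>n. ent (P n)) \<longlongrightarrow> ent P') F"
  unfolding ent_UNIV using assms by (intro tendsto_sum tendsto_minus tendsto_x_ln_x) auto

text \<open>A crude constant in place of the sharp \<open>ln CARD('a)\<close>; its purpose is the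
  boundedness of \<open>rate_set\<close>.\<close>

lemma ent_le_card: "ent P \<le> 2 * real CARD('a)" for P :: "'a::finite pmf"
proof -
  have "ent P \<le> (\<Sum>x\<in>(UNIV::'a set). 2)"
    unfolding ent_UNIV
  proof (rule sum_mono)
    fix x
    have "sqrt (pmf P x) \<le> 1" by (simp add: pmf_le_1)
    then show "- (pmf P x * ln (pmf P x)) \<le> 2"
      using abs_x_ln_x_le[OF pmf_nonneg pmf_le_1, of P x] by linarith
  qed
  then show ?thesis by simp
qed

lemma bounded_rate_set: "bounded (rate_set \<pi>)"
proof -
  let ?n = "2 * real CARD('a)" and ?m = "2 * real CARD('b)"
  have "norm z \<le> real CARD('a \<times> 'b) + (?n + (cost_max \<pi> + ?n + ?m))" if "z \<in> rate_set \<pi>" for z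
  proof -
    from that obtain P Q t where z: "z = (prod_vec P Q, - ent P, t)"
      and t: "transport_sup (cost \<pi>) P Q \<le> t + ent P + ent Q" "t \<le> cost_max \<pi>"
      unfolding rate_set_def by auto
    have "norm (prod_vec P Q) \<le> (\<Sum>z\<in>UNIV. \<bar>prod_vec P Q $ z\<bar>)"
      by (rule norm_le_l1_cart)
    also have "\<dots> \<le> (\<Sum>z\<in>(UNIV :: ('a \<times> 'b) set). 1)"
      by (intro sum_mono) (auto simp: prod_vec_def abs_mult pmf_le_1 intro!: mult_le_one)
    finally have 1: "norm (prod_vec P Q) \<le> real CARD('a \<times> 'b)" by simp
    \<comment> \<open>Nonnegativity of the transport value bounds \<open>t\<close> from below by
      minus the two entropies; the upper bound is part of \<open>rate_set\<close>.\<close>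
    have "0 \<le> expect (pair_pmf P Q) (cost \<pi>)" by (intro expect_ge_const) (auto intro: cost_nonneg)
    also have "\<dots> \<le> transport_sup (cost \<pi>) P Q"
      by (intro transport_sup_upper pair_pmf_in_couplings) (auto intro: cost_le_max)
    finally have "\<bar>t\<bar> \<le> cost_max \<pi> + ?n + ?m"
      using t ent_le_card[of P] ent_le_card[of Q] ent_nonneg[of P] ent_nonneg[of Q] cost_max_nonneg[of \<pi>] by linarith
    moreover have "norm z \<le> norm (prod_vec P Q) + norm (- ent P, t)"
      unfolding z using norm_Pair_le[of "prod_vec P Q" "(- ent P, t)"] by simp
    moreover have "norm (- ent P, t) \<le> \<bar>ent P\<bar> + \<bar>t\<bar>"
      using norm_Pair_le[of "- ent P" t] by simp
    ultimately show ?thesis using 1 ent_le_card[of P] ent_nonneg[of P] by linarith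
  qed
  then show ?thesis unfolding bounded_iff by blast
qed

text \<open>Semicontinuity in the marginals. A coupling of the limits, shrunk by a factor
  \<open>s < 1\<close>, is eventually a subcoupling of the approximating marginals, hence bounded by
  their transport value; then \<open>s\<close> tends to 1.\<close>

lemma transport_sup_le_limit:
  fixes P :: "'x::finite pmf" and Q :: "'y::finite pmf"
  assumes P: "\<And>x. (\<lambda>n. pmf (Pn n) x) \<longlonglongrightarrow> pmf P x" and Q: "\<And>y. (\<lambda>n. pmf (Qn n) y) \<longlonglongrightarrow> pmf Q y"
    and c: "\<And>z. 0 \<le> c z"
    and le: "\<And>n. transport_sup c (Pn n) (Qn n) \<le> b n" and b: "b \<longlonglongrightarrow> B"
  shows "transport_sup c P Q \<le> B"
proof (rule transport_sup_least)
  fix T assume T: "T \<in> couplings P Q"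
  have step: "s * expect T c \<le> B" if s: "0 \<le> s" "s < 1" for s
  proof -
    \<comment> \<open>Shrinking leaves strict room below \<open>p > 0\<close>; at letters of mass 0
      the claim is just nonnegativity.\<close>
    have scaled: "eventually (\<lambda>n. s * p \<le> f n) sequentially" if "f \<longlonglongrightarrow> p" "p \<ge> 0" "\<And>n. 0 \<le> f n" for f and p :: real
    proof (cases "p = 0")
      case False
      then have "s * p < p" using s that(2) by (simp add: mult_less_cancel_right2)
      from order_tendstoD(1)[OF that(1) this] show ?thesis by eventually_elim simp
    qed (use that in auto)
    have "eventually (\<lambda>n. \<forall>x. s * pmf P x \<le> pmf (Pn n) x) sequentially"
      by (intro eventually_all_finite scaled P) auto
    moreover have "eventually (\<lambda>n. \<forall>y. s * pmf Q y \<le> pmf (Qn n) y) sequentially"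
      by (intro eventually_all_finite scaled Q) auto
    ultimately have "eventually (\<lambda>n. s * expect T c \<le> b n) sequentially"
    proof eventually_elim
      case (elim n)
      have "(\<Sum>z\<in>UNIV. (s * pmf T z) * c z) \<le> transport_sup c (Pn n) (Qn n)"
        using elim s T c
        by (intro subcoupling_le_transport_sup)
          (auto simp: sum_distrib_left[symmetric] pmf_map_fst[symmetric] pmf_map_snd[symmetric] couplings_def)
      then show ?case using le[of n] by (simp add: expect_UNIV sum_distrib_left mult.assoc)
    qed
    then show ?thesis using tendsto_le[OF _ b tendsto_const] by auto
  qed
  have "((\<lambda>s. s * expect T c) \<longlongrightarrow> 1 * expect T c) (at_left 1)"
    by (intro tendsto_intros)
  moreover have "eventually (\<lambda>s. s * expect T c \<le> B) (at_left 1)"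
    using eventually_at_left_real[of 0 "1::real"] by (auto elim!: eventually_mono intro: step)
  ultimately have "1 * expect T c \<le> B" by (rule tendsto_upperbound) auto
  then show "expect T c \<le> B" by simp
qed

text \<open>Row and column sums recover the marginals continuously from a product vector, so a limit
  of product vectors is again one. The support condition survives because a positive limit mass is
  eventually positive, and the transport inequality by
  \<open>transport_sup_le_limit\<close>.\<close>

lemma closed_rate_set: "closed (rate_set \<pi>)"
  unfolding closed_sequential_limits
proof (intro allI impI)
  fix z l assume "(\<forall>n. z n \<in> rate_set \<pi>) \<and> z \<longlonglongrightarrow> l"
  then have z: "\<forall>n. z n \<in> rate_set \<pi>" and lim: "z \<longlonglongrightarrow> l" by auto
  obtain v h t where l: "l = (v, h, t)" by (cases l)
  from z have "\<forall>n. \<exists>p. z n = (prod_vec (fst p) (fst (snd p)), - ent (fst p), snd (snd p)) \<and>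
     set_pmf (fst p) \<times> set_pmf (fst (snd p)) \<subseteq> set_pmf \<pi> \<and>
     transport_sup (cost \<pi>) (fst p) (fst (snd p)) \<le> snd (snd p) + ent (fst p) + ent (fst (snd p)) \<and> snd (snd p) \<le> cost_max \<pi>"
    unfolding rate_set_def by fastforce
  from choice[OF this] obtain p where p: "\<forall>n. z n = (prod_vec (fst (p n)) (fst (snd (p n))), - ent (fst (p n)), snd (snd (p n))) \<and>
     set_pmf (fst (p n)) \<times> set_pmf (fst (snd (p n))) \<subseteq> set_pmf \<pi> \<and>
     transport_sup (cost \<pi>) (fst (p n)) (fst (snd (p n))) \<le> snd (snd (p n)) + ent (fst (p n)) + ent (fst (snd (p n))) \<and> snd (snd (p n)) \<le> cost_max \<pi>" ..
  define P where "P n = fst (p n)" for n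
  define Q where "Q n = fst (snd (p n))" for n
  define s where "s n = snd (snd (p n))" for n
  have z_eq: "z n = (prod_vec (P n) (Q n), - ent (P n), s n)"
    and supp: "set_pmf (P n) \<times> set_pmf (Q n) \<subseteq> set_pmf \<pi>"
    and tr: "transport_sup (cost \<pi>) (P n) (Q n) \<le> s n + ent (P n) + ent (Q n)"
    and sm: "s n \<le> cost_max \<pi>" for n
    using p by (auto simp: P_def Q_def s_def)
  have "(\<lambda>n. prod_vec (P n) (Q n)) \<longlonglongrightarrow> v" "(\<lambda>n. - ent (P n)) \<longlonglongrightarrow> h" and st: "s \<longlonglongrightarrow> t"
    using tendsto_fst[OF lim] tendsto_fst[OF tendsto_snd[OF lim]] tendsto_snd[OF tendsto_snd[OF lim]]
    by (simp_all add: z_eq l)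
  have PQ: "(\<lambda>n. pmf (P n) x * pmf (Q n) y) \<longlonglongrightarrow> v $ (x, y)" for x y
    using tendsto_vec_nth[OF \<open>(\<lambda>n. prod_vec (P n) (Q n)) \<longlonglongrightarrow> v\<close>, of "(x, y)"] by (simp add: prod_vec_def)
  define f where "f x = (\<Sum>y\<in>UNIV. v $ (x, y))" for x
  define g where "g y = (\<Sum>x\<in>UNIV. v $ (x, y))" for y
  have Pf: "(\<lambda>n. pmf (P n) x) \<longlonglongrightarrow> f x" for x
  proof -
    have "(\<lambda>n. \<Sum>y\<in>UNIV. pmf (P n) x * pmf (Q n) y) \<longlonglongrightarrow> f x"
      unfolding f_def by (intro tendsto_sum PQ)
    then show ?thesis by (simp add: sum_distrib_left[symmetric] sum_pmf_UNIV)
  qed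
  have Qg: "(\<lambda>n. pmf (Q n) y) \<longlonglongrightarrow> g y" for y
  proof -
    have "(\<lambda>n. \<Sum>x\<in>UNIV. pmf (P n) x * pmf (Q n) y) \<longlonglongrightarrow> g y"
      unfolding g_def by (intro tendsto_sum PQ)
    then show ?thesis by (simp add: sum_distrib_right[symmetric] sum_pmf_UNIV)
  qed
  have f0: "0 \<le> f x" for x using Pf by (rule LIMSEQ_le_const) auto
  have g0: "0 \<le> g y" for y using Qg by (rule LIMSEQ_le_const) auto
  have "(\<lambda>n. \<Sum>x\<in>UNIV. pmf (P n) x) \<longlonglongrightarrow> (\<Sum>x\<in>UNIV. f x)" by (intro tendsto_sum Pf)
  then have fs: "(\<Sum>x\<in>UNIV. f x) = 1" by (simp add: sum_pmf_UNIV LIMSEQ_const_iff)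
  have "(\<lambda>n. \<Sum>x\<in>UNIV. pmf (Q n) x) \<longlonglongrightarrow> (\<Sum>x\<in>UNIV. g x)" by (intro tendsto_sum Qg)
  then have gs: "(\<Sum>x\<in>UNIV. g x) = 1" by (simp add: sum_pmf_UNIV LIMSEQ_const_iff)
  obtain P' where P': "pmf P' = f" using pmf_of_function[of UNIV f] f0 fs by auto
  obtain Q' where Q': "pmf Q' = g" using pmf_of_function[of UNIV g] g0 gs by auto
  have entP: "(\<lambda>n. ent (P n)) \<longlonglongrightarrow> ent P'" and entQ: "(\<lambda>n. ent (Q n)) \<longlonglongrightarrow> ent Q'"
    using Pf Qg by (auto intro!: tendsto_ent simp: P' Q')
  have "v $ (x, y) = f x * g y" for x y
    using LIMSEQ_unique[OF PQ tendsto_mult[OF Pf Qg]] by blast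
  then have v: "v = prod_vec P' Q'" by (simp add: vec_eq_iff prod_vec_def P' Q')
  have h: "h = - ent P'"
    using LIMSEQ_unique[OF \<open>(\<lambda>n. - ent (P n)) \<longlonglongrightarrow> h\<close> tendsto_minus[OF entP]] .
  have "set_pmf P' \<times> set_pmf Q' \<subseteq> set_pmf \<pi>"
  proof clarify
    fix x y assume "x \<in> set_pmf P'" "y \<in> set_pmf Q'"
    then have "0 < f x" "0 < g y" using P' Q' by (metis pmf_positive)+
    then have "eventually (\<lambda>n. 0 < pmf (P n) x) sequentially" "eventually (\<lambda>n. 0 < pmf (Q n) y) sequentially"
      using order_tendstoD(1)[OF Pf] order_tendstoD(1)[OF Qg] by blast+
    then have "eventually (\<lambda>n. (x, y) \<in> set_pmf \<pi>) sequentially"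
    proof eventually_elim
      case (elim n)
      then have "x \<in> set_pmf (P n)" "y \<in> set_pmf (Q n)" by (auto simp: set_pmf_iff)
      then show ?case using supp[of n] by blast
    qed
    then show "(x, y) \<in> set_pmf \<pi>" by simp
  qed
  moreover have "transport_sup (cost \<pi>) P' Q' \<le> t + ent P' + ent Q'"
    by (rule transport_sup_le_limit[OF _ _ cost_nonneg tr])
      (use Pf Qg in \<open>auto simp: P' Q' intro!: tendsto_add st entP entQ\<close>)
  moreover have "t \<le> cost_max \<pi>" using st by (rule LIMSEQ_le_const2) (auto intro: sm)
  ultimately show "l \<in> rate_set \<pi>" unfolding rate_set_def l v h by blast
qed

lemma compact_hull_rate_set: "compact (convex hull (rate_set \<pi>))"
  using bounded_rate_set closed_rate_set compact_convex_hull compact_eq_bounded_closed by blast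

text \<open>The target region in convex form: \<open>h\<close> stands for \<open>- H(X|W)\<close>,
  so \<open>ent (map_pmf fst \<pi>) + h\<close> is I(W;X), and \<open>t\<close> bounds the mean of
  \<Phi>.\<close>

definition hull_region :: "('x::finite \<times> 'y::finite) pmf \<Rightarrow> (real \<times> real) set" where
  "hull_region \<pi> = {(R0, R). R0 \<ge> 0 \<and> R \<ge> 0 \<and>
     (\<exists>h t. ((\<chi> z. pmf \<pi> z), h, t) \<in> convex hull (rate_set \<pi>) \<and> ent (map_pmf fst \<pi>) + h \<le> R \<and> t \<le> R + R0)}"

text \<open>The section of the compact hull over \<pi> is compact, and compact plus closed quadrant
  is closed; the region is the preimage of that sum under an affine map, cut with the
  quadrant.\<close>

lemma closed_hull_region: "closed (hull_region \<pi>)"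
proof -
  let ?C = "convex hull (rate_set \<pi>)" and ?v = "(\<chi> z. pmf \<pi> z) :: real ^ _"
  define D where "D = snd ` (?C \<inter> {?v} \<times> UNIV)"
  define U where "U = (\<Union>x\<in>D. \<Union>y\<in>{0..}\<times>{0..}. {x + y :: real \<times> real})"
  have "compact D" unfolding D_def
    by (intro compact_continuous_image compact_Int_closed compact_hull_rate_set closed_Times continuous_intros)
  then have U: "closed U" unfolding U_def by (intro compact_closed_sums closed_Times) auto
  have "hull_region \<pi> = {0..} \<times> {0..} \<inter> (\<lambda>z. (snd z - ent (map_pmf fst \<pi>), snd z + fst z)) -` U"
  proof (rule set_eqI)
    fix z :: "real \<times> real"
    obtain R0 R where z: "z = (R0, R)" by force
    have "(R - ent (map_pmf fst \<pi>), R + R0) \<in> U \<longleftrightarrow>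
      (\<exists>h t. (?v, h, t) \<in> ?C \<and> ent (map_pmf fst \<pi>) + h \<le> R \<and> t \<le> R + R0)"
    proof
      assume "(R - ent (map_pmf fst \<pi>), R + R0) \<in> U"
      then obtain h t a b where "(?v, h, t) \<in> ?C" "0 \<le> a" "0 \<le> b"
        "(R - ent (map_pmf fst \<pi>), R + R0) = (h, t) + (a, b)"
        unfolding U_def D_def by auto
      then show "\<exists>h t. (?v, h, t) \<in> ?C \<and> ent (map_pmf fst \<pi>) + h \<le> R \<and> t \<le> R + R0"
        by (intro exI[of _ h] exI[of _ t]) auto
    next
      assume "\<exists>h t. (?v, h, t) \<in> ?C \<and> ent (map_pmf fst \<pi>) + h \<le> R \<and> t \<le> R + R0"
      then obtain h t where ht: "(?v, h, t) \<in> ?C" "ent (map_pmf fst \<pi>) + h \<le> R" "t \<le> R + R0" by blast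
      have "(h, t) \<in> D" unfolding D_def using ht(1) by force
      moreover have "(R - ent (map_pmf fst \<pi>) - h, R + R0 - t) \<in> {0..}\<times>{0..}" using ht by auto
      moreover have "(R - ent (map_pmf fst \<pi>), R + R0) = (h, t) + (R - ent (map_pmf fst \<pi>) - h, R + R0 - t)" by simp
      ultimately show "(R - ent (map_pmf fst \<pi>), R + R0) \<in> U" unfolding U_def by blast
    qed
    then show "z \<in> hull_region \<pi> \<longleftrightarrow> z \<in> {0..} \<times> {0..} \<inter> (\<lambda>z. (snd z - ent (map_pmf fst \<pi>), snd z + fst z)) -` U"
      by (simp add: hull_region_def z)
  qed
  also have "closed \<dots>"
    by (intro closed_Int closed_Times closed_vimage U continuous_intros closed_atLeast)
  finally show ?thesis .
qed

section \<open>From the hull to the region\<close>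

lemma shannon_entropy_eq_nn_integral:
  "shannon_entropy P = (\<integral>\<^sup>+ x. ennreal (- ln (pmf P x)) \<partial>measure_pmf P)"
  unfolding shannon_entropy_def nn_integral_measure_pmf
  by (intro nn_integral_cong) (simp add: ennreal_mult'[symmetric])

lemma nn_integral_eq_expect:
  assumes "finite (set_pmf P)" "\<And>x. x \<in> set_pmf P \<Longrightarrow> 0 \<le> f x"
  shows "(\<integral>\<^sup>+ x. ennreal (f x) \<partial>measure_pmf P) = ennreal (expect P f)"
  using assms by (intro nn_integral_eq_integral integrable_measure_pmf_finite) (auto simp: AE_measure_pmf_iff)

lemma shannon_entropy_eq_ent:
  assumes "finite (set_pmf P)"
  shows "shannon_entropy P = ennreal (ent P)"
  unfolding shannon_entropy_eq_nn_integral ent_def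
  using assms by (intro nn_integral_eq_expect) (auto simp: pmf_le_1 pmf_positive)

text \<open>With countable alphabets both counting measures are sigma-finite and their product is
  again a counting measure, so the mass functions serve as densities in the general formula.\<close>

lemma mutual_info_eq_sum:
  fixes Q :: "(nat \<times> 'b::finite) pmf"
  assumes "finite (set_pmf Q)"
  shows "mutual_info Q =
    expect Q (\<lambda>z. ln (pmf Q z / (pmf (map_pmf fst Q) (fst z) * pmf (map_pmf snd Q) (snd z))))"
proof -
  interpret information_space "measure_pmf Q" "exp 1"
    by unfold_locales simp
  have dist: "distributed (measure_pmf Q) (count_space UNIV) X (\<lambda>x. ennreal (pmf (map_pmf X Q) x))" for X :: "nat \<times> 'b \<Rightarrow> 'c"
    unfolding distributed_def by (simp add: map_pmf_rep_eq[symmetric] measure_pmf_eq_density[symmetric])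
  have prod: "count_space (UNIV :: nat set) \<Otimes>\<^sub>M count_space (UNIV :: 'b set) = count_space UNIV"
    by (subst pair_measure_countable) (auto intro: countable_finite)
  have sf: "sigma_finite_measure (count_space (UNIV :: nat set))" "sigma_finite_measure (count_space (UNIV :: 'b set))"
    by (auto intro: sigma_finite_measure_count_space_countable countable_finite)
  let ?f = "\<lambda>z. pmf Q z * ln (pmf Q z / (pmf (map_pmf fst Q) (fst z) * pmf (map_pmf snd Q) (snd z)))"
  have d3: "distributed (measure_pmf Q) (count_space UNIV \<Otimes>\<^sub>M count_space UNIV) (\<lambda>x. (fst x, snd x)) (\<lambda>x. ennreal (pmf Q x))"
    using dist[of "\<lambda>x. x"] by (simp add: prod)
  have "mutual_info Q = (\<integral>z. pmf Q z * log (exp 1) (pmf Q z / (pmf (map_pmf fst Q) (fst z) * pmf (map_pmf snd Q) (snd z)))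
      \<partial>(count_space UNIV \<Otimes>\<^sub>M count_space UNIV))"
    unfolding mutual_info_def
    by (rule mutual_information_distr[OF sf dist[of fst] _ dist[of snd] _ d3]) auto
  also have "\<dots> = (\<integral>z. ?f z \<partial>count_space UNIV)"
    by (simp add: prod log_ln[symmetric])
  also have "\<dots> = (\<Sum>z | z \<in> UNIV \<and> ?f z \<noteq> 0. ?f z)"
    by (rule lebesgue_integral_count_space_finite_support)
      (rule finite_subset[OF _ assms], auto simp: set_pmf_iff)
  also have "\<dots> = (\<Sum>z\<in>set_pmf Q. ?f z)"
    using assms by (intro sum.mono_neutral_left) (auto simp: set_pmf_iff)
  finally show ?thesis using assms by (simp add: expect_finite)
qed

text \<open>I(W;X) = H(X) - H(X|W): the mass of \<open>w\<close> cancels in the log ratio.\<close>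

lemma mutual_info_bind:
  fixes PX :: "nat \<Rightarrow> 'x::finite pmf"
  assumes fin: "finite (set_pmf PW)"
  defines "Q \<equiv> joint_law PW PX"
  shows "mutual_info Q = ent (map_pmf snd Q) - expect PW (\<lambda>w. ent (PX w))"
proof -
  have finQ: "finite (set_pmf Q)" unfolding Q_def using fin by auto
  have fstQ: "map_pmf fst Q = PW" unfolding Q_def by (simp add: map_bind_pmf map_pmf_comp bind_return_pmf')
  have "mutual_info Q = expect Q (\<lambda>z. ln (pmf (PX (fst z)) (snd z)) - ln (pmf (map_pmf snd Q) (snd z)))"
    unfolding mutual_info_eq_sum[OF finQ]
  proof (rule expect_cong)
    fix z assume z: "z \<in> set_pmf Q"
    obtain w x where wx: "z = (w, x)" by force
    have "w \<in> set_pmf PW" "x \<in> set_pmf (PX w)" using z by (auto simp: Q_def wx)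
    moreover have "x \<in> set_pmf (map_pmf snd Q)" using z wx by force
    ultimately have "0 < pmf PW w" "0 < pmf (PX w) x" "0 < pmf (map_pmf snd Q) x" by (auto simp only: pmf_positive)
    then show "ln (pmf Q z / (pmf (map_pmf fst Q) (fst z) * pmf (map_pmf snd Q) (snd z)))
      = ln (pmf (PX (fst z)) (snd z)) - ln (pmf (map_pmf snd Q) (snd z))"
      unfolding fstQ by (simp add: wx Q_def pmf_bind_Pair ln_divide_pos)
  qed
  also have "\<dots> = expect Q (\<lambda>z. ln (pmf (PX (fst z)) (snd z))) - expect Q (\<lambda>z. ln (pmf (map_pmf snd Q) (snd z)))"
    using finQ by (rule expect_diff_finite)
  also have "expect Q (\<lambda>z. ln (pmf (map_pmf snd Q) (snd z))) = - ent (map_pmf snd Q)"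
    by (simp add: ent_def)
  also have "expect Q (\<lambda>z. ln (pmf (PX (fst z)) (snd z))) = - expect PW (\<lambda>w. ent (PX w))"
    unfolding Q_def using fin by (subst expect_bind) (auto simp: ent_def)
  finally show ?thesis by simp
qed

lemma nn_integral_log_cost:
  fixes T :: "('x::finite \<times> 'y::finite) pmf"
  assumes "set_pmf T \<subseteq> set_pmf \<pi>"
  shows "(\<integral>\<^sup>+ z. log_cost \<pi> z \<partial>measure_pmf T) = ennreal (expect T (cost \<pi>))"
proof -
  have "(\<integral>\<^sup>+ z. log_cost \<pi> z \<partial>measure_pmf T) = (\<integral>\<^sup>+ z. ennreal (cost \<pi> z) \<partial>measure_pmf T)"
  proof (intro nn_integral_cong_AE, unfold AE_measure_pmf_iff, intro ballI)
    fix z assume "z \<in> set_pmf T"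
    then have "0 < pmf \<pi> z" using assms by (auto simp only: pmf_positive)
    then show "log_cost \<pi> z = ennreal (cost \<pi> z)" by (simp add: log_cost_def cost_def ln_div)
  qed
  also have "\<dots> = ennreal (expect T (cost \<pi>))"
    by (intro nn_integral_eq_expect) (auto simp: cost_nonneg)
  finally show ?thesis .
qed

text \<open>The support condition keeps every coupling away from the infinite values of
  \<open>log_cost\<close>; the extended and the real supremum are then compared through near-optimal
  couplings.\<close>

lemma max_transport_log_cost:
  fixes P :: "'x::finite pmf" and Q :: "'y::finite pmf"
  assumes "set_pmf P \<times> set_pmf Q \<subseteq> set_pmf \<pi>"
  shows "max_transport (log_cost \<pi>) P Q = ennreal (transport_sup (cost \<pi>) P Q)"
proof -
  have eq: "(\<integral>\<^sup>+ z. log_cost \<pi> z \<partial>measure_pmf T) = ennreal (expect T (cost \<pi>))" if "T \<in> couplings P Q" for T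
    using set_pmf_coupling[OF that] assms by (intro nn_integral_log_cost) auto
  have up: "expect T (cost \<pi>) \<le> transport_sup (cost \<pi>) P Q" if "T \<in> couplings P Q" for T
    using that by (intro transport_sup_upper) (auto intro: cost_le_max)
  show ?thesis unfolding max_transport_def
  proof (rule antisym)
    show "(SUP T\<in>couplings P Q. \<integral>\<^sup>+ z. log_cost \<pi> z \<partial>measure_pmf T) \<le> ennreal (transport_sup (cost \<pi>) P Q)"
      by (intro SUP_least) (simp add: eq up ennreal_leI)
    show "ennreal (transport_sup (cost \<pi>) P Q) \<le> (SUP T\<in>couplings P Q. \<integral>\<^sup>+ z. log_cost \<pi> z \<partial>measure_pmf T)"
    proof (rule ennreal_le_epsilon)
      fix e :: real assume e: "0 < e"
      obtain T where T: "T \<in> couplings P Q" "transport_sup (cost \<pi>) P Q - e \<le> expect T (cost \<pi>)"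
        using transport_sup_approx[OF e] by blast
      have "0 \<le> expect T (cost \<pi>)" by (intro expect_ge_const) (auto intro: cost_nonneg)
      have "ennreal (transport_sup (cost \<pi>) P Q) \<le> ennreal (expect T (cost \<pi>) + e)"
        using T by (intro ennreal_leI) simp
      also have "\<dots> = ennreal (expect T (cost \<pi>)) + ennreal e"
        using e \<open>0 \<le> expect T (cost \<pi>)\<close> by (simp add: ennreal_plus)
      also have "\<dots> \<le> (SUP T\<in>couplings P Q. \<integral>\<^sup>+ z. log_cost \<pi> z \<partial>measure_pmf T) + ennreal e"
        unfolding eq[OF T(1), symmetric] using T(1) by (intro add_right_mono SUP_upper)
      finally show "ennreal (transport_sup (cost \<pi>) P Q)
        \<le> (SUP T\<in>couplings P Q. \<integral>\<^sup>+ z. log_cost \<pi> z \<partial>measure_pmf T) + ennreal e" .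
    qed
  qed
qed

lemma transport_sup_cost_nonneg: "0 \<le> transport_sup (cost \<pi>) (P :: 'x::finite pmf) (Q :: 'y::finite pmf)"
proof -
  have "0 \<le> expect (pair_pmf P Q) (cost \<pi>)" by (intro expect_ge_const) (auto intro: cost_nonneg)
  also have "\<dots> \<le> transport_sup (cost \<pi>) P Q"
    by (intro transport_sup_upper pair_pmf_in_couplings) (auto intro: cost_le_max)
  finally show ?thesis .
qed

lemma Phi_finite:
  assumes "set_pmf P \<times> set_pmf Q \<subseteq> set_pmf \<pi>"
  shows "Phi (log_cost \<pi>) P Q = ereal (transport_sup (cost \<pi>) P Q - ent P - ent Q)"
  unfolding Phi_def max_transport_log_cost[OF assms]
  by (simp add: shannon_entropy_eq_ent ent_nonneg transport_sup_cost_nonneg enn2ereal_ennreal)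

text \<open>The indices of a finite convex combination become the values of \<open>W\<close> and the
  weights become its law. The three coordinates of the combination give the joint law, the mutual
  information and the bound on \<Phi>.\<close>

lemma hull_region_subset_R_region: "hull_region \<pi> \<subseteq> R_region \<pi>"
proof (rule subsetI)
  fix r assume "r \<in> hull_region \<pi>"
  then obtain R0 R h t where r: "r = (R0, R)" "0 \<le> R0" "0 \<le> R"
    and hull: "((\<chi> z. pmf \<pi> z), h, t) \<in> convex hull (rate_set \<pi>)"
    and hR: "ent (map_pmf fst \<pi>) + h \<le> R" and tR: "t \<le> R + R0"
    unfolding hull_region_def by auto
  from hull obtain k :: nat and u :: "nat \<Rightarrow> real" and x where
    u: "\<And>i. i \<in> {1..k} \<Longrightarrow> 0 \<le> u i" and x: "\<And>i. i \<in> {1..k} \<Longrightarrow> x i \<in> rate_set \<pi>"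
    and u1: "sum u {1..k} = 1" and ux: "(\<Sum>i = 1..k. u i *\<^sub>R x i) = ((\<chi> z. pmf \<pi> z), h, t)"
    unfolding convex_hull_indexed by blast
  define good where "good i p \<longleftrightarrow> x i = (prod_vec (fst p) (fst (snd p)), - ent (fst p), snd (snd p)) \<and>
     set_pmf (fst p) \<times> set_pmf (fst (snd p)) \<subseteq> set_pmf \<pi> \<and>
     transport_sup (cost \<pi>) (fst p) (fst (snd p)) \<le> snd (snd p) + ent (fst p) + ent (fst (snd p))" for i p
  have "\<forall>i. \<exists>p. i \<in> {1..k} \<longrightarrow> good i p"
  proof
    fix i
    show "\<exists>p. i \<in> {1..k} \<longrightarrow> good i p"
    proof (cases "i \<in> {1..k}")
      case True
      from x[OF this] obtain P Q s where "good i (P, Q, s)"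
        unfolding rate_set_def good_def by auto
      then show ?thesis by blast
    next
      case False
      then show ?thesis by blast
    qed
  qed
  from choice[OF this] obtain p where p: "\<And>i. i \<in> {1..k} \<Longrightarrow> good i (p i)" by blast
  define PX where "PX i = fst (p i)" for i
  define PY where "PY i = fst (snd (p i))" for i
  define s where "s i = snd (snd (p i))" for i
  have x_eq: "x i = (prod_vec (PX i) (PY i), - ent (PX i), s i)"
    and supp: "set_pmf (PX i) \<times> set_pmf (PY i) \<subseteq> set_pmf \<pi>"
    and tr: "transport_sup (cost \<pi>) (PX i) (PY i) \<le> s i + ent (PX i) + ent (PY i)" if "i \<in> {1..k}" for i
    using p[OF that] by (auto simp: good_def PX_def PY_def s_def)
  obtain PW where PW: "pmf PW = (\<lambda>i. if i \<in> {1..k} then u i else 0)"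
  proof (rule pmf_of_function[of "{1..k}" "\<lambda>i. if i \<in> {1..k} then u i else 0"])
    show "(\<Sum>i = 1..k. if i \<in> {1..k} then u i else 0) = 1" using u1 by (simp only: if_True cong: sum.cong)
  qed (use u in auto)
  \<comment> \<open>Only an inclusion, since weights may be 0; expectations are nevertheless summed
    over all of \<open>{1..k}\<close>.\<close>
  have setW: "set_pmf PW \<subseteq> {1..k}" by (auto simp: set_pmf_iff PW split: if_splits)
  then have finW: "finite (set_pmf PW)" by (rule finite_subset) simp
  have EW: "expect PW f = (\<Sum>i=1..k. u i * f i)" for f
    by (subst expect_superset[OF _ setW]) (auto simp: PW)
  have "(\<Sum>i = 1..k. u i *\<^sub>R x i) = (\<Sum>i = 1..k. u i *\<^sub>R (prod_vec (PX i) (PY i), - ent (PX i), s i))"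
    by (intro sum.cong) (auto simp: x_eq)
  with ux have ux': "(\<Sum>i = 1..k. u i *\<^sub>R prod_vec (PX i) (PY i)) = (\<chi> z. pmf \<pi> z)"
    "(\<Sum>i = 1..k. u i * ent (PX i)) = - h" "(\<Sum>i = 1..k. u i * s i) = t"
    by (auto simp: prod_eq_iff fst_sum snd_sum sum_negf)
  define J where "J = do {w \<leftarrow> PW; x \<leftarrow> PX w; y \<leftarrow> PY w; return_pmf (w, x, y)}"
  have JXY: "map_pmf (\<lambda>(w, x, y). (x, y)) J = \<pi>"
  proof (rule pmf_eqI)
    fix z
    have "map_pmf (\<lambda>(w, x, y). (x, y)) J = bind_pmf PW (\<lambda>w. pair_pmf (PX w) (PY w))"
      by (simp add: J_def map_pmf_def pair_pmf_def bind_assoc_pmf bind_return_pmf)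
    then have "pmf (map_pmf (\<lambda>(w, x, y). (x, y)) J) z = expect PW (\<lambda>w. pmf (PX w) (fst z) * pmf (PY w) (snd z))"
      by (cases z) (simp add: pmf_bind pmf_pair)
    also have "\<dots> = (\<Sum>i = 1..k. u i *\<^sub>R prod_vec (PX i) (PY i)) $ z"
      by (simp add: EW prod_vec_def sum_component)
    finally show "pmf (map_pmf (\<lambda>(w, x, y). (x, y)) J) z = pmf \<pi> z" by (simp only: ux'(1) vec_lambda_beta)
  qed
  have JWX: "map_pmf (\<lambda>(w, x, y). (w, x)) J = joint_law PW PX"
    by (simp add: J_def map_pmf_def bind_assoc_pmf bind_return_pmf)
  have "map_pmf snd (map_pmf (\<lambda>(w, x, y). (w, x)) J) = map_pmf fst (map_pmf (\<lambda>(w, x, y). (x, y)) J)"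
    by (simp add: map_pmf_comp case_prod_unfold)
  then have X: "map_pmf snd (joint_law PW PX) = map_pmf fst \<pi>"
    by (simp only: JXY JWX)
  have "mutual_info (map_pmf (\<lambda>(w, x, y). (w, x)) J) = ent (map_pmf fst \<pi>) + h"
    unfolding JWX mutual_info_bind[OF finW] X using ux' by (simp add: EW)
  moreover have "(\<Sum>w\<in>set_pmf PW. ereal (pmf PW w) * Phi (log_cost \<pi>) (PX w) (PY w)) \<le> ereal (R + R0)"
  proof -
    have "(\<Sum>w\<in>set_pmf PW. ereal (pmf PW w) * Phi (log_cost \<pi>) (PX w) (PY w))
      \<le> (\<Sum>w\<in>set_pmf PW. ereal (pmf PW w * s w))"
    proof (rule sum_mono)
      fix w assume "w \<in> set_pmf PW"
      then have w: "w \<in> {1..k}" using setW by blast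
      have "pmf PW w * (transport_sup (cost \<pi>) (PX w) (PY w) - ent (PX w) - ent (PY w)) \<le> pmf PW w * s w"
        using tr[OF w] by (intro mult_left_mono) auto
      then show "ereal (pmf PW w) * Phi (log_cost \<pi>) (PX w) (PY w) \<le> ereal (pmf PW w * s w)"
        by (simp add: Phi_finite[OF supp[OF w]])
    qed
    also have "\<dots> = ereal (expect PW s)" using finW by (simp add: expect_finite)
    also have "\<dots> \<le> ereal (R + R0)" using tR ux' by (simp add: EW)
    finally show ?thesis .
  qed
  ultimately show "r \<in> R_region \<pi>"
    unfolding R_region_def r(1) using r hR finW JXY
    by (auto simp: Let_def J_def intro!: exI[of _ PW] exI[of _ PX] exI[of _ PY])
qed

section \<open>Converse\<close>

lemma pmf_bind_Cons:
  "pmf (do {y \<leftarrow> p; ys \<leftarrow> q; return_pmf (y # ys)}) (a # as) = pmf p a * pmf q as"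
proof -
  have "do {y \<leftarrow> p; ys \<leftarrow> q; return_pmf (y # ys)} = map_pmf (\<lambda>(y, ys). y # ys) (pair_pmf p q)"
    by (simp add: pair_pmf_def map_bind_pmf)
  moreover have "inj (\<lambda>(y, ys :: 'a list). y # ys)" by (auto simp: inj_on_def)
  ultimately show ?thesis using pmf_map_inj'[of "\<lambda>(y, ys). y # ys" "pair_pmf p q" "(a, as)"]
    by (simp add: pmf_pair)
qed

lemma pmf_memoryless:
  "pmf (memoryless V xs) ys = (if length ys = length xs then \<Prod>i<length xs. pmf (V (xs ! i)) (ys ! i) else 0)"
proof (induction xs arbitrary: ys)
  case (Cons x xs)
  show ?case
  proof (cases ys)
    case Nil
    then have "[] \<notin> set_pmf (memoryless V (x # xs))" by auto
    then have "pmf (memoryless V (x # xs)) [] = 0" by (simp only: set_pmf_iff not_not)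
    then show ?thesis using Nil by simp
  next
    case (Cons y ys')
    have "pmf (memoryless V (x # xs)) ys = pmf (V x) y * pmf (memoryless V xs) ys'"
      by (simp add: Cons pmf_bind_Cons)
    then show ?thesis by (simp add: Cons.IH Cons prod.lessThan_Suc_shift del: prod.lessThan_Suc)
  qed
qed (simp add: pmf_return)

lemma replicate_pmf_eq_memoryless: "replicate_pmf n p = memoryless (\<lambda>_. p) (replicate n ())"
  by (induction n) simp_all

lemma pmf_replicate_pmf:
  "pmf (replicate_pmf n p) xs = (if length xs = n then \<Prod>i<n. pmf p (xs ! i) else 0)"
  by (simp add: replicate_pmf_eq_memoryless pmf_memoryless)

lemma map_nth_replicate_pmf: "i < n \<Longrightarrow> map_pmf (\<lambda>xs. xs ! i) (replicate_pmf n p) = p"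
proof (induction n arbitrary: i)
  case (Suc n)
  then show ?case
    by (cases i) (simp_all add: map_bind_pmf bind_return_pmf' map_pmf_comp flip: map_pmf_def)
qed simp

text \<open>Turns the exactness condition on conditional laws into the joint statement that (X^n,
  Y^n) is i.i.d. with letter law \<pi>.\<close>

lemma memoryless_cond_law:
  "joint_law (replicate_pmf n (map_pmf fst \<pi>)) (memoryless (cond_law \<pi>))
    = map_pmf (\<lambda>l. (map fst l, map snd l)) (replicate_pmf n \<pi>)"
proof (induction n)
  case (Suc n)
  have "joint_law (replicate_pmf (Suc n) (map_pmf fst \<pi>)) (memoryless (cond_law \<pi>))
    = do {x \<leftarrow> map_pmf fst \<pi>; xs \<leftarrow> replicate_pmf n (map_pmf fst \<pi>); y \<leftarrow> cond_law \<pi> x;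
          ys \<leftarrow> memoryless (cond_law \<pi>) xs; return_pmf (x # xs, y # ys)}"
    by (simp add: bind_assoc_pmf bind_return_pmf map_bind_pmf)
  also have "\<dots> = do {x \<leftarrow> map_pmf fst \<pi>; y \<leftarrow> cond_law \<pi> x; xs \<leftarrow> replicate_pmf n (map_pmf fst \<pi>);
          ys \<leftarrow> memoryless (cond_law \<pi>) xs; return_pmf (x # xs, y # ys)}"
    by (subst bind_commute_pmf) simp
  also have "\<dots> = do {z \<leftarrow> joint_law (map_pmf fst \<pi>) (cond_law \<pi>);
      l \<leftarrow> joint_law (replicate_pmf n (map_pmf fst \<pi>)) (memoryless (cond_law \<pi>));
      return_pmf (fst z # fst l, snd z # snd l)}"
    by (simp add: bind_assoc_pmf bind_map_pmf)
  also have "\<dots> = map_pmf (\<lambda>l. (map fst l, map snd l)) (replicate_pmf (Suc n) \<pi>)"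
    unfolding bind_cond_law Suc.IH by (simp add: bind_map_pmf map_bind_pmf)
  finally show ?case .
qed (simp add: bind_return_pmf)

lemma pmf_le_pmf_map: "pmf P z \<le> pmf (map_pmf f P) (f z)"
  unfolding pmf_map by (subst measure_pmf_single[symmetric], rule measure_pmf.finite_measure_mono) auto

lemma pmf_mult_le_pmf_bind: "pmf P w * pmf (K w) y \<le> pmf (bind_pmf P K) y"
proof -
  have "pmf P w * pmf (K w) y = pmf (joint_law P K) (w, y)"
    by (simp add: pmf_bind_Pair)
  also have "\<dots> \<le> pmf (map_pmf snd (joint_law P K)) y"
    using pmf_le_pmf_map[of "joint_law P K" "(w, y)" snd] by simp
  finally show ?thesis by (simp add: map_bind_pmf map_pmf_comp)
qed

section \<open>Averages over an auxiliary with infinitely many values\<close>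

lemma integrable_bounded_pmf:
  fixes f :: "'a \<Rightarrow> 'b::{banach, second_countable_topology}"
  shows "(\<And>w. norm (f w) \<le> B) \<Longrightarrow> integrable (measure_pmf P) f"
  by (rule measure_pmf.integrable_const_bound[where B = B]) auto

text \<open>A mixture of infinitely many points is not a finite convex combination. If the mean lay
  outside \<open>C\<close>, a hyperplane would separate it from all the \<open>z w\<close>, against
  linearity of the integral.\<close>

lemma integral_in_closed_convex:
  fixes C :: "'a::euclidean_space set"
  assumes "closed C" "convex C" "bounded C" "\<And>w. z w \<in> C"
  shows "(\<integral>w. z w \<partial>measure_pmf PW) \<in> C"
proof (rule ccontr)
  assume "(\<integral>w. z w \<partial>measure_pmf PW) \<notin> C"
  then obtain a b where ab: "a \<bullet> (\<integral>w. z w \<partial>measure_pmf PW) < b" "\<And>x. x \<in> C \<Longrightarrow> b < a \<bullet> x"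
    using separating_hyperplane_closed_point[OF assms(2,1)] by blast
  obtain B where B: "\<And>x. x \<in> C \<Longrightarrow> norm x \<le> B" using assms(3) bounded_iff by blast
  have int: "integrable (measure_pmf PW) z"
    using B assms(4) by (intro integrable_bounded_pmf) auto
  have "b = (\<integral>w. b \<partial>measure_pmf PW)" by simp
  also have "\<dots> \<le> (\<integral>w. a \<bullet> z w \<partial>measure_pmf PW)"
    using int ab(2)[OF assms(4)] by (intro integral_mono) (auto intro: less_imp_le)
  also have "\<dots> = a \<bullet> (\<integral>w. z w \<partial>measure_pmf PW)"
    using int by simp
  finally show False using ab(1) by simp
qed

lemma pos_factor:
  fixes f :: "'i \<Rightarrow> real"
  assumes "0 < (\<Prod>i\<in>A. f i)" "finite A" "i \<in> A" "0 \<le> f i"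
  shows "0 < f i"
  using assms by (metis less_le prod_zero)

lemma expect_map_eq: "map_pmf f T = P \<Longrightarrow> expect T (\<lambda>z. g (f z)) = expect P g"
  by auto

text \<open>Let \<open>w = (k, m)\<close> and let \<open>q w\<close> be the probability of
  \<open>m\<close> given \<open>k\<close>, so that H(M|K) is the mean of \<open>- ln (q w)\<close>.
  The pointwise bound \<open>A\<close> controls the third coordinate, since
  \<open>- ln (pmf PW w) = n * R0 - ln (q w)\<close>. The bound \<open>B\<close> controls the
  second: it gives \<open>- ent (PX w) \<le> - ln (q w) + E[ln P(X^n)]\<close> given
  \<open>w\<close>, and on averaging I(W;X) is at most H(M|K) / n.\<close>

lemma exact_rates_subset_hull_region:
  assumes n: "n \<ge> 1"
  shows "exact_rates \<pi> n \<subseteq> hull_region \<pi>"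
proof (rule subsetI)
  fix r assume "r \<in> exact_rates \<pi> n"
  then obtain R0 R N enc dec where r: "r = (R0, R)" and R0: "0 \<le> R0" and N: "real N = exp (real n * R0)"
    and len: "\<And>m k ys. ys \<in> set_pmf (dec m k) \<Longrightarrow> length ys = n"
    and cond: "\<And>xs. xs \<in> set_pmf (replicate_pmf n (map_pmf fst \<pi>)) \<Longrightarrow>
       cond_law (map_pmf (\<lambda>(xs, k, m, ys). (xs, ys)) (synthesis_law n N (map_pmf fst \<pi>) enc dec)) xs
         = memoryless (cond_law \<pi>) xs"
    and R: "ereal (1 / real n) * enn2ereal (cond_entropy (map_pmf (\<lambda>(xs, k, m, ys). (k, m))
        (synthesis_law n N (map_pmf fst \<pi>) enc dec))) \<le> ereal R"
    unfolding exact_rates_def Let_def by blast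
  define \<pi>X where "\<pi>X = map_pmf fst \<pi>"
  define J where "J = synthesis_law n N \<pi>X enc dec"
  define JXY where "JXY = map_pmf (\<lambda>(xs, k, m, ys). (xs, ys)) J"
  define JWX where "JWX = map_pmf (\<lambda>(xs, k, m, ys). ((k, m), xs)) J"
  define PW where "PW = map_pmf (\<lambda>(xs, k, m, ys). (k, m)) J"
  define PX where "PX = cond_law JWX"
  define PY where "PY w = dec (snd w) (fst w)" for w
  define PK where "PK = pmf_of_set {1..N}"
  define q where "q w = pmf (cond_law PW (fst w)) (snd w)" for w
  have "N \<noteq> 0" using N by (metis exp_not_eq_zero of_nat_0)
  then have Ne: "finite {1..N}" "{1..N} \<noteq> {}" by auto
  have PW_fst: "map_pmf fst JWX = PW" by (simp add: PW_def JWX_def map_pmf_comp case_prod_unfold)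
  have JWX_eq: "JWX = joint_law PW PX"
    unfolding PX_def PW_fst[symmetric] by (rule bind_cond_law[symmetric])
  have J_xkm: "JWX = do {xs \<leftarrow> replicate_pmf n \<pi>X; k \<leftarrow> PK; m \<leftarrow> enc xs k; return_pmf ((k, m), xs)}"
    by (simp add: JWX_def J_def synthesis_law_def PK_def map_bind_pmf bind_return_pmf)
  have J_eq: "J = do {wx \<leftarrow> JWX; ys \<leftarrow> PY (fst wx); return_pmf (snd wx, fst (fst wx), snd (fst wx), ys)}"
    unfolding J_xkm by (simp add: J_def synthesis_law_def PK_def bind_assoc_pmf bind_return_pmf PY_def)
  have JXY1: "JXY = bind_pmf PW (\<lambda>w. pair_pmf (PX w) (PY w))"
    unfolding JXY_def J_eq JWX_eq
    by (simp add: map_bind_pmf bind_assoc_pmf bind_map_pmf pair_pmf_def)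
  have JXY_fst: "map_pmf fst JXY = replicate_pmf n \<pi>X"
    by (simp add: JXY_def J_def synthesis_law_def map_bind_pmf bind_return_pmf')
  have JXY2: "JXY = map_pmf (\<lambda>l. (map fst l, map snd l)) (replicate_pmf n \<pi>)"
  proof -
    have "JXY = joint_law (replicate_pmf n \<pi>X) (cond_law JXY)"
      unfolding JXY_fst[symmetric] by (rule bind_cond_law[symmetric])
    also have "\<dots> = joint_law (replicate_pmf n \<pi>X) (memoryless (cond_law \<pi>))"
      using cond by (intro bind_pmf_cong) (auto simp: JXY_def J_def \<pi>X_def)
    also have "\<dots> = map_pmf (\<lambda>l. (map fst l, map snd l)) (replicate_pmf n \<pi>)"
      unfolding \<pi>X_def by (rule memoryless_cond_law)
    finally show ?thesis .
  qed
  have lenX: "length xs = n" if "w \<in> set_pmf PW" "xs \<in> set_pmf (PX w)" for w xs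
  proof -
    have "(w, xs) \<in> set_pmf JWX" using that by (auto simp: JWX_eq)
    then show ?thesis by (auto simp: J_xkm set_replicate_pmf)
  qed
  have lenY: "length ys = n" if "ys \<in> set_pmf (PY w)" for w ys
    using len that by (simp add: PY_def)
  have finX: "finite (set_pmf (PX w))" if "w \<in> set_pmf PW" for w
    using lenX[OF that] by (intro finite_lists_pmf[of _ n]) auto
  have finY: "finite (set_pmf (PY w))" for w
    by (rule finite_lists_pmf[of "PY w" n]) (use lenY in blast)
  have A: "pmf PW w * pmf (PX w) xs * pmf (PY w) ys \<le> (\<Prod>i<n. pmf \<pi> (xs ! i, ys ! i))"
    if "length xs = n" "length ys = n" for w xs ys
  proof -
    have "pmf PW w * pmf (PX w) xs * pmf (PY w) ys = pmf PW w * pmf (pair_pmf (PX w) (PY w)) (xs, ys)"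
      by (simp add: pmf_pair)
    also have "\<dots> \<le> pmf JXY (xs, ys)" unfolding JXY1 by (rule pmf_mult_le_pmf_bind)
    also have "\<dots> = pmf (map_pmf (\<lambda>l. (map fst l, map snd l)) (replicate_pmf n \<pi>)) ((\<lambda>l. (map fst l, map snd l)) (zip xs ys))"
      using that by (simp add: JXY2)
    also have "\<dots> = pmf (replicate_pmf n \<pi>) (zip xs ys)"
      by (rule pmf_map_inj') (auto simp: inj_on_def intro: pair_list_eqI)
    finally show ?thesis using that by (simp add: pmf_replicate_pmf)
  qed
  have KPW: "pmf PW w = pmf PK (fst w) * q w" for w
  proof -
    have "map_pmf fst PW = PK"
      unfolding PW_fst[symmetric] J_xkm by (simp add: map_bind_pmf map_pmf_comp bind_return_pmf')
    then have "PW = joint_law PK (cond_law PW)" using bind_cond_law[of PW] by simp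
    then have "pmf PW (fst w, snd w) = pmf PK (fst w) * q w" unfolding q_def by (metis pmf_bind_Pair)
    then show ?thesis by simp
  qed
  have PK1: "pmf PK (fst w) = 1 / real N" if "w \<in> set_pmf PW" for w
  proof -
    have "pmf PK (fst w) \<noteq> 0" using that KPW[of w] by (auto simp: set_pmf_iff)
    then show ?thesis using Ne by (auto simp: PK_def pmf_of_set indicator_def split: if_splits)
  qed
  have q0: "0 < q w" if "w \<in> set_pmf PW" for w
    using pmf_positive[OF that] KPW[of w] PK1[OF that] by (simp add: zero_less_divide_iff)
  have q1: "q w \<le> 1" for w by (simp add: q_def pmf_le_1)
  \<comment> \<open>Forgetting \<open>m\<close> leaves the independent pair of \<open>K\<close> and
    X^n, and forgetting a coordinate can only increase a mass.\<close>
  have B: "pmf (PX w) xs * q w \<le> pmf (replicate_pmf n \<pi>X) xs" if w: "w \<in> set_pmf PW" for w xs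
  proof -
    have "map_pmf (\<lambda>((k, m), xs). (k, xs)) JWX = pair_pmf PK (replicate_pmf n \<pi>X)"
      unfolding J_xkm pair_pmf_def
      by (subst (2) bind_commute_pmf) (simp add: map_bind_pmf)
    then have "pmf JWX (w, xs) \<le> pmf (pair_pmf PK (replicate_pmf n \<pi>X)) (fst w, xs)"
      using pmf_le_pmf_map[of JWX "(w, xs)" "\<lambda>((k, m), xs). (k, xs)"] by (simp add: case_prod_unfold)
    then have "pmf PW w * pmf (PX w) xs \<le> pmf PK (fst w) * pmf (replicate_pmf n \<pi>X) xs"
      by (simp add: JWX_eq pmf_bind_Pair pmf_pair)
    then show ?thesis unfolding KPW PK1[OF w] using \<open>N \<noteq> 0\<close> by (simp add: field_simps)
  qed
  let ?C = "convex hull (rate_set \<pi>)"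
  define good where "good w z \<longleftrightarrow> z \<in> ?C \<and>
    (\<forall>x y. real n * fst z $ (x, y) = (\<Sum>i<n. pmf (map_pmf (\<lambda>xs. xs ! i) (PX w)) x * pmf (map_pmf (\<lambda>ys. ys ! i) (PY w)) y)) \<and>
    real n * fst (snd z) = - ent (PX w) \<and> real n * snd (snd z) \<le> - ln (pmf PW w)" for w z
  have good_ex: "\<exists>z. good w z" if w: "w \<in> set_pmf PW" for w
  proof -
    have pos: "0 < pmf \<pi> (xs ! i, ys ! i)" if "xs \<in> set_pmf (PX w)" "ys \<in> set_pmf (PY w)" "i < n" for xs ys i
    proof -
      have "0 < pmf PW w * pmf (PX w) xs * pmf (PY w) ys" using w that by (simp add: pmf_positive)
      also have "\<dots> \<le> (\<Prod>i<n. pmf \<pi> (xs ! i, ys ! i))" using lenX[OF w that(1)] lenY[OF that(2)] by (rule A)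
      finally show ?thesis by (rule pos_factor) (use that in auto)
    qed
    have "\<exists>v h s. (v, h, s) \<in> ?C \<and>
      (\<forall>x y. real n * v $ (x, y) = (\<Sum>i<n. pmf (map_pmf (\<lambda>xs. xs ! i) (PX w)) x * pmf (map_pmf (\<lambda>ys. ys ! i) (PY w)) y)) \<and>
      real n * h = - ent (PX w) \<and> real n * s \<le> - ln (pmf PW w)"
    proof (rule rate_set_tensor)
      show "set_pmf (PX w) \<subseteq> {xs. length xs = n}" using lenX[OF w] by auto
      show "set_pmf (PY w) \<subseteq> {ys. length ys = n}" using lenY by blast
      show "(xs ! i, ys ! i) \<in> set_pmf \<pi>" if "xs \<in> set_pmf (PX w)" "ys \<in> set_pmf (PY w)" "i < n" for xs ys i
        using pos[OF that] by (auto simp: set_pmf_iff)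
      fix T assume T: "T \<in> couplings (PX w) (PY w)"
      have finT: "finite (set_pmf T)" using finite_coupling[OF T finX[OF w] finY] .
      have "expect T (block_cost \<pi> n)
        \<le> expect T (\<lambda>z. - ln (pmf PW w) + (- ln (pmf (PX w) (fst z)) + - ln (pmf (PY w) (snd z))))"
      proof (rule expect_mono_finite[OF finT])
        fix z assume "z \<in> set_pmf T"
        then have z: "fst z \<in> set_pmf (PX w)" "snd z \<in> set_pmf (PY w)" using set_pmf_coupling[OF T] by auto
        have p: "0 < pmf PW w" "0 < pmf (PX w) (fst z)" "0 < pmf (PY w) (snd z)"
          using w z by (simp_all add: pmf_positive)
        have "block_cost \<pi> n z = - ln (\<Prod>i<n. pmf \<pi> (fst z ! i, snd z ! i))"
          unfolding block_cost_def cost_def using less_imp_neq[OF pos[OF z]]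
          by (subst ln_prod) (auto simp: sum_negf simp del: pmf_eq_0_set_pmf)
        also have "\<dots> \<le> - ln (pmf PW w * pmf (PX w) (fst z) * pmf (PY w) (snd z))"
          by (intro le_imp_neg_le ln_mono A[OF lenX[OF w z(1)] lenY[OF z(2)]]) (use p in auto)
        also have "\<dots> = - ln (pmf PW w) + (- ln (pmf (PX w) (fst z)) + - ln (pmf (PY w) (snd z)))"
          using p by (simp add: ln_mult_pos)
        finally show "block_cost \<pi> n z \<le> - ln (pmf PW w) + (- ln (pmf (PX w) (fst z)) + - ln (pmf (PY w) (snd z)))" .
      qed
      also have "\<dots> = - ln (pmf PW w) + (expect T (\<lambda>z. - ln (pmf (PX w) (fst z))) + expect T (\<lambda>z. - ln (pmf (PY w) (snd z))))"
        using finT by (simp add: expect_add_finite expect_diff_finite)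
      also have "expect T (\<lambda>z. - ln (pmf (PX w) (fst z))) = ent (PX w)"
        unfolding ent_def by (rule expect_map_eq) (use T in \<open>simp add: couplings_def\<close>)
      also have "expect T (\<lambda>z. - ln (pmf (PY w) (snd z))) = ent (PY w)"
        unfolding ent_def by (rule expect_map_eq) (use T in \<open>simp add: couplings_def\<close>)
      finally show "expect T (block_cost \<pi> n) \<le> - ln (pmf PW w) + ent (PX w) + ent (PY w)" by simp
    qed
    then obtain v h s where "good w (v, h, s)" unfolding good_def fst_conv snd_conv by blast
    then show ?thesis by blast
  qed
  obtain z0 where z0: "z0 \<in> ?C" using rate_set_nonempty[of \<pi>] by fastforce
  \<comment> \<open>The default \<open>z0\<close> keeps \<open>z\<close> inside the hull off the
    support as well, as \<open>integral_in_closed_convex\<close> asks for every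
    \<open>w\<close>.\<close>
  define z where "z w = (if w \<in> set_pmf PW then SOME z. good w z else z0)" for w
  have good: "good w (z w)" if "w \<in> set_pmf PW" for w
    using someI_ex[OF good_ex[OF that]] that by (simp add: z_def)
  have zC: "z w \<in> ?C" for w
    using good[of w] z0 by (cases "w \<in> set_pmf PW") (auto simp: good_def z_def)
  have bd: "bounded ?C" and cl: "closed ?C"
    using compact_hull_rate_set[of \<pi>] by (simp_all add: compact_imp_bounded compact_imp_closed)
  define Z where "Z = (\<integral>w. z w \<partial>measure_pmf PW)"
  have ZC: "Z \<in> ?C" unfolding Z_def by (rule integral_in_closed_convex[OF cl convex_convex_hull bd zC])
  obtain Bz where Bz: "\<And>x. x \<in> ?C \<Longrightarrow> norm x \<le> Bz" using bd bounded_iff by blast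
  have intz: "integrable (measure_pmf PW) z" by (rule integrable_bounded_pmf) (rule Bz[OF zC])
  have lin: "f Z = (\<integral>w. f (z w) \<partial>measure_pmf PW)" "integrable (measure_pmf PW) (\<lambda>w. f (z w))"
    if "bounded_linear f" for f :: "(real ^ ('a \<times> 'b)) \<times> real \<times> real \<Rightarrow> real"
    unfolding Z_def using integral_bounded_linear[OF that intz] integrable_bounded_linear[OF that intz] by simp_all
  have bl1: "bounded_linear (\<lambda>z :: (real ^ ('a \<times> 'b)) \<times> real \<times> real. fst z $ xy)" for xy
    by (intro bounded_linear_compose[OF bounded_linear_vec_nth bounded_linear_fst])
  have bl2: "bounded_linear (\<lambda>z :: (real ^ ('a \<times> 'b)) \<times> real \<times> real. fst (snd z))"
    by (intro bounded_linear_compose[OF bounded_linear_fst bounded_linear_snd])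
  have bl3: "bounded_linear (\<lambda>z :: (real ^ ('a \<times> 'b)) \<times> real \<times> real. snd (snd z))"
    by (intro bounded_linear_compose[OF bounded_linear_snd bounded_linear_snd])
  have Z1: "fst Z = (\<chi> z. pmf \<pi> z)"
  proof (rule vec_eq_iff[THEN iffD2], rule allI)
    fix xy :: "'a \<times> 'b"
    obtain x y where xy: "xy = (x, y)" by force
    \<comment> \<open>X^n and Y^n are independent given \<open>W\<close>, so mixing the products of
      the letter marginals at position \<open>i\<close> gives the law of the \<open>i\<close>-th
      letter pair, which is \<pi>.\<close>
    have marg: "bind_pmf PW (\<lambda>w. pair_pmf (map_pmf (\<lambda>xs. xs ! i) (PX w)) (map_pmf (\<lambda>ys. ys ! i) (PY w))) = \<pi>"
      if "i < n" for i
    proof -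
      have "bind_pmf PW (\<lambda>w. pair_pmf (map_pmf (\<lambda>xs. xs ! i) (PX w)) (map_pmf (\<lambda>ys. ys ! i) (PY w)))
        = map_pmf (\<lambda>(xs, ys). (xs ! i, ys ! i)) JXY"
        by (simp add: JXY1 map_bind_pmf pair_map_pmf1 pair_map_pmf2 map_pmf_comp case_prod_unfold)
      also have "\<dots> = map_pmf (\<lambda>l. l ! i) (replicate_pmf n \<pi>)"
        unfolding JXY2 map_pmf_comp using that by (intro map_pmf_cong) (auto simp: set_replicate_pmf)
      finally show ?thesis using that by (simp add: map_nth_replicate_pmf)
    qed
    have "real n * fst Z $ xy = (\<integral>w. real n * fst (z w) $ xy \<partial>measure_pmf PW)"
      using lin[OF bl1, of xy] by simp
    also have "\<dots> = (\<integral>w. (\<Sum>i<n. pmf (map_pmf (\<lambda>xs. xs ! i) (PX w)) x * pmf (map_pmf (\<lambda>ys. ys ! i) (PY w)) y) \<partial>measure_pmf PW)"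
      using good by (intro expect_cong) (auto simp: good_def xy)
    also have "\<dots> = (\<Sum>i<n. \<integral>w. pmf (map_pmf (\<lambda>xs. xs ! i) (PX w)) x * pmf (map_pmf (\<lambda>ys. ys ! i) (PY w)) y \<partial>measure_pmf PW)"
      by (intro Bochner_Integration.integral_sum integrable_bounded_pmf[where B = 1])
        (auto simp: abs_mult pmf_le_1 intro!: mult_le_one)
    also have "\<dots> = (\<Sum>i<n. pmf \<pi> (x, y))"
    proof (rule sum.cong[OF refl])
      fix i assume "i \<in> {..<n}"
      then have "pmf \<pi> (x, y) = pmf (bind_pmf PW (\<lambda>w. pair_pmf (map_pmf (\<lambda>xs. xs ! i) (PX w)) (map_pmf (\<lambda>ys. ys ! i) (PY w)))) (x, y)"
        using marg by simp
      then show "(\<integral>w. pmf (map_pmf (\<lambda>xs. xs ! i) (PX w)) x * pmf (map_pmf (\<lambda>ys. ys ! i) (PY w)) y \<partial>measure_pmf PW) = pmf \<pi> (x, y)"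
        by (simp only: pmf_bind pmf_pair)
    qed
    finally show "fst Z $ xy = (\<chi> z. pmf \<pi> z) $ xy" using n xy by simp
  qed
  have ent_int: "cond_entropy PW = (\<integral>\<^sup>+ w. ennreal (- ln (q w)) \<partial>measure_pmf PW)"
  proof -
    have "(\<integral>\<^sup>+ w. ennreal (- ln (q w)) \<partial>measure_pmf PW)
      = (\<integral>\<^sup>+ w. ennreal (- ln (q w)) \<partial>measure_pmf (joint_law (map_pmf fst PW) (cond_law PW)))"
      by (simp only: bind_cond_law)
    also have "\<dots> = cond_entropy PW"
      by (simp add: cond_entropy_def shannon_entropy_eq_nn_integral q_def)
    finally show ?thesis by simp
  qed
  define H where "H = enn2real (cond_entropy PW)"
  have Rn: "ereal (1 / real n) * enn2ereal (cond_entropy PW) \<le> ereal R"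
    using R by (simp add: PW_def J_def \<pi>X_def)
  \<comment> \<open>A real rate \<open>R\<close> rules out infinite conditional entropy, although
    the message may have infinite support.\<close>
  have fin: "cond_entropy PW \<noteq> \<infinity>" using Rn n by auto
  then have ceH: "cond_entropy PW = ennreal H" by (simp add: H_def less_top)
  have H0: "0 \<le> H" by (simp add: H_def)
  have HR: "H \<le> real n * R" using Rn n H0 by (simp add: ceH enn2ereal_ennreal field_simps)
  have intq: "integrable (measure_pmf PW) (\<lambda>w. - ln (q w))"
    using ent_int fin q0 q1 by (intro integrableI_nonneg) (auto simp: AE_measure_pmf_iff less_top)
  have Hq: "(\<integral>w. - ln (q w) \<partial>measure_pmf PW) = H"
    unfolding H_def ent_int using q0 q1 by (intro integral_eq_nn_integral) (auto simp: AE_measure_pmf_iff)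
  have mono: "(\<integral>w. f w \<partial>measure_pmf PW) \<le> (\<integral>w. g w \<partial>measure_pmf PW)"
    if "integrable (measure_pmf PW) f" "integrable (measure_pmf PW) g" "\<And>w. w \<in> set_pmf PW \<Longrightarrow> f w \<le> g w" for f g :: "nat \<times> nat \<Rightarrow> real"
    using that by (intro integral_mono_AE) (auto simp: AE_measure_pmf_iff)
  have Z3: "real n * snd (snd Z) \<le> real n * R0 + H"
  proof -
    have "real n * snd (snd Z) = (\<integral>w. real n * snd (snd (z w)) \<partial>measure_pmf PW)"
      using lin[OF bl3] by simp
    also have "\<dots> \<le> (\<integral>w. real n * R0 + - ln (q w) \<partial>measure_pmf PW)"
    proof (rule mono)
      fix w assume w: "w \<in> set_pmf PW"
      have "ln (pmf PW w) = - (real n * R0) + ln (q w)"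
        unfolding KPW PK1[OF w] using q0[OF w] N by (simp add: ln_div ln_mult_pos)
      then show "real n * snd (snd (z w)) \<le> real n * R0 + - ln (q w)" using good[OF w] by (simp add: good_def)
    qed (use lin[OF bl3] intq in auto)
    also have "\<dots> = real n * R0 + H" using intq Hq by simp
    finally show ?thesis .
  qed
  have Z2: "real n * fst (snd Z) \<le> H - real n * ent \<pi>X"
  proof -
    \<comment> \<open>A linear functional of the triple: \<open>n * ?L (z w)\<close> is the
      conditional mean of \<open>ln P(X^n)\<close> given \<open>w\<close>. By linearity its average
      is read off at \<open>Z\<close>, whose first coordinate is \<pi>, and equals
      \<open>- n * ent \<pi>X\<close>.\<close>
    let ?L = "\<lambda>z :: (real ^ ('a \<times> 'b)) \<times> real \<times> real. \<Sum>xy\<in>UNIV. fst z $ xy * ln (pmf \<pi>X (fst xy))"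
    have bL: "bounded_linear ?L"
      by (intro bounded_linear_sum bounded_linear_mult_const bl1)
    have "real n * fst (snd Z) = (\<integral>w. real n * fst (snd (z w)) \<partial>measure_pmf PW)"
      using lin[OF bl2] by simp
    also have "\<dots> \<le> (\<integral>w. - ln (q w) + real n * ?L (z w) \<partial>measure_pmf PW)"
    proof (rule mono)
      fix w assume w: "w \<in> set_pmf PW"
      have "- ent (PX w) \<le> expect (PX w) (\<lambda>xs. - ln (q w) + (\<Sum>i<n. ln (pmf \<pi>X (xs ! i))))"
      proof -
        have "- ent (PX w) = expect (PX w) (\<lambda>xs. ln (pmf (PX w) xs))" by (simp add: ent_def)
        also have "\<dots> \<le> expect (PX w) (\<lambda>xs. - ln (q w) + (\<Sum>i<n. ln (pmf \<pi>X (xs ! i))))"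
        proof (rule expect_mono_finite[OF finX[OF w]])
          fix xs assume xs: "xs \<in> set_pmf (PX w)"
          have p: "0 < pmf (PX w) xs" "0 < q w" using xs q0[OF w] by (simp_all add: pmf_positive)
          have le: "pmf (PX w) xs * q w \<le> (\<Prod>i<n. pmf \<pi>X (xs ! i))"
            using B[OF w, of xs] lenX[OF w xs] by (simp add: pmf_replicate_pmf)
          moreover have "0 < pmf (PX w) xs * q w" using p by simp
          ultimately have "0 < (\<Prod>i<n. pmf \<pi>X (xs ! i))" by linarith
          then have pp: "\<And>i. i < n \<Longrightarrow> 0 < pmf \<pi>X (xs ! i)" by (rule pos_factor) auto
          have "ln (pmf (PX w) xs * q w) \<le> ln (\<Prod>i<n. pmf \<pi>X (xs ! i))"
            using le p by (intro ln_mono) auto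
          also have "\<dots> = (\<Sum>i<n. ln (pmf \<pi>X (xs ! i)))" using less_imp_neq[OF pp]
            by (subst ln_prod) (auto simp del: pmf_eq_0_set_pmf)
          finally show "ln (pmf (PX w) xs) \<le> - ln (q w) + (\<Sum>i<n. ln (pmf \<pi>X (xs ! i)))"
            using p by (simp add: ln_mult_pos)
        qed
        finally show ?thesis .
      qed
      also have "\<dots> = - ln (q w) + (\<Sum>i<n. expect (PX w) (\<lambda>xs. ln (pmf \<pi>X (xs ! i))))"
        using finX[OF w] by (simp add: expect_diff_finite integrable_measure_pmf_finite)
      also have "(\<Sum>i<n. expect (PX w) (\<lambda>xs. ln (pmf \<pi>X (xs ! i)))) = real n * ?L (z w)"
      proof -
        have "real n * ?L (z w) = (\<Sum>x\<in>UNIV. \<Sum>y\<in>UNIV. real n * fst (z w) $ (x, y) * ln (pmf \<pi>X x))"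
          by (simp add: sum_distrib_left sum.cartesian_product mult.assoc UNIV_Times_UNIV case_prod_unfold)
        also have "\<dots> = (\<Sum>x\<in>UNIV. \<Sum>y\<in>UNIV. (\<Sum>i<n. pmf (map_pmf (\<lambda>xs. xs ! i) (PX w)) x * pmf (map_pmf (\<lambda>ys. ys ! i) (PY w)) y) * ln (pmf \<pi>X x))"
          using good[OF w] by (simp add: good_def)
        also have "\<dots> = (\<Sum>x\<in>UNIV. \<Sum>i<n. \<Sum>y\<in>UNIV. pmf (map_pmf (\<lambda>xs. xs ! i) (PX w)) x * ln (pmf \<pi>X x) * pmf (map_pmf (\<lambda>ys. ys ! i) (PY w)) y)"
        proof (rule sum.cong[OF refl])
          fix x
          show "(\<Sum>y\<in>UNIV. (\<Sum>i<n. pmf (map_pmf (\<lambda>xs. xs ! i) (PX w)) x * pmf (map_pmf (\<lambda>ys. ys ! i) (PY w)) y) * ln (pmf \<pi>X x))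
            = (\<Sum>i<n. \<Sum>y\<in>UNIV. pmf (map_pmf (\<lambda>xs. xs ! i) (PX w)) x * ln (pmf \<pi>X x) * pmf (map_pmf (\<lambda>ys. ys ! i) (PY w)) y)"
            by (subst sum.swap) (simp add: sum_distrib_left mult_ac)
        qed
        also have "\<dots> = (\<Sum>x\<in>UNIV. \<Sum>i<n. pmf (map_pmf (\<lambda>xs. xs ! i) (PX w)) x * ln (pmf \<pi>X x))"
          by (simp only: sum_distrib_left[symmetric] sum_pmf_UNIV mult_1_right)
        also have "\<dots> = (\<Sum>i<n. expect (map_pmf (\<lambda>xs. xs ! i) (PX w)) (\<lambda>x. ln (pmf \<pi>X x)))"
          unfolding expect_UNIV by (rule sum.swap)
        finally show ?thesis by simp
      qed
      finally show "real n * fst (snd (z w)) \<le> - ln (q w) + real n * ?L (z w)"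
        using good[OF w] by (simp add: good_def)
    next
      show "integrable (measure_pmf PW) (\<lambda>w. real n * fst (snd (z w)))" using lin(2)[OF bl2] by simp
      show "integrable (measure_pmf PW) (\<lambda>w. - ln (q w) + real n * ?L (z w))"
        by (intro Bochner_Integration.integrable_add integrable_mult_right intq lin(2)[OF bL])
    qed
    also have "\<dots> = H + real n * ?L Z"
      unfolding lin(1)[OF bL] Hq[symmetric]
      by (subst Bochner_Integration.integral_add[OF intq]) (use lin(2)[OF bL] in auto)
    also have "?L Z = (\<Sum>x\<in>UNIV. \<Sum>y\<in>UNIV. pmf \<pi> (x, y) * ln (pmf \<pi>X x))"
      by (simp add: Z1 sum.cartesian_product UNIV_Times_UNIV case_prod_unfold)
    also have "\<dots> = - ent \<pi>X"
      by (simp add: ent_UNIV sum_negf \<pi>X_def pmf_map_fst sum_distrib_right)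
    finally show ?thesis by simp
  qed
  have "((\<chi> z. pmf \<pi> z), fst (snd Z), snd (snd Z)) \<in> ?C" using ZC Z1 by (metis prod.collapse)
  moreover have "ent \<pi>X + fst (snd Z) \<le> R"
  proof -
    have "real n * (ent \<pi>X + fst (snd Z)) \<le> real n * R" using Z2 HR by (simp add: algebra_simps)
    then show ?thesis using n by simp
  qed
  moreover have "snd (snd Z) \<le> R + R0"
  proof -
    have "real n * snd (snd Z) \<le> real n * (R + R0)" using Z3 HR by (simp add: algebra_simps)
    then show ?thesis using n by simp
  qed
  moreover have "0 \<le> R" using HR H0 n by (metis less_le_trans linorder_not_less mult_pos_neg of_nat_0_less_iff order.trans zero_less_one)
  ultimately show "r \<in> hull_region \<pi>" unfolding hull_region_def r \<pi>X_def using R0 by blast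
qed

lemma R_exact_subset_R_region: "R_exact \<pi> \<subseteq> R_region \<pi>"
proof -
  have "R_exact \<pi> \<subseteq> hull_region \<pi>"
    unfolding R_exact_def using exact_rates_subset_hull_region by (intro closure_minimal closed_hull_region) auto
  then show ?thesis using hull_region_subset_R_region by blast
qed

section \<open>Random codebooks and typicality\<close>

lemma set_memoryless: "ys \<in> set_pmf (memoryless V xs) \<Longrightarrow> length ys = length xs"
  by (metis pmf_memoryless set_pmf_iff)

lemma finite_set_memoryless:
  "(\<And>x. x \<in> set xs \<Longrightarrow> finite (set_pmf (V x))) \<Longrightarrow> finite (set_pmf (memoryless V xs))"
  by (induction xs) auto

lemma expect_memoryless_prod:
  "(\<And>x. x \<in> set xs \<Longrightarrow> finite (set_pmf (V x))) \<Longrightarrow>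
    expect (memoryless V xs) (\<lambda>ys. \<Prod>i<length xs. h i (ys ! i)) = (\<Prod>i<length xs. expect (V (xs ! i)) (h i))"
proof (induction xs arbitrary: h)
  case (Cons x xs)
  have fin: "finite (set_pmf (V x))" "finite (set_pmf (memoryless V xs))"
    using Cons.prems by (auto intro: finite_set_memoryless)
  have "expect (memoryless V (x # xs)) (\<lambda>ys. \<Prod>i<length (x # xs). h i (ys ! i))
    = expect (V x) (\<lambda>y. expect (memoryless V xs) (\<lambda>ys. h 0 y * (\<Prod>i<length xs. h (Suc i) (ys ! i))))"
    using fin by (simp add: expect_bind prod.lessThan_Suc_shift del: prod.lessThan_Suc)
  also have "\<dots> = expect (V x) (h 0) * (\<Prod>i<length xs. expect (V (xs ! i)) (h (Suc i)))"
    using Cons.IH[of "\<lambda>i. h (Suc i)"] Cons.prems by simp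
  finally show ?case by (simp add: prod.lessThan_Suc_shift del: prod.lessThan_Suc)
qed simp

lemma finite_set_replicate_pmf: "finite (set_pmf p) \<Longrightarrow> finite (set_pmf (replicate_pmf n p))"
  unfolding replicate_pmf_eq_memoryless by (rule finite_set_memoryless)

lemma expect_replicate_prod:
  assumes "finite (set_pmf p)"
  shows "expect (replicate_pmf n p) (\<lambda>ys. \<Prod>i<n. h i (ys ! i)) = (\<Prod>i<n. expect p (h i))"
  using expect_memoryless_prod[of "replicate n ()" "\<lambda>_. p" h] assms
  by (simp add: replicate_pmf_eq_memoryless)

text \<open>The chord lies above the convex exponential; this reduces the exponential moment of a
  variable bounded between 0 and a cap to its mean.\<close>

lemma exp_chord:
  assumes "0 \<le> t" "t \<le> (1::real)"
  shows "exp (t * x) \<le> 1 + t * (exp x - 1)"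
proof -
  have "exp ((1 - t) *\<^sub>R 0 + t *\<^sub>R x) \<le> (1 - t) * exp 0 + t * exp x"
    by (rule convex_onD[OF exp_convex]) (use assms in auto)
  then show ?thesis by (simp add: algebra_simps)
qed

text \<open>The large-deviation exponent of a unit-mean Poisson variable at
  \<open>1 + \<delta>\<close>, as in the multiplicative Chernoff bound.\<close>

definition chernoff :: "real \<Rightarrow> real" where
  "chernoff \<delta> = (1 + \<delta>) * ln (1 + \<delta>) - \<delta>"

lemma chernoff_pos:
  assumes "0 < \<delta>"
  shows "0 < chernoff \<delta>"
proof -
  have "ln (1 / (1 + \<delta>)) < 1 / (1 + \<delta>) - 1"
    using assms ln_le_minus_one[of "1 / (1 + \<delta>)"] ln_eq_minus_one[of "1 / (1 + \<delta>)"] by (auto simp: less_le)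
  then have "(1 + \<delta>) * (- ln (1 + \<delta>)) < (1 + \<delta>) * (1 / (1 + \<delta>) - 1)"
    using assms by (intro mult_strict_left_mono) (auto simp: ln_div)
  also have "\<dots> = - \<delta>" using assms by (simp add: field_simps)
  finally show ?thesis by (simp add: chernoff_def)
qed

text \<open>Chernoff bound and union bound for an independent codebook, phrased without events: if every
  codebook violated some constraint, the sum of the exponential moments would be at least 1.\<close>

lemma random_codebook:
  fixes \<mu> :: "'w pmf" and Z :: "'c \<Rightarrow> 'w \<Rightarrow> real" and J :: "'c \<Rightarrow> 'i set"
  assumes fin: "finite (set_pmf \<mu>)" "finite I" "finite C"
    and J: "\<And>c. c \<in> C \<Longrightarrow> J c \<subseteq> I" and B: "\<And>c. c \<in> C \<Longrightarrow> 0 < B c" and \<delta>: "0 < \<delta>"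
    and Z: "\<And>c w. c \<in> C \<Longrightarrow> w \<in> set_pmf \<mu> \<Longrightarrow> 0 \<le> Z c w \<and> Z c w \<le> B c"
    and mean: "\<And>c. c \<in> C \<Longrightarrow> expect \<mu> (Z c) \<le> 1"
    and small: "(\<Sum>c\<in>C. exp (- chernoff \<delta> * real (card (J c)) / B c)) < 1"
  shows "\<exists>\<omega>. (\<forall>i. \<omega> i \<in> set_pmf \<mu>) \<and> (\<forall>c\<in>C. (\<Sum>i\<in>J c. Z c (\<omega> i)) \<le> (1 + \<delta>) * real (card (J c)))"
proof (rule ccontr)
  assume neg: "\<not> ?thesis"
  \<comment> \<open>\<open>d\<close> is the default value of \<open>Pi_pmf\<close> outside
    \<open>I\<close>; taken from the support of \<mu>, it puts \<open>\<omega> i\<close> into that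
    support for every index.\<close>
  obtain d where d: "d \<in> set_pmf \<mu>" using set_pmf_not_empty by fast
  define P where "P = Pi_pmf I d (\<lambda>_. \<mu>)"
  have setP: "set_pmf P = PiE_dflt I d (\<lambda>_. set_pmf \<mu>)"
    unfolding P_def using fin by (simp add: set_Pi_pmf o_def)
  have finP: "finite (set_pmf P)" unfolding setP using fin by (intro finite_PiE_dflt) auto
  \<comment> \<open>With this exponent \<open>exp (s c * B c) = 1 + \<delta>\<close>, so the chord
    bound has slope \<open>\<delta> / B c\<close>; it is also the value that makes the final
    exponent equal to \<open>chernoff \<delta>\<close> per unit of
    \<open>card (J c) / B c\<close>.\<close>
  define s where "s c = ln (1 + \<delta>) / B c" for c
  have s: "0 < s c" if "c \<in> C" for c using B[OF that] \<delta> by (simp add: s_def)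
  define X where "X c \<omega> = exp (s c * (\<Sum>i\<in>J c. Z c (\<omega> i)) - s c * ((1 + \<delta>) * real (card (J c))))" for c \<omega>
  have "1 \<le> expect P (\<lambda>\<omega>. \<Sum>c\<in>C. X c \<omega>)"
  proof (rule expect_ge_const[OF finP])
    fix \<omega> assume \<omega>: "\<omega> \<in> set_pmf P"
    then have "\<forall>i. \<omega> i \<in> set_pmf \<mu>" unfolding setP PiE_dflt_def using d by auto
    then have "\<not> (\<forall>c\<in>C. (\<Sum>i\<in>J c. Z c (\<omega> i)) \<le> (1 + \<delta>) * real (card (J c)))" using neg by blast
    then obtain c where c: "c \<in> C" "(1 + \<delta>) * real (card (J c)) < (\<Sum>i\<in>J c. Z c (\<omega> i))"
      by (auto simp: not_le)
    have "s c * ((1 + \<delta>) * real (card (J c))) \<le> s c * (\<Sum>i\<in>J c. Z c (\<omega> i))"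
      using c s by (intro mult_left_mono) (auto intro: less_imp_le)
    then have "1 \<le> X c \<omega>" by (simp add: X_def)
    also have "\<dots> \<le> (\<Sum>c\<in>C. X c \<omega>)" using c fin by (intro member_le_sum) (auto simp: X_def)
    finally show "1 \<le> (\<Sum>c\<in>C. X c \<omega>)" .
  qed
  also have "\<dots> = (\<Sum>c\<in>C. expect P (X c))"
    using finP by (simp add: integrable_measure_pmf_finite)
  also have "\<dots> \<le> (\<Sum>c\<in>C. exp (- chernoff \<delta> * real (card (J c)) / B c))"
  proof (rule sum_mono)
    fix c assume c: "c \<in> C"
    note Bc = B[OF c]
    have finJ: "finite (J c)" using J[OF c] fin(2) finite_subset by blast
    \<comment> \<open>Indices outside \<open>J c\<close> get the factor 1, so that the independence
      formula applies to the product over all of \<open>I\<close>.\<close>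
    define g where "g i w = (if i \<in> J c then exp (s c * Z c w) else 1)" for i w
    have "X c \<omega> = exp (- (s c * ((1 + \<delta>) * real (card (J c))))) * (\<Prod>i\<in>I. g i (\<omega> i))" for \<omega>
    proof -
      have "(\<Prod>i\<in>I. g i (\<omega> i)) = (\<Prod>i\<in>J c. exp (s c * Z c (\<omega> i)))"
        unfolding g_def using J[OF c] fin(2) by (simp add: prod.If_cases Int_absorb1)
      also have "\<dots> = exp (s c * (\<Sum>i\<in>J c. Z c (\<omega> i)))"
        by (simp add: exp_sum[OF finJ] sum_distrib_left)
      finally show ?thesis by (simp add: X_def mult_exp_exp)
    qed
    then have "X c = (\<lambda>\<omega>. exp (- (s c * ((1 + \<delta>) * real (card (J c))))) * (\<Prod>i\<in>I. g i (\<omega> i)))"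
      by (rule ext)
    then have "expect P (X c) = exp (- (s c * ((1 + \<delta>) * real (card (J c))))) * expect P (\<lambda>\<omega>. \<Prod>i\<in>I. g i (\<omega> i))"
      by simp
    also have "expect P (\<lambda>\<omega>. \<Prod>i\<in>I. g i (\<omega> i)) = (\<Prod>i\<in>I. expect \<mu> (g i))"
      unfolding P_def using fin by (intro expectation_prod_Pi_pmf) (auto intro: integrable_measure_pmf_finite simp: g_def)
    also have "\<dots> = (\<Prod>i\<in>J c. expect \<mu> (\<lambda>w. exp (s c * Z c w)))"
      unfolding g_def using J[OF c] fin(2)
      by (intro prod.mono_neutral_cong_right) auto
    also have "\<dots> = expect \<mu> (\<lambda>w. exp (s c * Z c w)) ^ card (J c)" by simp
    also have "\<dots> \<le> exp (\<delta> / B c) ^ card (J c)"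
    proof (rule power_mono)
      have "expect \<mu> (\<lambda>w. exp (s c * Z c w)) \<le> expect \<mu> (\<lambda>w. 1 + \<delta> / B c * Z c w)"
      proof (rule expect_mono_finite[OF fin(1)])
        fix w assume "w \<in> set_pmf \<mu>"
        then have "0 \<le> Z c w / B c" "Z c w / B c \<le> 1" using Z[OF c] Bc by auto
        from exp_chord[OF this, of "ln (1 + \<delta>)"] show "exp (s c * Z c w) \<le> 1 + \<delta> / B c * Z c w"
          using \<delta> by (simp add: s_def mult.commute)
      qed
      also have "\<dots> = 1 + \<delta> / B c * expect \<mu> (Z c)" using fin(1) by (simp add: expect_add_finite)
      also have "\<dots> \<le> 1 + \<delta> / B c * 1" using mean[OF c] \<delta> Bc by (intro add_left_mono mult_left_mono) auto
      also have "\<dots> \<le> exp (\<delta> / B c)" by simp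
      finally show "expect \<mu> (\<lambda>w. exp (s c * Z c w)) \<le> exp (\<delta> / B c)" .
    qed (auto intro: expect_ge_const[OF fin(1)])
    also have "exp (- (s c * ((1 + \<delta>) * real (card (J c))))) * exp (\<delta> / B c) ^ card (J c)
      = exp (- chernoff \<delta> * real (card (J c)) / B c)"
      using Bc by (simp add: exp_of_nat_mult[symmetric] mult_exp_exp s_def chernoff_def field_simps)
    finally show "expect P (X c) \<le> exp (- chernoff \<delta> * real (card (J c)) / B c)" by simp
  qed
  finally show False using small by linarith
qed

section \<open>Letter counts and typical words\<close>

definition occ :: "nat \<Rightarrow> (nat \<Rightarrow> 'z) \<Rightarrow> 'z \<Rightarrow> real" where
  "occ n u z = (\<Sum>i<n. of_bool (u i = z))"

text \<open>Only upper bounds on the letter counts are required: they force the letters into the support,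
  and the lower bounds follow because the counts sum to \<open>n\<close>.\<close>

definition typical :: "real \<Rightarrow> nat \<Rightarrow> 'z pmf \<Rightarrow> (nat \<Rightarrow> 'z) \<Rightarrow> bool" where
  "typical \<epsilon> n D u \<longleftrightarrow> (\<forall>z. occ n u z \<le> (1 + \<epsilon>) * real n * pmf D z)"

lemma sum_eq_sum_count:
  assumes "finite S" "\<And>i. i < n \<Longrightarrow> u i \<in> S"
  shows "(\<Sum>i<n. f (u i)) = (\<Sum>z\<in>S. occ n u z * f z)"
proof -
  have "(\<Sum>z\<in>S. occ n u z * f z) = (\<Sum>i<n. \<Sum>z\<in>S. of_bool (u i = z) * f z)"
    unfolding occ_def sum_distrib_right by (rule sum.swap)
  also have "\<dots> = (\<Sum>i<n. f (u i))"
    using assms by (intro sum.cong) (auto simp: if_distrib[of "\<lambda>x. x * _"] of_bool_def cong: if_cong)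
  finally show ?thesis by simp
qed

lemma typical_support:
  assumes "typical \<epsilon> n D u" "i < n"
  shows "u i \<in> set_pmf D"
proof (rule ccontr)
  assume "u i \<notin> set_pmf D"
  then have "occ n u (u i) \<le> 0" using assms(1) by (auto simp: typical_def set_pmf_iff dest: spec[of _ "u i"])
  moreover have "1 \<le> occ n u (u i)"
    unfolding occ_def using member_le_sum[of i "{..<n}" "\<lambda>j. of_bool (u j = u i) :: real"] assms(2) by simp
  ultimately show False by simp
qed

text \<open>Used with log-likelihoods as \<open>f\<close>: it turns typicality into exponential
  bounds on word probabilities, with an error proportional to \<epsilon> and the l1 norm of
  \<open>f\<close> on the support.\<close>

lemma typical_average:
  assumes typical: "typical \<epsilon> n D u" and fin: "finite (set_pmf D)" and \<epsilon>: "0 \<le> \<epsilon>"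
  shows "(\<Sum>i<n. f (u i)) \<le> real n * (expect D f + \<epsilon> * (\<Sum>z\<in>set_pmf D. \<bar>f z\<bar>))"
proof -
  have up: "occ n u z \<le> (1 + \<epsilon>) * real n * pmf D z" for z
    using typical by (simp add: typical_def)
  have tot: "(\<Sum>z\<in>set_pmf D. occ n u z) = real n"
    using sum_eq_sum_count[OF fin typical_support[OF typical], where f = "\<lambda>_. 1 :: real"] by simp
  have sumD: "(\<Sum>z\<in>set_pmf D. pmf D z) = 1" using fin by (simp add: sum_pmf_eq_1)
  have dev: "\<bar>occ n u z - real n * pmf D z\<bar> \<le> real n * \<epsilon>" if z: "z \<in> set_pmf D" for z
  proof -
    have le: "(1 + \<epsilon>) * real n * pmf D z \<le> real n * pmf D z + real n * \<epsilon>"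
      using \<epsilon> mult_left_mono[OF pmf_le_1[of D z], of "real n * \<epsilon>"] by (simp add: algebra_simps)
    have "real n = occ n u z + (\<Sum>z'\<in>set_pmf D - {z}. occ n u z')"
      using tot sum.remove[OF fin z, of "occ n u"] by simp
    also have "(\<Sum>z'\<in>set_pmf D - {z}. occ n u z') \<le> (\<Sum>z'\<in>set_pmf D - {z}. (1 + \<epsilon>) * real n * pmf D z')"
      by (intro sum_mono up)
    also have "\<dots> = (1 + \<epsilon>) * real n * (1 - pmf D z)"
      using sumD sum.remove[OF fin z, of "pmf D"] by (simp add: sum_distrib_left[symmetric])
    finally have "real n * pmf D z - real n * \<epsilon> * (1 - pmf D z) \<le> occ n u z" by (simp add: algebra_simps)
    moreover have "real n * \<epsilon> * (1 - pmf D z) \<le> real n * \<epsilon>"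
      using \<epsilon> by (intro mult_left_le) (auto simp: pmf_le_1)
    ultimately show ?thesis using le up[of z] by (simp add: abs_le_iff)
  qed
  have "(\<Sum>i<n. f (u i)) = (\<Sum>z\<in>set_pmf D. occ n u z * f z)"
    by (rule sum_eq_sum_count[OF fin typical_support[OF typical]])
  also have "\<dots> = real n * expect D f + (\<Sum>z\<in>set_pmf D. (occ n u z - real n * pmf D z) * f z)"
    using fin by (simp add: expect_finite algebra_simps sum_distrib_left sum_subtractf)
  also have "(\<Sum>z\<in>set_pmf D. (occ n u z - real n * pmf D z) * f z) \<le> (\<Sum>z\<in>set_pmf D. real n * \<epsilon> * \<bar>f z\<bar>)"
  proof (rule sum_mono)
    fix z assume "z \<in> set_pmf D"
    then have "\<bar>occ n u z - real n * pmf D z\<bar> * \<bar>f z\<bar> \<le> real n * \<epsilon> * \<bar>f z\<bar>"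
      by (intro mult_right_mono dev) auto
    then show "(occ n u z - real n * pmf D z) * f z \<le> real n * \<epsilon> * \<bar>f z\<bar>"
      by (simp add: abs_mult[symmetric] abs_le_iff)
  qed
  finally show ?thesis by (simp add: sum_distrib_left algebra_simps)
qed

text \<open>The pair \<open>(ws, xs)\<close> below is i.i.d. with letter law \<open>D\<close>.\<close>

lemma atypical_mean:
  fixes V :: "'w \<Rightarrow> 'x pmf"
  assumes fin: "finite (set_pmf p)" "\<And>w. w \<in> set_pmf p \<Longrightarrow> finite (set_pmf (V w))" and \<epsilon>: "0 < \<epsilon>"
  defines "D \<equiv> joint_law p V"
  shows "expect (replicate_pmf n p) (\<lambda>ws. expect (memoryless V ws)
      (\<lambda>xs. of_bool (\<not> typical \<epsilon> n D (\<lambda>i. (ws ! i, xs ! i)))))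
    \<le> (\<Sum>z\<in>set_pmf D. exp (- chernoff \<epsilon> * pmf D z) ^ n)"
proof -
  let ?Q = "replicate_pmf n p"
  have finQ: "finite (set_pmf ?Q)" using fin(1) by (rule finite_set_replicate_pmf)
  have Qlen: "length ws = n" "set ws \<subseteq> set_pmf p" if "ws \<in> set_pmf ?Q" for ws
    using that by (auto simp: set_replicate_pmf)
  have finV: "finite (set_pmf (memoryless V ws))" if "ws \<in> set_pmf ?Q" for ws
    using Qlen(2)[OF that] fin(2) by (intro finite_set_memoryless) auto
  have finD: "finite (set_pmf D)" unfolding D_def using fin by auto
  \<comment> \<open>Exponential tilting of a single letter by the factor
    \<open>1 + \<epsilon>\<close>; \<open>c z\<close> below is the normalisation from Markov's
    inequality at the threshold \<open>(1 + \<epsilon>) * n * pmf D z\<close>.\<close>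
  define g where "g z z' = (if z' = z then 1 + \<epsilon> else (1::real))" for z z' :: "'w \<times> 'x"
  define c where "c z = exp (- ln (1 + \<epsilon>) * ((1 + \<epsilon>) * real n * pmf D z))" for z
  have prod_g: "(\<Prod>i<n. g z (u i)) = exp (ln (1 + \<epsilon>) * occ n u z)" for z u
  proof -
    have "(\<Prod>i<n. g z (u i)) = (\<Prod>i<n. exp (ln (1 + \<epsilon>) * of_bool (u i = z)))"
      using \<epsilon> by (intro prod.cong) (auto simp: g_def)
    then show ?thesis by (simp only: exp_sum[OF finite_lessThan] occ_def sum_distrib_left)
  qed
  have point: "of_bool (\<not> typical \<epsilon> n D u) \<le> (\<Sum>z\<in>set_pmf D. c z * (\<Prod>i<n. g z (u i)))"
    if u: "\<And>i. i < n \<Longrightarrow> u i \<in> set_pmf D" for u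
  proof (cases "typical \<epsilon> n D u")
    case True
    have "0 \<le> (\<Sum>z\<in>set_pmf D. c z * (\<Prod>i<n. g z (u i)))"
      using \<epsilon> by (intro sum_nonneg mult_nonneg_nonneg prod_nonneg ballI) (auto simp: c_def g_def)
    then show ?thesis using True by simp
  next
    case False
    then obtain z where z: "(1 + \<epsilon>) * real n * pmf D z < occ n u z" by (auto simp: typical_def not_le)
    \<comment> \<open>The violated letter must lie in the support, since any other letter has count
      0; hence the union bound runs over the support only.\<close>
    have "z \<in> set_pmf D"
    proof (rule ccontr)
      assume "z \<notin> set_pmf D"
      then have "occ n u z = 0" unfolding occ_def using u by (intro sum.neutral) auto
      with z show False using \<epsilon> by (smt (verit) mult_nonneg_nonneg of_nat_0_le_iff pmf_nonneg)
    qed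
    have "1 \<le> exp (ln (1 + \<epsilon>) * (occ n u z - (1 + \<epsilon>) * real n * pmf D z))"
      using z \<epsilon> by simp
    also have "\<dots> = c z * (\<Prod>i<n. g z (u i))"
      unfolding prod_g c_def mult_exp_exp by (simp add: algebra_simps)
    also have "\<dots> \<le> (\<Sum>z\<in>set_pmf D. c z * (\<Prod>i<n. g z (u i)))"
      using finD \<open>z \<in> set_pmf D\<close> \<epsilon>
      by (intro member_le_sum mult_nonneg_nonneg prod_nonneg ballI) (auto simp: c_def g_def)
    finally show ?thesis using False by simp
  qed
  have "expect ?Q (\<lambda>ws. expect (memoryless V ws) (\<lambda>xs. of_bool (\<not> typical \<epsilon> n D (\<lambda>i. (ws ! i, xs ! i)))))
    \<le> expect ?Q (\<lambda>ws. expect (memoryless V ws) (\<lambda>xs. \<Sum>z\<in>set_pmf D. c z * (\<Prod>i<n. g z (ws ! i, xs ! i))))"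
  proof (intro expect_mono_finite finQ finV)
    fix ws xs assume ws: "ws \<in> set_pmf ?Q" and xs: "xs \<in> set_pmf (memoryless V ws)"
    have "(ws ! i, xs ! i) \<in> set_pmf D" if "i < n" for i
    proof -
      have "0 < (\<Prod>i<n. pmf (V (ws ! i)) (xs ! i))"
        using pmf_positive[OF xs] Qlen(1)[OF ws] by (simp add: pmf_memoryless split: if_splits)
      then have "0 < pmf (V (ws ! i)) (xs ! i)" by (rule pos_factor) (use that in auto)
      moreover have "ws ! i \<in> set_pmf p" using Qlen[OF ws] that by (auto simp: subset_iff)
      ultimately have "ws ! i \<in> set_pmf p" "xs ! i \<in> set_pmf (V (ws ! i))" by (simp_all add: set_pmf_iff)
      then show ?thesis by (auto simp: D_def)
    qed
    then show "of_bool (\<not> typical \<epsilon> n D (\<lambda>i. (ws ! i, xs ! i))) \<le> (\<Sum>z\<in>set_pmf D. c z * (\<Prod>i<n. g z (ws ! i, xs ! i)))"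
      by (rule point)
  qed
  also have "\<dots> = expect ?Q (\<lambda>ws. \<Sum>z\<in>set_pmf D. c z * (\<Prod>i<n. expect (V (ws ! i)) (\<lambda>x. g z (ws ! i, x))))"
  proof (rule expect_cong)
    fix ws assume ws: "ws \<in> set_pmf ?Q"
    show "expect (memoryless V ws) (\<lambda>xs. \<Sum>z\<in>set_pmf D. c z * (\<Prod>i<n. g z (ws ! i, xs ! i)))
      = (\<Sum>z\<in>set_pmf D. c z * (\<Prod>i<n. expect (V (ws ! i)) (\<lambda>x. g z (ws ! i, x))))"
      using finV[OF ws] expect_memoryless_prod[of ws V "\<lambda>i x. g _ (ws ! i, x)"] Qlen[OF ws] fin(2)
      by (simp add: integrable_measure_pmf_finite subset_iff)
  qed
  also have "\<dots> = (\<Sum>z\<in>set_pmf D. c z * expect ?Q (\<lambda>ws. \<Prod>i<n. expect (V (ws ! i)) (\<lambda>x. g z (ws ! i, x))))"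
    using finQ by (simp add: integrable_measure_pmf_finite)
  also have "\<dots> = (\<Sum>z\<in>set_pmf D. c z * expect D (g z) ^ n)"
  proof (rule sum.cong[OF refl])
    fix z
    have "expect ?Q (\<lambda>ws. \<Prod>i<n. expect (V (ws ! i)) (\<lambda>x. g z (ws ! i, x)))
      = (\<Prod>i<n. expect p (\<lambda>w. expect (V w) (\<lambda>x. g z (w, x))))"
      using fin(1) by (rule expect_replicate_prod)
    also have "expect p (\<lambda>w. expect (V w) (\<lambda>x. g z (w, x))) = expect D (g z)"
      unfolding D_def using fin by (subst expect_bind) auto
    finally show "c z * expect ?Q (\<lambda>ws. \<Prod>i<n. expect (V (ws ! i)) (\<lambda>x. g z (ws ! i, x))) = c z * expect D (g z) ^ n"
      by simp
  qed
  also have "\<dots> \<le> (\<Sum>z\<in>set_pmf D. exp (- chernoff \<epsilon> * pmf D z) ^ n)"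
  proof (rule sum_mono)
    fix z assume z: "z \<in> set_pmf D"
    have "expect D (g z) = expect D (\<lambda>z'. 1 + \<epsilon> * of_bool (z' = z))"
      by (intro expect_cong) (auto simp: g_def)
    also have "\<dots> = 1 + \<epsilon> * expect D (\<lambda>z'. of_bool (z' = z))" using finD by (simp add: expect_add_finite)
    also have "expect D (\<lambda>z'. of_bool (z' = z)) = pmf D z"
      using finD z by (simp add: expect_finite of_bool_def if_distrib cong: if_cong)
    also have "1 + \<epsilon> * pmf D z \<le> exp (\<epsilon> * pmf D z)" by simp
    finally have le: "expect D (g z) \<le> exp (\<epsilon> * pmf D z)" .
    have "expect D (g z) ^ n \<le> exp (\<epsilon> * pmf D z) ^ n"
      using \<epsilon> by (intro power_mono le expect_ge_const[OF finD]) (auto simp: g_def)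
    then have "c z * expect D (g z) ^ n \<le> c z * exp (\<epsilon> * pmf D z) ^ n"
      by (intro mult_left_mono) (auto simp: c_def)
    also have "\<dots> = exp (- chernoff \<epsilon> * pmf D z) ^ n"
      unfolding c_def chernoff_def exp_of_nat_mult[symmetric] mult_exp_exp by (simp add: algebra_simps)
    finally show "c z * expect D (g z) ^ n \<le> exp (- chernoff \<epsilon> * pmf D z) ^ n" .
  qed
  finally show ?thesis .
qed

lemma atypical_bound_tendsto_0:
  assumes "0 < \<epsilon>"
  shows "(\<lambda>n. \<Sum>z\<in>set_pmf D. exp (- chernoff \<epsilon> * pmf D z) ^ n) \<longlonglongrightarrow> 0"
proof (rule tendsto_null_sum)
  fix z assume "z \<in> set_pmf D"
  then have "norm (exp (- chernoff \<epsilon> * pmf D z)) < 1"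
    using chernoff_pos[OF assms] by (simp add: pmf_positive)
  then show "(\<lambda>n. exp (- chernoff \<epsilon> * pmf D z) ^ n) \<longlonglongrightarrow> 0" by (rule LIMSEQ_power_zero)
qed

section \<open>Exact codes\<close>

text \<open>Gibbs' inequality with a subprobability \<open>r\<close>, from
  \<open>ln u \<le> u - 1\<close>.\<close>

lemma gibbs:
  assumes S: "finite S" "set_pmf q \<subseteq> S" and r: "\<And>x. x \<in> S \<Longrightarrow> 0 < r x" "(\<Sum>x\<in>S. r x) \<le> 1"
  shows "ent q \<le> expect q (\<lambda>x. - ln (r x))"
proof -
  have fin: "finite (set_pmf q)" using S finite_subset by blast
  have "ent q - expect q (\<lambda>x. - ln (r x)) = expect q (\<lambda>x. - ln (pmf q x) - - ln (r x))"
    unfolding ent_def using fin by (rule expect_diff_finite[symmetric])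
  also have "\<dots> \<le> expect q (\<lambda>x. r x / pmf q x - 1)"
  proof (rule expect_mono_finite[OF fin])
    fix x assume x: "x \<in> set_pmf q"
    have "ln (r x / pmf q x) \<le> r x / pmf q x - 1"
      using x r(1) S(2) by (intro ln_le_minus_one) (auto simp: pmf_positive)
    then show "- ln (pmf q x) - - ln (r x) \<le> r x / pmf q x - 1"
      using x r(1)[of x] S(2) by (simp add: ln_divide_pos pmf_positive subset_iff)
  qed
  also have "\<dots> = (\<Sum>x\<in>set_pmf q. r x) - 1"
  proof -
    have "expect q (\<lambda>x. r x / pmf q x) = (\<Sum>x\<in>set_pmf q. r x)"
      unfolding expect_finite[OF fin] by (intro sum.cong) (auto simp: set_pmf_iff)
    then show ?thesis using fin by (simp add: expect_diff_finite)
  qed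
  also have "\<dots> \<le> 0"
    using sum_mono2[OF S, of r] r by (smt (verit) DiffD1 less_imp_le)
  finally show ?thesis by simp
qed

text \<open>Cross-entropy against half a uniform law on the first \<open>M\<close> values and half a
  uniform law on the last \<open>D\<close>. The \<open>ln 2\<close> is the price of naming the
  block, and \<open>ln D\<close> is paid only in proportion to the mass of the second block, which
  is what makes a rare uncompressed message cheap.\<close>

lemma ent_two_blocks:
  fixes q :: "nat pmf"
  assumes "set_pmf q \<subseteq> {..<M + D}" "1 \<le> M" "1 \<le> D"
  shows "ent q \<le> ln 2 + ln (real M) + (1 - (\<Sum>m<M. pmf q m)) * ln (real D)"
proof -
  define r where "r m = (if m < M then 1 / (2 * real M) else 1 / (2 * real D))" for m
  have fin: "finite (set_pmf q)" using assms(1) finite_subset by blast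
  have split: "{..<M + D} = {..<M} \<union> {M..<M + D}" "{..<M} \<inter> {M..<M + D} = {}" by auto
  have "(\<Sum>m<M + D. r m) = (\<Sum>m<M. r m) + (\<Sum>m=M..<M + D. r m)"
    unfolding split(1) by (rule sum.union_disjoint) auto
  also have "\<dots> = 1" using assms(2,3) by (simp add: r_def)
  finally have "ent q \<le> expect q (\<lambda>m. - ln (r m))"
    using assms by (intro gibbs[of "{..<M + D}"]) (auto simp: r_def)
  also have "\<dots> \<le> expect q (\<lambda>m. (ln 2 + ln (real M) + ln (real D)) - of_bool (m < M) * ln (real D))"
    using assms by (intro expect_mono_finite[OF fin]) (auto simp: r_def ln_div ln_mult)
  also have "\<dots> = (ln 2 + ln (real M) + ln (real D)) - expect q (\<lambda>m. of_bool (m < M)) * ln (real D)"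
    using fin by (simp add: expect_diff_finite)
  also have "expect q (\<lambda>m. of_bool (m < M)) = (\<Sum>m<M. pmf q m)"
  proof -
    have "expect q (\<lambda>m. of_bool (m < M)) = (\<Sum>m<M + D. pmf q m * of_bool (m < M))"
      using assms(1) by (intro expect_superset) auto
    also have "\<dots> = (\<Sum>m<M. pmf q m)"
      by (intro sum.mono_neutral_cong_right) auto
    finally show ?thesis .
  qed
  finally show ?thesis by (simp add: algebra_simps)
qed

text \<open>The multiplicative form covers total mass 0, where any law on \<open>S\<close>
  serves.\<close>

lemma normalise_pmf:
  assumes "finite S" "S \<noteq> {}" "\<And>y. 0 \<le> f y" "\<And>y. y \<notin> S \<Longrightarrow> f y = 0"
  shows "\<exists>P. set_pmf P \<subseteq> S \<and> (\<forall>y. pmf P y * (\<Sum>y\<in>S. f y) = f y)"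
proof (cases "(\<Sum>y\<in>S. f y) = 0")
  case True
  then have z: "f y = 0" for y using assms by (cases "y \<in> S") (auto simp: sum_nonneg_eq_0_iff)
  obtain y0 where "y0 \<in> S" using assms(2) by blast
  then show ?thesis using z by (intro exI[of _ "return_pmf y0"]) auto
next
  case False
  have "0 \<le> (\<Sum>y\<in>S. f y)" using assms by (intro sum_nonneg) auto
  obtain P where "pmf P = (\<lambda>y. f y / (\<Sum>y\<in>S. f y))"
    using assms False \<open>0 \<le> (\<Sum>y\<in>S. f y)\<close>
    by (elim pmf_of_function[of S "\<lambda>y. f y / (\<Sum>y\<in>S. f y)"]) (auto simp: sum_divide_distrib[symmetric])
  moreover have "y \<in> S" if "f y \<noteq> 0" for y using that assms(4) by blast
  ultimately show ?thesis using False by (intro exI[of _ P]) (auto simp: set_pmf_iff)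
qed

lemma cond_law_bind_Pair:
  assumes "a \<in> set_pmf P"
  shows "cond_law (joint_law P K) a = K a"
proof (rule pmf_eqI)
  fix b
  have fst: "map_pmf fst (joint_law P K) = P"
    by (simp add: map_bind_pmf map_pmf_comp bind_return_pmf')
  have "pmf P a \<noteq> 0" using assms by (simp add: set_pmf_iff)
  then show "pmf (cond_law (joint_law P K) a) b = pmf (K a) b"
    using assms by (subst pmf_cond_law) (simp_all add: fst pmf_bind_Pair del: pmf_eq_0_set_pmf)
qed

lemma ln_card_lists: "ln (real (card {xs :: 'x::finite list. length xs = n})) = real n * ln (real CARD('x))"
  using card_lists_length_eq[of "UNIV :: 'x set" n] by (simp add: ln_realpow)

lemma prod_pmf_eq_memoryless:
  assumes "length xs = n" "length ys = n" "xs \<in> set_pmf (replicate_pmf n (map_pmf fst \<pi>))"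
  shows "(\<Prod>i<n. pmf \<pi> (xs ! i, ys ! i)) = pmf (replicate_pmf n (map_pmf fst \<pi>)) xs * pmf (memoryless (cond_law \<pi>) xs) ys"
proof -
  have "pmf \<pi> (xs ! i, ys ! i) = pmf (map_pmf fst \<pi>) (xs ! i) * pmf (cond_law \<pi> (xs ! i)) (ys ! i)" for i
    using pmf_bind_Pair[of "map_pmf fst \<pi>" "cond_law \<pi>" "xs ! i" "ys ! i"] by (simp only: bind_cond_law)
  then show ?thesis using assms by (simp add: pmf_replicate_pmf pmf_memoryless prod.distrib)
qed

text \<open>The code attached to a codebook. Message \<open>m < M\<close> is the index of a codeword, while the message
  \<open>M + idx xs\<close> reveals the source word. The kernels \<open>a\<close> and \<open>b\<close> are not normalised: the mass that
  \<open>b\<close> lacks is charged to the encoder, and revealing the source word corrects the remaining error.\<close>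

lemma exact_code:
  fixes \<pi> :: "('x::finite \<times> 'y::finite) pmf" and cw :: "nat \<Rightarrow> nat \<Rightarrow> 'w" and n :: nat
    and a :: "'w \<Rightarrow> 'x list \<Rightarrow> real" and b :: "'w \<Rightarrow> 'y list \<Rightarrow> real"
  defines "A \<equiv> \<lambda>w. \<Sum>xs | length xs = n. a w xs" and "B \<equiv> \<lambda>w. \<Sum>ys | length ys = n. b w ys"
  assumes n: "1 \<le> n" and N: "1 \<le> N" and M: "1 \<le> M" and \<theta>: "0 \<le> \<theta>"
    and a0: "\<And>w xs. 0 \<le> a w xs"
    and b0: "\<And>w ys. 0 \<le> b w ys" "\<And>w ys. length ys \<noteq> n \<Longrightarrow> b w ys = 0"
    and X: "\<And>k xs. k \<in> {1..N} \<Longrightarrow> length xs = n \<Longrightarrow>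
      \<theta> * (\<Sum>m<M. a (cw m k) xs * B (cw m k)) \<le> real M * pmf (replicate_pmf n (map_pmf fst \<pi>)) xs"
    and XY: "\<And>xs ys. length xs = n \<Longrightarrow> length ys = n \<Longrightarrow>
      \<theta> * (\<Sum>k\<in>{1..N}. \<Sum>m<M. a (cw m k) xs * b (cw m k) ys) \<le> real M * real N * (\<Prod>i<n. pmf \<pi> (xs ! i, ys ! i))"
    and mass: "(1 - \<rho>) * (real M * real N) \<le> \<theta> * (\<Sum>k\<in>{1..N}. \<Sum>m<M. A (cw m k) * B (cw m k))"
    and R: "ln 2 + ln (real M) + \<rho> * (real n * ln (real CARD('x))) \<le> real n * R"
  shows "(ln (real N) / real n, R) \<in> exact_rates \<pi> n"
proof -
  define LX where "LX = {xs :: 'x list. length xs = n}"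
  define LY where "LY = {ys :: 'y list. length ys = n}"
  have finL: "finite LX" "finite LY"
    unfolding LX_def LY_def
    by (rule finite_words)+
  have neL: "LX \<noteq> {}" "LY \<noteq> {}"
    using length_replicate[of n "undefined :: 'x"] length_replicate[of n "undefined :: 'y"]
    unfolding LX_def LY_def by blast+
  define D where "D = card LX"
  have D: "1 \<le> D" using finL neL by (simp add: D_def Suc_le_eq card_gt_0_iff)
  obtain idx where idx: "bij_betw idx LX {0..<D}"
    unfolding D_def using ex_bij_betw_finite_nat[OF finL(1)] by blast
  define PX where "PX = replicate_pmf n (map_pmf fst \<pi>)"
  define U where "U = pmf_of_set {1..N}"
  have Ne: "finite {1..N}" "{1..N} \<noteq> {}" using N by auto
  have setU: "set_pmf U = {1..N}" using Ne by (simp add: U_def)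
  have EU: "expect U f = (\<Sum>k\<in>{1..N}. f k) / real N" for f
    using Ne by (simp add: U_def integral_pmf_of_set)
  have setPX: "set_pmf PX \<subseteq> LX" by (auto simp: PX_def LX_def set_replicate_pmf)
  have B0: "0 \<le> B w" for w unfolding B_def using b0 by (intro sum_nonneg) auto
  \<comment> \<open>The joint mass, under a given key, of source word \<open>xs\<close> and codeword
    message \<open>m\<close>. The factor \<open>B\<close> anticipates the decoder, whose law is
    \<open>b\<close> divided by \<open>B\<close>.\<close>
  define g where "g k xs m = \<theta> / real M * (a (cw m k) xs * B (cw m k))" for k xs m
  have g0: "0 \<le> g k xs m" for k xs m using \<theta> a0 B0 by (simp add: g_def)
  have g_sum: "(\<Sum>m<M. g k xs m) \<le> pmf PX xs" if "k \<in> {1..N}" "xs \<in> LX" for k xs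
  proof -
    have "(\<Sum>m<M. g k xs m) = \<theta> * (\<Sum>m<M. a (cw m k) xs * B (cw m k)) / real M"
      by (simp add: g_def sum_distrib_left sum_divide_distrib)
    then show ?thesis using X[OF that(1), of xs] that(2) M by (simp add: PX_def LX_def pos_divide_le_eq mult.commute)
  qed
  \<comment> \<open>Given \<open>xs\<close>, codeword messages are sent with the conditional masses
    from \<open>g\<close>, and whatever probability remains goes to the single message revealing
    \<open>xs\<close>.\<close>
  define e where "e xs k m = (if m < M then g k xs m / pmf PX xs
      else if m = M + idx xs then 1 - (\<Sum>m<M. g k xs m) / pmf PX xs else 0)" for xs k m
  have e_ex: "\<exists>P. pmf P = e xs k" if xs: "xs \<in> set_pmf PX" and k: "k \<in> {1..N}" for xs k
  proof -
    have p: "0 < pmf PX xs" using xs by (simp add: pmf_positive)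
    have s: "(\<Sum>m<M. g k xs m) / pmf PX xs \<le> 1" using g_sum[OF k] setPX xs p by auto
    have 1: "(\<Sum>m\<in>insert (M + idx xs) {..<M}. e xs k m) = 1"
      by (subst sum.insert) (auto simp: e_def sum_divide_distrib)
    have 0: "0 \<le> e xs k m" for m using g0 s by (simp add: e_def)
    have "e xs k m = 0" if "m \<notin> insert (M + idx xs) {..<M}" for m using that by (simp add: e_def)
    from pmf_of_function[of "insert (M + idx xs) {..<M}" "e xs k", OF _ 0 this 1] show ?thesis by blast
  qed
  \<comment> \<open>For source words of probability 0 or keys outside \<open>{1..N}\<close> this
    choice is arbitrary, but such inputs never occur.\<close>
  define enc where "enc xs k = (SOME P. pmf P = e xs k)" for xs k
  have enc: "pmf (enc xs k) = e xs k" if "xs \<in> set_pmf PX" "k \<in> {1..N}" for xs k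
    unfolding enc_def by (rule someI_ex[OF e_ex[OF that]])
  have enc_set: "set_pmf (enc xs k) \<subseteq> insert (M + idx xs) {..<M}" if "xs \<in> set_pmf PX" "k \<in> {1..N}" for xs k
    using enc[OF that] by (auto simp: set_pmf_iff e_def split: if_splits)
  define Phat where "Phat xs ys = \<theta> / (real M * real N) * (\<Sum>k\<in>{1..N}. \<Sum>m<M. a (cw m k) xs * b (cw m k) ys)" for xs ys
  \<comment> \<open>\<open>Phat\<close> is the joint mass produced by codeword messages, so
    \<open>r\<close> is what the target still lacks; its normalisation \<open>V xs\<close> is the
    decoder's law once \<open>xs\<close> is revealed.\<close>
  define r where "r xs ys = (if xs \<in> set_pmf PX \<and> ys \<in> LY then (\<Prod>i<n. pmf \<pi> (xs ! i, ys ! i)) - Phat xs ys else 0)" for xs ys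
  have r0: "0 \<le> r xs ys" for xs ys
  proof (cases "xs \<in> set_pmf PX \<and> ys \<in> LY")
    case True
    then have "xs \<in> LX" using setPX by auto
    then have "Phat xs ys \<le> (\<Prod>i<n. pmf \<pi> (xs ! i, ys ! i))"
      using XY[of xs ys] True N M by (simp add: Phat_def LX_def LY_def field_simps)
    then show ?thesis by (simp add: r_def)
  next
    case False
    then have "r xs ys = 0" unfolding r_def by (rule if_not_P)
    then show ?thesis by simp
  qed
  have "\<exists>V. set_pmf V \<subseteq> LY \<and> (\<forall>ys. pmf V ys * (\<Sum>ys\<in>LY. r xs ys) = r xs ys)" for xs
    using finL neL r0 by (intro normalise_pmf) (auto simp: r_def)
  then obtain V where V: "\<And>xs. set_pmf (V xs) \<subseteq> LY" "\<And>xs ys. pmf (V xs) ys * (\<Sum>ys\<in>LY. r xs ys) = r xs ys"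
    by metis
  have "\<exists>V. set_pmf V \<subseteq> LY \<and> (\<forall>ys. pmf V ys * (\<Sum>ys\<in>LY. b w ys) = b w ys)" for w
    using finL neL b0 by (intro normalise_pmf) (auto simp: LY_def)
  then obtain Bt where Bt: "\<And>w. set_pmf (Bt w) \<subseteq> LY" "\<And>w ys. pmf (Bt w) ys * B w = b w ys"
    unfolding B_def LY_def[symmetric] by metis
  define dec where "dec m k = (if m < M then Bt (cw m k) else V (inv_into LX idx (m - M)))" for m k
  have dec_len: "length ys = n" if "ys \<in> set_pmf (dec m k)" for m k ys
    using that Bt(1) V(1) by (auto simp: dec_def LY_def split: if_splits)
  define K where "K xs = do {k \<leftarrow> U; m \<leftarrow> enc xs k; dec m k}" for xs
  have K_eq: "K xs = memoryless (cond_law \<pi>) xs" if xs: "xs \<in> set_pmf PX" for xs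
  proof (rule pmf_eqI)
    fix ys
    have p: "0 < pmf PX xs" using xs by (simp add: pmf_positive)
    have xsL: "xs \<in> LX" using xs setPX by blast
    have inv: "inv_into LX idx (idx xs) = xs" using idx xsL by (simp add: bij_betw_inv_into_left)
    define G where "G = (\<Sum>k\<in>{1..N}. \<Sum>m<M. g k xs m) / real N"
    have inner: "pmf PX xs * expect (enc xs k) (\<lambda>m. pmf (dec m k) ys)
      = (\<Sum>m<M. \<theta> / real M * (a (cw m k) xs * b (cw m k) ys)) + (pmf PX xs - (\<Sum>m<M. g k xs m)) * pmf (V xs) ys"
      if k: "k \<in> {1..N}" for k
    proof -
      have "expect (enc xs k) (\<lambda>m. pmf (dec m k) ys)
        = (\<Sum>m\<in>insert (M + idx xs) {..<M}. e xs k m * pmf (dec m k) ys)"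
        using enc_set[OF xs k] by (subst expect_superset) (auto simp: enc[OF xs k])
      also have "\<dots> = (1 - (\<Sum>m<M. g k xs m) / pmf PX xs) * pmf (V xs) ys
          + (\<Sum>m<M. g k xs m / pmf PX xs * pmf (Bt (cw m k)) ys)"
        by (subst sum.insert) (auto simp: e_def dec_def inv)
      also have "(\<Sum>m<M. g k xs m / pmf PX xs * pmf (Bt (cw m k)) ys) = (\<Sum>m<M. g k xs m * pmf (Bt (cw m k)) ys) / pmf PX xs"
        by (simp add: sum_divide_distrib)
      finally have "pmf PX xs * expect (enc xs k) (\<lambda>m. pmf (dec m k) ys)
        = (pmf PX xs - (\<Sum>m<M. g k xs m)) * pmf (V xs) ys + (\<Sum>m<M. g k xs m * pmf (Bt (cw m k)) ys)"
        using p by (simp add: field_simps del: pmf_eq_0_set_pmf)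
      \<comment> \<open>The encoder's factor \<open>B\<close> cancels the decoder's
        normalisation.\<close>
      moreover have "g k xs m * pmf (Bt (cw m k)) ys = \<theta> / real M * (a (cw m k) xs * b (cw m k) ys)" for m
        unfolding g_def Bt(2)[symmetric] by (simp add: algebra_simps)
      ultimately show ?thesis by simp
    qed
    \<comment> \<open>The crux of exactness: the mass that the target lacks at \<open>xs\<close>
      equals the joint probability that \<open>xs\<close> occurs and is revealed, so sampling from
      \<open>V xs\<close> supplies precisely \<open>r xs\<close>.\<close>
    have tot: "(\<Sum>ys\<in>LY. r xs ys) = pmf PX xs - G"
    proof -
      have "(\<Sum>ys\<in>LY. r xs ys) = (\<Sum>ys\<in>LY. pmf PX xs * pmf (memoryless (cond_law \<pi>) xs) ys) - (\<Sum>ys\<in>LY. Phat xs ys)"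
        using xs xsL unfolding sum_subtractf[symmetric]
        by (intro sum.cong) (auto simp: r_def prod_pmf_eq_memoryless PX_def LX_def LY_def)
      also have "(\<Sum>ys\<in>LY. pmf PX xs * pmf (memoryless (cond_law \<pi>) xs) ys) = pmf PX xs"
        using xsL finL by (subst sum_distrib_left[symmetric], subst sum_pmf_eq_1) (auto simp: LX_def LY_def dest: set_memoryless)
      also have "(\<Sum>ys\<in>LY. Phat xs ys) = \<theta> / (real M * real N) * (\<Sum>k\<in>{1..N}. \<Sum>m<M. a (cw m k) xs * B (cw m k))"
      proof -
        have "(\<Sum>ys\<in>LY. \<Sum>k\<in>{1..N}. \<Sum>m<M. a (cw m k) xs * b (cw m k) ys)
          = (\<Sum>k\<in>{1..N}. \<Sum>m<M. \<Sum>ys\<in>LY. a (cw m k) xs * b (cw m k) ys)"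
          by (subst sum.swap) (intro sum.cong refl sum.swap)
        then show ?thesis unfolding Phat_def B_def LY_def[symmetric] sum_distrib_left[symmetric] by simp
      qed
      also have "\<dots> = G" unfolding G_def g_def sum_distrib_left[symmetric] by simp
      finally show ?thesis .
    qed
    have "pmf PX xs * pmf (K xs) ys = (\<Sum>k\<in>{1..N}. pmf PX xs * expect (enc xs k) (\<lambda>m. pmf (dec m k) ys)) / real N"
      by (simp add: K_def pmf_bind EU sum_distrib_left)
    also have "\<dots> = (\<Sum>k\<in>{1..N}. (\<Sum>m<M. \<theta> / real M * (a (cw m k) xs * b (cw m k) ys))
        + (pmf PX xs - (\<Sum>m<M. g k xs m)) * pmf (V xs) ys) / real N"
      by (simp only: inner cong: sum.cong)
    also have "\<dots> = Phat xs ys + (pmf PX xs - G) * pmf (V xs) ys"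
      unfolding Phat_def G_def sum.distrib sum_distrib_right[symmetric] sum_distrib_left[symmetric] sum_subtractf
      using N by (simp add: field_simps)
    also have "\<dots> = Phat xs ys + r xs ys" using V(2)[of xs ys] by (simp add: tot mult.commute)
    also have "\<dots> = pmf PX xs * pmf (memoryless (cond_law \<pi>) xs) ys"
    proof (cases "ys \<in> LY")
      case True
      then show ?thesis using xs xsL by (simp add: r_def prod_pmf_eq_memoryless PX_def LX_def LY_def)
    next
      case False
      then show ?thesis using xsL b0(2) by (simp add: r_def Phat_def pmf_memoryless LX_def LY_def)
    qed
    finally show "pmf (K xs) ys = pmf (memoryless (cond_law \<pi>) xs) ys" using p by simp
  qed
  define J where "J = synthesis_law n N (map_pmf fst \<pi>) enc dec"
  have JXY: "map_pmf (\<lambda>(xs, k, m, ys). (xs, ys)) J = joint_law PX K"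
    unfolding J_def synthesis_law_def K_def PX_def U_def
    by (simp add: map_pmf_def bind_assoc_pmf bind_return_pmf)
  define q where "q k = bind_pmf PX (\<lambda>xs. enc xs k)" for k
  have JKM: "map_pmf (\<lambda>(xs, k, m, ys). (k, m)) J = joint_law U q"
  proof -
    have "map_pmf (\<lambda>(xs, k, m, ys). (k, m)) J = do {xs \<leftarrow> PX; k \<leftarrow> U; m \<leftarrow> enc xs k; return_pmf (k, m)}"
      unfolding J_def synthesis_law_def PX_def U_def by (simp add: map_pmf_def bind_assoc_pmf bind_return_pmf)
    also have "\<dots> = do {k \<leftarrow> U; xs \<leftarrow> PX; m \<leftarrow> enc xs k; return_pmf (k, m)}"
      by (rule bind_commute_pmf)
    finally show ?thesis by (simp add: q_def map_pmf_def bind_assoc_pmf bind_return_pmf)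
  qed
  have q_set: "set_pmf (q k) \<subseteq> {..<M + D}" if k: "k \<in> {1..N}" for k
  proof
    fix m assume "m \<in> set_pmf (q k)"
    then obtain xs where xs: "xs \<in> set_pmf PX" "m \<in> set_pmf (enc xs k)" by (auto simp: q_def)
    then have "idx xs \<in> {0..<D}" using bij_betwE[OF idx] setPX by blast
    then have "idx xs < D" by simp
    then show "m \<in> {..<M + D}" using enc_set[OF xs(1) k] xs(2) by auto
  qed
  have q_pmf: "pmf (q k) m = \<theta> / real M * (A (cw m k) * B (cw m k))" if k: "k \<in> {1..N}" and m: "m < M" for k m
  proof -
    have "pmf (q k) m = (\<Sum>xs\<in>set_pmf PX. pmf PX xs * pmf (enc xs k) m)"
      unfolding q_def pmf_bind using setPX finL by (intro expect_finite) (rule finite_subset)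
    also have "\<dots> = (\<Sum>xs\<in>set_pmf PX. g k xs m)"
      using m by (intro sum.cong) (auto simp: enc[OF _ k] e_def set_pmf_iff)
    also have "\<dots> = (\<Sum>xs\<in>LX. g k xs m)"
    \<comment> \<open>Words of source probability 0 carry no codeword mass, because
      \<open>g_sum\<close> bounds that mass by the source probability.\<close>
    proof (rule sum.mono_neutral_left[OF finL(1) setPX], intro ballI)
      fix xs assume "xs \<in> LX - set_pmf PX"
      then have "(\<Sum>m<M. g k xs m) \<le> 0" using g_sum[OF k, of xs] by (auto simp: set_pmf_iff)
      moreover have "g k xs m \<le> (\<Sum>m<M. g k xs m)" using g0 m by (intro member_le_sum) auto
      ultimately show "g k xs m = 0" using g0[of k xs m] by linarith
    qed
    also have "\<dots> = \<theta> / real M * (A (cw m k) * B (cw m k))"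
      unfolding g_def A_def LX_def[symmetric] by (simp add: sum_distrib_left sum_distrib_right)
    finally show ?thesis .
  qed
  have ce: "cond_entropy (joint_law U q) = ennreal (expect U (\<lambda>k. ent (q k)))"
  proof -
    have fst: "map_pmf fst (joint_law U q) = U"
      by (simp add: map_bind_pmf map_pmf_comp bind_return_pmf')
    have "cond_entropy (joint_law U q) = (\<integral>\<^sup>+ k. ennreal (ent (q k)) \<partial>measure_pmf U)"
      unfolding cond_entropy_def fst
    proof (intro nn_integral_cong_AE, unfold AE_measure_pmf_iff, intro ballI)
      fix k assume k: "k \<in> set_pmf U"
      then have "finite (set_pmf (q k))" using q_set setU finite_subset by blast
      then show "shannon_entropy (cond_law (joint_law U q) k) = ennreal (ent (q k))"
        using k by (simp add: cond_law_bind_Pair shannon_entropy_eq_ent)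
    qed
    also have "\<dots> = ennreal (expect U (\<lambda>k. ent (q k)))"
      by (intro nn_integral_eq_expect) (auto simp: setU ent_nonneg)
    finally show ?thesis .
  qed
  have "expect U (\<lambda>k. ent (q k)) \<le> real n * R"
  proof -
    have lnD: "ln (real D) = real n * ln (real CARD('x))" unfolding D_def LX_def by (rule ln_card_lists)
    have "expect U (\<lambda>k. ent (q k)) \<le> expect U (\<lambda>k. ln 2 + ln (real M) + (1 - (\<Sum>m<M. pmf (q k) m)) * ln (real D))"
      using q_set M D setU by (intro expect_mono_finite ent_two_blocks) auto
    also have "\<dots> = expect U (\<lambda>k. ln 2 + ln (real M) + (1 - (\<Sum>m<M. \<theta> / real M * (A (cw m k) * B (cw m k)))) * ln (real D))"
      using q_pmf setU by (intro expect_cong) auto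
    also have "\<dots> = ln 2 + ln (real M) + (1 - \<theta> / (real M * real N) * (\<Sum>k\<in>{1..N}. \<Sum>m<M. A (cw m k) * B (cw m k))) * ln (real D)"
      unfolding EU sum.distrib sum_distrib_right[symmetric] sum_subtractf sum_distrib_left[symmetric]
      using N M by (simp add: field_simps)
    also have "\<dots> \<le> ln 2 + ln (real M) + \<rho> * ln (real D)"
    proof -
      have "1 - \<rho> \<le> \<theta> / (real M * real N) * (\<Sum>k\<in>{1..N}. \<Sum>m<M. A (cw m k) * B (cw m k))"
        using mass M N by (simp add: field_simps)
      then show ?thesis using D by (intro add_left_mono mult_right_mono) auto
    qed
    also have "\<dots> \<le> real n * R" using R lnD by simp
    finally show ?thesis .
  qed
  moreover have "0 \<le> expect U (\<lambda>k. ent (q k))" by (intro expect_ge_const) (auto simp: setU ent_nonneg)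
  ultimately have "ereal (1 / real n) * enn2ereal (cond_entropy (map_pmf (\<lambda>(xs, k, m, ys). (k, m)) J)) \<le> ereal R"
    unfolding JKM ce using n by (simp add: enn2ereal_ennreal field_simps)
  moreover have "cond_law (map_pmf (\<lambda>(xs, k, m, ys). (xs, ys)) J) xs = memoryless (cond_law \<pi>) xs" if "xs \<in> set_pmf PX" for xs
    unfolding JXY using that by (simp add: cond_law_bind_Pair K_eq)
  moreover have "real N = exp (real n * (ln (real N) / real n))" using n N by simp
  ultimately show ?thesis
    unfolding exact_rates_def Let_def using dec_len n N
    by (auto simp: J_def PX_def intro!: exI[of _ N] exI[of _ enc] exI[of _ dec])
qed

section \<open>Achievability\<close>

lemma occ_fst:
  fixes y :: "nat \<Rightarrow> 'y::finite"
  shows "(\<Sum>y'\<in>UNIV. occ n (\<lambda>i. (w i, x i, y i)) (w', x', y')) = occ n (\<lambda>i. (w i, x i)) (w', x')"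
proof -
  have "(\<Sum>y'\<in>UNIV. of_bool ((w i, x i, y i) = (w', x', y'))) = (of_bool ((w i, x i) = (w', x')) :: real)" for i
    by (cases "w i = w' \<and> x i = x'") (auto simp: of_bool_def)
  then show ?thesis unfolding occ_def by (subst sum.swap) simp
qed

lemma occ_snd:
  fixes x :: "nat \<Rightarrow> 'x::finite"
  shows "(\<Sum>x'\<in>UNIV. occ n (\<lambda>i. (w i, x i, y i)) (w', x', y')) = occ n (\<lambda>i. (w i, y i)) (w', y')"
proof -
  have "(\<Sum>x'\<in>UNIV. of_bool ((w i, x i, y i) = (w', x', y'))) = (of_bool ((w i, y i) = (w', y')) :: real)" for i
    by (cases "w i = w' \<and> y i = y'") (auto simp: of_bool_def)
  then show ?thesis unfolding occ_def by (subst sum.swap) simp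
qed

text \<open>For fixed \<open>w'\<close>, the joint counts divided by
  \<open>(1 + \<epsilon>) * n * pmf PW w'\<close> form a subcoupling of \<open>PX w'\<close> and
  \<open>PY w'\<close>: the upper bounds on counts in \<open>typical\<close> are exactly the
  marginal bounds needed. So no joint type of two typical words costs much more than the best
  coupling.\<close>

lemma typical_cost_le:
  fixes PX :: "'w \<Rightarrow> 'x::finite pmf" and PY :: "'w \<Rightarrow> 'y::finite pmf"
  assumes fin: "finite (set_pmf PW)" and \<epsilon>: "0 < \<epsilon>" and n: "1 \<le> n" and c: "\<And>z. 0 \<le> c z"
    and X: "typical \<epsilon> n (joint_law PW PX) (\<lambda>i. (w i, x i))"
    and Y: "typical \<epsilon> n (joint_law PW PY) (\<lambda>i. (w i, y i))"
  shows "(\<Sum>i<n. c (x i, y i)) \<le> (1 + \<epsilon>) * real n * expect PW (\<lambda>w. transport_sup c (PX w) (PY w))"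
proof -
  let ?M = "\<lambda>w' z. occ n (\<lambda>i. (w i, x i, y i)) (w', z)"
  have wS: "(w i, x i, y i) \<in> set_pmf PW \<times> UNIV" if "i < n" for i
    using typical_support[OF X that] by auto
  have "(\<Sum>i<n. c (x i, y i)) = (\<Sum>v\<in>set_pmf PW \<times> UNIV. occ n (\<lambda>i. (w i, x i, y i)) v * c (snd v))"
    using sum_eq_sum_count[OF _ wS, where f = "\<lambda>v. c (snd v)"] fin by simp
  also have "\<dots> = (\<Sum>w'\<in>set_pmf PW. \<Sum>z\<in>UNIV. ?M w' z * c z)"
    by (simp add: sum.cartesian_product case_prod_unfold)
  also have "\<dots> \<le> (\<Sum>w'\<in>set_pmf PW. (1 + \<epsilon>) * real n * pmf PW w' * transport_sup c (PX w') (PY w'))"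
  proof (rule sum_mono)
    fix w' assume "w' \<in> set_pmf PW"
    define s where "s = (1 + \<epsilon>) * real n * pmf PW w'"
    have s: "0 < s" using \<open>w' \<in> set_pmf PW\<close> \<epsilon> n by (simp add: s_def pmf_positive)
    have "(\<Sum>z\<in>UNIV. (?M w' z / s) * c z) \<le> transport_sup c (PX w') (PY w')"
    proof (rule subcoupling_le_transport_sup)
      fix x' y'
      show "0 \<le> ?M w' z / s" for z using s by (simp add: occ_def sum_nonneg)
      show "(\<Sum>y'\<in>UNIV. ?M w' (x', y') / s) \<le> pmf (PX w') x'"
        using X s unfolding typical_def sum_divide_distrib[symmetric] occ_fst
        by (auto simp: pos_divide_le_eq pmf_bind_Pair s_def mult_ac dest!: spec[of _ "(w', x')"])
      show "(\<Sum>x'\<in>UNIV. ?M w' (x', y') / s) \<le> pmf (PY w') y'"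
        using Y s unfolding typical_def sum_divide_distrib[symmetric] occ_snd
        by (auto simp: pos_divide_le_eq pmf_bind_Pair s_def mult_ac dest!: spec[of _ "(w', y')"])
    qed (rule c)
    then have "(\<Sum>z\<in>UNIV. ?M w' z * c z) / s \<le> transport_sup c (PX w') (PY w')"
      by (simp add: sum_divide_distrib)
    then show "(\<Sum>z\<in>UNIV. ?M w' z * c z) \<le> (1 + \<epsilon>) * real n * pmf PW w' * transport_sup c (PX w') (PY w')"
      using s unfolding s_def[symmetric] by (simp add: pos_divide_le_eq mult.commute)
  qed
  also have "\<dots> = (1 + \<epsilon>) * real n * expect PW (\<lambda>w. transport_sup c (PX w) (PY w))"
    using fin by (simp add: expect_finite sum_distrib_left mult.assoc)
  finally show ?thesis .
qed

lemma sum_restrict_memoryless: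
  fixes V :: "'w \<Rightarrow> 'x::finite pmf"
  assumes "length ws = n"
  shows "(\<Sum>xs | length xs = n. if p xs then pmf (memoryless V ws) xs else 0)
    = 1 - expect (memoryless V ws) (\<lambda>xs. of_bool (\<not> p xs))"
proof -
  have fL: "finite {xs :: 'x list. length xs = n}" by (rule finite_words)
  have sub: "set_pmf (memoryless V ws) \<subseteq> {xs. length xs = n}" using assms by (auto dest: set_memoryless)
  have "(\<Sum>xs | length xs = n. if p xs then pmf (memoryless V ws) xs else 0)
    = (\<Sum>xs | length xs = n. pmf (memoryless V ws) xs * (1 - of_bool (\<not> p xs)))"
    by (intro sum.cong) auto
  also have "\<dots> = expect (memoryless V ws) (\<lambda>xs. 1 - of_bool (\<not> p xs))"
    using fL sub by (rule expect_superset[symmetric])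
  also have "\<dots> = 1 - expect (memoryless V ws) (\<lambda>xs. of_bool (\<not> p xs))"
    using finite_subset[OF sub fL] by (simp only: expect_diff_finite) simp
  finally show ?thesis .
qed

text \<open>A doubly exponentially small failure probability beats exponentially many constraints;
  \<open>1 / 3\<close> because three families of constraints share total probability 1.\<close>

lemma eventually_exp_exp_small:
  fixes \<alpha> \<kappa> \<gamma> :: real
  assumes "0 < \<kappa>" "0 < \<gamma>"
  shows "eventually (\<lambda>n. exp (real n * \<alpha> - \<kappa> * exp (real n * \<gamma>)) < 1 / 3) sequentially"
proof -
  \<comment> \<open>From \<open>exp u \<ge> u^2 / 2\<close>: for \<open>n \<ge> c\<close> the
    subtracted term exceeds \<open>(\<bar>\<alpha>\<bar> + 1) * n\<close>, leaving an exponent of at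
    most \<open>- n \<le> - 2\<close>.\<close>
  define c where "c = 2 * (\<bar>\<alpha>\<bar> + 1) / (\<kappa> * \<gamma>\<^sup>2)"
  have "eventually (\<lambda>n. max c 2 \<le> real n) sequentially"
    using filterlim_real_sequentially unfolding filterlim_at_top by blast
  then show ?thesis
  proof eventually_elim
    case (elim n)
    then have n: "c \<le> real n" "2 \<le> real n" by auto
    have "\<bar>\<alpha>\<bar> + 1 \<le> \<kappa> * \<gamma>\<^sup>2 / 2 * real n"
      using n(1) assms unfolding c_def by (simp add: pos_divide_le_eq mult_ac)
    then have "(\<bar>\<alpha>\<bar> + 1) * real n \<le> \<kappa> * \<gamma>\<^sup>2 / 2 * real n * real n"
      using n by (intro mult_right_mono) auto
    also have "\<dots> = \<kappa> * ((real n * \<gamma>)\<^sup>2 / 2)" by (simp add: power2_eq_square)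
    also have "\<dots> \<le> \<kappa> * exp (real n * \<gamma>)"
    proof (rule mult_left_mono)
      have "0 \<le> real n * \<gamma>" using assms by simp
      then show "(real n * \<gamma>)\<^sup>2 / 2 \<le> exp (real n * \<gamma>)"
        using exp_lower_Taylor_quadratic[of "real n * \<gamma>"] by linarith
    qed (use assms in simp)
    finally have "real n * \<bar>\<alpha>\<bar> + real n \<le> \<kappa> * exp (real n * \<gamma>)" by (simp add: algebra_simps)
    moreover have "real n * \<alpha> \<le> real n * \<bar>\<alpha>\<bar>" by (intro mult_left_mono) auto
    ultimately have "real n * \<alpha> - \<kappa> * exp (real n * \<gamma>) \<le> - 2" using n by linarith
    then have "exp (real n * \<alpha> - \<kappa> * exp (real n * \<gamma>)) \<le> exp (- 2)" by simp
    also have "\<dots> < 1 / 3"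
      using exp_lower_Taylor_quadratic[of 2] by (simp add: exp_minus field_simps)
    finally show ?case .
  qed
qed

text \<open>Sizes of codebooks and key sets are integers; rounding up costs at most
  \<open>ln 2\<close>, which vanishes after division by \<open>n\<close>.\<close>

lemma nat_ceiling_exp:
  fixes t :: real
  assumes "0 \<le> t"
  defines "N \<equiv> nat \<lceil>exp t\<rceil>"
  shows "exp t \<le> real N" "real N \<le> 2 * exp t" "1 \<le> N" "t \<le> ln (real N)" "ln (real N) \<le> ln 2 + t"
proof -
  have e: "1 \<le> exp t" using assms by simp
  show 1: "exp t \<le> real N" unfolding N_def by linarith
  show 2: "real N \<le> 2 * exp t" unfolding N_def using e by linarith
  show 3: "1 \<le> N" using e 1 by linarith
  show "t \<le> ln (real N)" using 1 3 by (simp add: ln_ge_iff)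
  have "ln (real N) \<le> ln (2 * exp t)" using 2 3 by (intro ln_mono) auto
  then show "ln (real N) \<le> ln 2 + t" by (simp add: ln_mult)
qed

text \<open>\<open>r0\<close> replaces \<open>R0\<close> because \<open>exp (n * R0)\<close> need
  not be an integer. The slack \<open>e\<close> is spent on typicality, on the excess size of the
  codebook, on occasionally revealing the source word, and on rounding.\<close>

lemma achievability:
  fixes \<pi> :: "('x::finite \<times> 'y::finite) pmf" and PW :: "'w pmf"
  assumes fin: "finite (set_pmf PW)"
    and joint: "bind_pmf PW (\<lambda>w. pair_pmf (PX w) (PY w)) = \<pi>"
    and I: "ent (map_pmf fst \<pi>) - expect PW (\<lambda>w. ent (PX w)) \<le> R"
    and F: "expect PW (\<lambda>w. transport_sup (cost \<pi>) (PX w) (PY w) - ent (PX w) - ent (PY w)) \<le> R + R0"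
    and R: "0 \<le> R" "0 \<le> R0" and e: "0 < e"
  shows "\<exists>n\<ge>1. \<exists>r0. (r0, R + e) \<in> exact_rates \<pi> n \<and> \<bar>r0 - R0\<bar> \<le> e"
proof -
  define \<pi>X where "\<pi>X = map_pmf fst \<pi>"
  have \<pi>X: "\<pi>X = bind_pmf PW PX"
    unfolding \<pi>X_def joint[symmetric] by (simp add: map_bind_pmf map_fst_pair_pmf)
  define D1 where "D1 = joint_law PW PX"
  define D2 where "D2 = joint_law PW PY"
  have finD: "finite (set_pmf D1)" "finite (set_pmf D2)" using fin by (auto simp: D1_def D2_def)
  \<comment> \<open>The information density, whose mean under \<open>D1\<close> is I(W;X). Likewise
    \<open>tw\<close> plus the means of \<open>f2\<close> and \<open>f3\<close> is the mean of
    \<Phi>.\<close>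
  define f1 where "f1 v = ln (pmf (PX (fst v)) (snd v)) - ln (pmf \<pi>X (snd v))" for v
  define f2 where "f2 v = ln (pmf (PX (fst v)) (snd v))" for v
  define f3 where "f3 v = ln (pmf (PY (fst v)) (snd v))" for v
  define tw where "tw = expect PW (\<lambda>w. transport_sup (cost \<pi>) (PX w) (PY w))"
  have tw0: "0 \<le> tw" unfolding tw_def using fin by (intro expect_ge_const transport_sup_cost_nonneg)
  define S1 where "S1 = (\<Sum>v\<in>set_pmf D1. \<bar>f1 v\<bar>)"
  define S2 where "S2 = (\<Sum>v\<in>set_pmf D1. \<bar>f2 v\<bar>)"
  define S3 where "S3 = (\<Sum>v\<in>set_pmf D2. \<bar>f3 v\<bar>)"
  have S0: "0 \<le> S1" "0 \<le> S2" "0 \<le> S3" by (auto simp: S1_def S2_def S3_def sum_nonneg)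
  \<comment> \<open>The codebook rate exceeds \<open>R\<close> by
    \<open>2 * \<gamma> = e / 4\<close>; another \<open>e / 4\<close> goes to revealed words and
    \<open>e / 4\<close> to the two terms \<open>ln 2\<close>.\<close>
  define \<gamma> where "\<gamma> = e / 8"
  have \<gamma>: "0 < \<gamma>" using e by (simp add: \<gamma>_def)
  \<comment> \<open>One choice that makes every typicality error, in \<open>\<epsilon>1\<close> and
    \<open>\<epsilon>2\<close>, at most \<gamma>.\<close>
  define \<epsilon> where "\<epsilon> = \<gamma> / (1 + S1 + S2 + S3 + tw)"
  have \<epsilon>: "0 < \<epsilon>" using \<gamma> S0 tw0 by (simp add: \<epsilon>_def)
  have \<epsilon>S: "\<epsilon> * (1 + S1 + S2 + S3 + tw) = \<gamma>" using S0 tw0 by (simp add: \<epsilon>_def)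
  have \<epsilon>1: "\<epsilon> * S1 \<le> \<gamma>" and \<epsilon>2: "\<epsilon> * (S2 + S3 + tw) \<le> \<gamma>"
    unfolding \<epsilon>S[symmetric] using S0 tw0 \<epsilon> by (auto intro!: mult_left_mono)
  have E2: "expect D1 f2 = - expect PW (\<lambda>w. ent (PX w))"
    unfolding D1_def f2_def using fin by (subst expect_bind) (auto simp: ent_def)
  have E3: "expect D2 f3 = - expect PW (\<lambda>w. ent (PY w))"
    unfolding D2_def f3_def using fin by (subst expect_bind) (auto simp: ent_def)
  have E1: "expect D1 f1 \<le> R"
  proof -
    have "expect D1 f1 = expect D1 f2 - expect D1 (\<lambda>v. ln (pmf \<pi>X (snd v)))"
      unfolding f1_def f2_def using finD by (simp add: expect_diff_finite)
    also have "expect D1 (\<lambda>v. ln (pmf \<pi>X (snd v))) = expect \<pi>X (\<lambda>x. ln (pmf \<pi>X x))"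
      by (rule expect_map_eq) (simp add: D1_def \<pi>X map_bind_pmf map_pmf_comp)
    also have "\<dots> = - ent \<pi>X" by (simp add: ent_def)
    finally show ?thesis using I by (simp add: E2 \<pi>X_def)
  qed
  have EF: "tw + expect D1 f2 + expect D2 f3 \<le> R + R0"
    using F fin unfolding E2 E3 tw_def by (simp add: expect_diff_finite)
  let ?TX = "\<lambda>n ws xs. typical \<epsilon> n D1 (\<lambda>i. (ws ! i, xs ! i))"
  let ?TY = "\<lambda>n ws ys. typical \<epsilon> n D2 (\<lambda>i. (ws ! i, ys ! i))"
  define a where "a n ws xs = (if length ws = n \<and> length xs = n \<and> ?TX n ws xs
      then pmf (memoryless PX ws) xs else 0)" for n ws xs
  define b where "b n ws ys = (if length ws = n \<and> length ys = n \<and> ?TY n ws ys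
      then pmf (memoryless PY ws) ys else 0)" for n ws ys
  have a0: "0 \<le> a n ws xs" and b0: "0 \<le> b n ws ys" for n ws xs ys by (simp_all add: a_def b_def)
  have posX: "0 < pmf (PX (ws ! i)) (xs ! i)" if "?TX n ws xs" "i < n" for ws xs n i
    using typical_support[OF that] by (auto simp: D1_def pmf_positive)
  have posY: "0 < pmf (PY (ws ! i)) (ys ! i)" if "?TY n ws ys" "i < n" for ws ys n i
    using typical_support[OF that] by (auto simp: D2_def pmf_positive)
  have prod_exp: "(\<Prod>i<n. h i) = exp (\<Sum>i<n. ln (h i))" if "\<And>i. i < n \<Longrightarrow> 0 < h i" for n and h :: "nat \<Rightarrow> real"
    unfolding exp_sum[OF finite_lessThan] using that by (intro prod.cong) auto
  \<comment> \<open>Along a typical pair the information density sums to at most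
    \<open>n * (R + \<gamma>)\<close>; this caps each codeword's share in the constraint for
    \<open>xs\<close>.\<close>
  have bound1: "a n ws xs \<le> exp (real n * (R + \<gamma>)) * pmf (replicate_pmf n \<pi>X) xs" for n ws xs
  proof (cases "length ws = n \<and> length xs = n \<and> ?TX n ws xs")
    case True
    then have ty: "?TX n ws xs" by simp
    have posP: "0 < pmf \<pi>X (xs ! i)" if "i < n" for i
      using typical_support[OF ty that] by (intro pmf_positive) (auto simp: \<pi>X D1_def)
    have "(\<Sum>i<n. ln (pmf (PX (ws ! i)) (xs ! i))) - (\<Sum>i<n. ln (pmf \<pi>X (xs ! i))) = (\<Sum>i<n. f1 (ws ! i, xs ! i))"
      by (simp add: f1_def sum_subtractf)
    also have "\<dots> \<le> real n * (expect D1 f1 + \<epsilon> * S1)"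
      unfolding S1_def using typical_average[OF ty finD(1), of f1] \<epsilon> by simp
    also have "\<dots> \<le> real n * (R + \<gamma>)" using E1 \<epsilon>1 by (intro mult_left_mono) auto
    finally have le: "(\<Sum>i<n. ln (pmf (PX (ws ! i)) (xs ! i))) \<le> real n * (R + \<gamma>) + (\<Sum>i<n. ln (pmf \<pi>X (xs ! i)))" by simp
    have "a n ws xs = exp (\<Sum>i<n. ln (pmf (PX (ws ! i)) (xs ! i)))"
      using True by (simp add: a_def pmf_memoryless prod_exp[OF posX[OF ty]])
    also have "\<dots> \<le> exp (real n * (R + \<gamma>)) * exp (\<Sum>i<n. ln (pmf \<pi>X (xs ! i)))"
      unfolding mult_exp_exp using le by simp
    also have "exp (\<Sum>i<n. ln (pmf \<pi>X (xs ! i))) = pmf (replicate_pmf n \<pi>X) xs"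
      using True by (simp add: pmf_replicate_pmf prod_exp[OF posP])
    finally show ?thesis .
  next
    case False
    then have "a n ws xs = 0" unfolding a_def by (rule if_not_P)
    then show ?thesis by simp
  qed
  \<comment> \<open>The exponent is the mean of \<Phi> up to \<gamma>, built from two
    log-likelihoods and the transport bound on the cost; it holds for all individually typical
    words, whatever their joint type.\<close>
  have bound2: "a n ws xs * b n ws ys \<le> exp (real n * (R + R0 + \<gamma>)) * (\<Prod>i<n. pmf \<pi> (xs ! i, ys ! i))" if n: "1 \<le> n" for n ws xs ys
  proof (cases "length ws = n \<and> length xs = n \<and> length ys = n \<and>
      ?TX n ws xs \<and> ?TY n ws ys")
    case True
    then have ty: "?TX n ws xs" "?TY n ws ys" by auto
    have posP: "0 < pmf \<pi> (xs ! i, ys ! i)" if "i < n" for i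
      using typical_support[OF ty(1) that] typical_support[OF ty(2) that]
      by (intro pmf_positive) (auto simp: joint[symmetric] D1_def D2_def)
    have "(\<Sum>i<n. ln (pmf (PX (ws ! i)) (xs ! i))) \<le> real n * (expect D1 f2 + \<epsilon> * S2)"
      unfolding S2_def using typical_average[OF ty(1) finD(1), of f2] \<epsilon> by (simp add: f2_def)
    moreover have "(\<Sum>i<n. ln (pmf (PY (ws ! i)) (ys ! i))) \<le> real n * (expect D2 f3 + \<epsilon> * S3)"
      unfolding S3_def using typical_average[OF ty(2) finD(2), of f3] \<epsilon> by (simp add: f3_def)
    moreover have "- (\<Sum>i<n. ln (pmf \<pi> (xs ! i, ys ! i))) \<le> real n * ((1 + \<epsilon>) * tw)"
      using typical_cost_le[where c = "cost \<pi>", OF fin \<epsilon> n cost_nonneg ty[unfolded D1_def D2_def]]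
      by (simp add: cost_def sum_negf tw_def mult_ac)
    ultimately have "(\<Sum>i<n. ln (pmf (PX (ws ! i)) (xs ! i))) + (\<Sum>i<n. ln (pmf (PY (ws ! i)) (ys ! i)))
       - (\<Sum>i<n. ln (pmf \<pi> (xs ! i, ys ! i)))
      \<le> real n * (expect D1 f2 + \<epsilon> * S2) + real n * (expect D2 f3 + \<epsilon> * S3) + real n * ((1 + \<epsilon>) * tw)"
      by linarith
    also have "\<dots> = real n * ((tw + expect D1 f2 + expect D2 f3) + \<epsilon> * (S2 + S3 + tw))" by (simp add: algebra_simps)
    also have "\<dots> \<le> real n * (R + R0 + \<gamma>)" by (rule mult_left_mono[OF add_mono[OF EF \<epsilon>2]]) simp
    finally have le: "(\<Sum>i<n. ln (pmf (PX (ws ! i)) (xs ! i))) + (\<Sum>i<n. ln (pmf (PY (ws ! i)) (ys ! i)))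
       \<le> real n * (R + R0 + \<gamma>) + (\<Sum>i<n. ln (pmf \<pi> (xs ! i, ys ! i)))" by simp
    have "a n ws xs * b n ws ys = exp ((\<Sum>i<n. ln (pmf (PX (ws ! i)) (xs ! i))) + (\<Sum>i<n. ln (pmf (PY (ws ! i)) (ys ! i))))"
      using True by (simp add: a_def b_def pmf_memoryless prod_exp[OF posX[OF ty(1)]] prod_exp[OF posY[OF ty(2)]] mult_exp_exp)
    also have "\<dots> \<le> exp (real n * (R + R0 + \<gamma>)) * exp (\<Sum>i<n. ln (pmf \<pi> (xs ! i, ys ! i)))"
      unfolding mult_exp_exp using le by simp
    also have "exp (\<Sum>i<n. ln (pmf \<pi> (xs ! i, ys ! i))) = (\<Prod>i<n. pmf \<pi> (xs ! i, ys ! i))"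
      by (simp add: prod_exp[OF posP])
    finally show ?thesis .
  next
    case False
    then have z: "a n ws xs * b n ws ys = 0" by (auto simp: a_def b_def)
    show ?thesis unfolding z by (simp add: prod_nonneg)
  qed
  define A where "A n ws = (\<Sum>xs | length xs = n. a n ws xs)" for n ws
  define B where "B n ws = (\<Sum>ys | length ys = n. b n ws ys)" for n ws
  have AE: "A n ws = 1 - expect (memoryless PX ws) (\<lambda>xs. of_bool (\<not> ?TX n ws xs))"
    if "length ws = n" for n ws
    unfolding A_def sum_restrict_memoryless[OF that, symmetric]
    using that by (intro sum.cong) (auto simp: a_def)
  have BE: "B n ws = 1 - expect (memoryless PY ws) (\<lambda>ys. of_bool (\<not> ?TY n ws ys))"
    if "length ws = n" for n ws
    unfolding B_def sum_restrict_memoryless[OF that, symmetric]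
    using that by (intro sum.cong) (auto simp: b_def)
  have A01: "0 \<le> A n ws" "A n ws \<le> 1" if "length ws = n" for n ws
  proof -
    show "0 \<le> A n ws" unfolding A_def by (intro sum_nonneg a0)
    show "A n ws \<le> 1" unfolding AE[OF that] by (simp add: Bochner_Integration.integral_nonneg)
  qed
  have B01: "0 \<le> B n ws" "B n ws \<le> 1" if "length ws = n" for n ws
  proof -
    show "0 \<le> B n ws" unfolding B_def by (intro sum_nonneg b0)
    show "B n ws \<le> 1" unfolding BE[OF that] by (simp add: Bochner_Integration.integral_nonneg)
  qed
  define lx ly where "lx = ln (real CARD('x))" and "ly = ln (real CARD('y))"
  have l0: "0 \<le> lx" "0 \<le> ly" by (simp_all add: lx_def ly_def Suc_le_eq)
  \<comment> \<open>The source word is revealed with probability at most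
    \<open>2 * \<delta>\<close>, at \<open>lx\<close> per letter; this choice makes that at most
    \<open>e / 4\<close>.\<close>
  define \<delta> where "\<delta> = e / (8 * (1 + lx))"
  have \<delta>: "0 < \<delta>" using e l0 by (simp add: \<delta>_def)
  have \<delta>lx: "2 * \<delta> * lx \<le> e / 4"
  proof -
    have "2 * \<delta> * lx = e / 4 * (lx / (1 + lx))"
      unfolding \<delta>_def times_divide_eq_right times_divide_eq_left divide_divide_eq_left
      using l0 by (subst frac_eq_eq) (auto simp: algebra_simps)
    also have "\<dots> \<le> e / 4 * 1" using l0 e by (intro mult_left_mono) auto
    finally show ?thesis by simp
  qed
  define \<kappa> where "\<kappa> = chernoff \<delta>"
  have \<kappa>: "0 < \<kappa>" unfolding \<kappa>_def using \<delta> by (rule chernoff_pos)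
  define tail where "tail n = (\<Sum>z\<in>set_pmf D1. exp (- chernoff \<epsilon> * pmf D1 z) ^ n) + (\<Sum>z\<in>set_pmf D2. exp (- chernoff \<epsilon> * pmf D2 z) ^ n)" for n
  have "tail \<longlonglongrightarrow> 0 + 0" unfolding tail_def[abs_def] by (intro tendsto_add atypical_bound_tendsto_0 \<epsilon>)
  then have ev_tail: "eventually (\<lambda>n. tail n < \<delta>) sequentially" using \<delta> by (intro order_tendstoD) auto
  have ev_n: "eventually (\<lambda>n. max 1 (8 * ln 2 / e) \<le> real n) sequentially"
    using filterlim_real_sequentially unfolding filterlim_at_top by blast
  \<comment> \<open>The three growth rates count the pairs of key and source word, the pairs of
    words, and the single mass constraint. The \<open>+ 1\<close> absorbs the factor 2 in
    \<open>N \<le> 2 * exp (n * R0)\<close>.\<close>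
  have "eventually (\<lambda>n. tail n < \<delta> \<and> max 1 (8 * ln 2 / e) \<le> real n \<and>
      exp (real n * (R0 + lx + 1) - \<kappa> * exp (real n * \<gamma>)) < 1 / 3 \<and>
      exp (real n * (lx + ly) - \<kappa> * exp (real n * \<gamma>)) < 1 / 3 \<and>
      exp (real n * 0 - (\<kappa> * \<delta>) * exp (real n * \<gamma>)) < 1 / 3) sequentially"
    using \<kappa> \<gamma> \<delta> by (intro eventually_conj ev_tail ev_n eventually_exp_exp_small) auto
  then obtain n where tail: "tail n < \<delta>" and n_big: "max 1 (8 * ln 2 / e) \<le> real n"
    and ex1: "exp (real n * (R0 + lx + 1) - \<kappa> * exp (real n * \<gamma>)) < 1 / 3"
    and ex2: "exp (real n * (lx + ly) - \<kappa> * exp (real n * \<gamma>)) < 1 / 3"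
    and ex3: "exp (real n * 0 - (\<kappa> * \<delta>) * exp (real n * \<gamma>)) < 1 / 3"
    using eventually_happens'[OF sequentially_bot] by blast
  have n: "1 \<le> n" using n_big by simp
  have n_ln: "8 * ln 2 \<le> real n * e" using n_big e by (simp add: pos_divide_le_eq)
  define N where "N = nat \<lceil>exp (real n * R0)\<rceil>"
  \<comment> \<open>One \<gamma> matches the cap in \<open>bound1\<close> and \<open>bound2\<close>;
    the other leaves at least \<open>exp (n * \<gamma>)\<close> codewords per unit of cap, which
    drives the concentration.\<close>
  define M where "M = nat \<lceil>exp (real n * (R + 2 * \<gamma>))\<rceil>"
  have "0 \<le> real n * R0" using R by simp
  note N = nat_ceiling_exp[OF this, folded N_def]
  have "0 \<le> real n * (R + 2 * \<gamma>)" using R \<gamma> by simp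
  note M = nat_ceiling_exp[OF this, folded M_def]
  define \<mu> where "\<mu> = replicate_pmf n PW"
  have fin\<mu>: "finite (set_pmf \<mu>)" unfolding \<mu>_def using fin by (rule finite_set_replicate_pmf)
  have len\<mu>: "length ws = n" if "ws \<in> set_pmf \<mu>" for ws using that by (auto simp: \<mu>_def set_replicate_pmf)
  define LX where "LX = {xs :: 'x list. length xs = n}"
  define LY where "LY = {ys :: 'y list. length ys = n}"
  have finL: "finite LX" "finite LY"
    unfolding LX_def LY_def
    by (rule finite_words)+
  have cardL: "real (card LX) = exp (real n * lx)" "real (card LY) = exp (real n * ly)"
  proof -
    have "0 < card LX" "0 < card LY"
      using finL length_replicate[of n "undefined :: 'x"] length_replicate[of n "undefined :: 'y"]
      unfolding card_gt_0_iff LX_def LY_def by blast+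
    then show "real (card LX) = exp (real n * lx)" "real (card LY) = exp (real n * ly)"
      unfolding lx_def ly_def ln_card_lists[symmetric] LX_def LY_def by simp_all
  qed
  define pX where "pX = pmf (replicate_pmf n \<pi>X)"
  define pXY where "pXY xs ys = (\<Prod>i<n. pmf \<pi> (xs ! i, ys ! i))" for xs ys
  have pXY0: "0 \<le> pXY xs ys" for xs ys by (simp add: pXY_def prod_nonneg)
  have meanX: "expect \<mu> (\<lambda>ws. a n ws xs * B n ws) \<le> pX xs" if xs: "length xs = n" for xs
  proof -
    have "expect \<mu> (\<lambda>ws. a n ws xs * B n ws) \<le> expect \<mu> (\<lambda>ws. \<Prod>i<n. pmf (PX (ws ! i)) (xs ! i))"
    proof (rule expect_mono_finite[OF fin\<mu>])
      fix ws assume ws: "ws \<in> set_pmf \<mu>"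
      have "a n ws xs * B n ws \<le> a n ws xs" using B01[OF len\<mu>[OF ws]] a0 by (intro mult_left_le) auto
      also have "\<dots> \<le> (\<Prod>i<n. pmf (PX (ws ! i)) (xs ! i))"
        using len\<mu>[OF ws] xs by (auto simp: a_def pmf_memoryless prod_nonneg)
      finally show "a n ws xs * B n ws \<le> (\<Prod>i<n. pmf (PX (ws ! i)) (xs ! i))" .
    qed
    also have "\<dots> = (\<Prod>i<n. expect PW (\<lambda>w. pmf (PX w) (xs ! i)))"
      unfolding \<mu>_def using fin by (rule expect_replicate_prod)
    also have "\<dots> = pX xs" using xs by (simp add: pX_def pmf_replicate_pmf \<pi>X pmf_bind)
    finally show ?thesis .
  qed
  have meanXY: "expect \<mu> (\<lambda>ws. a n ws xs * b n ws ys) \<le> pXY xs ys" if xs: "length xs = n" "length ys = n" for xs ys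
  proof -
    have "expect \<mu> (\<lambda>ws. a n ws xs * b n ws ys) \<le> expect \<mu> (\<lambda>ws. \<Prod>i<n. pmf (PX (ws ! i)) (xs ! i) * pmf (PY (ws ! i)) (ys ! i))"
    proof (rule expect_mono_finite[OF fin\<mu>])
      fix ws assume ws: "ws \<in> set_pmf \<mu>"
      show "a n ws xs * b n ws ys \<le> (\<Prod>i<n. pmf (PX (ws ! i)) (xs ! i) * pmf (PY (ws ! i)) (ys ! i))"
        using len\<mu>[OF ws] xs by (auto simp: a_def b_def pmf_memoryless prod_nonneg prod.distrib)
    qed
    also have "\<dots> = (\<Prod>i<n. expect PW (\<lambda>w. pmf (PX w) (xs ! i) * pmf (PY w) (ys ! i)))"
      unfolding \<mu>_def using fin by (rule expect_replicate_prod)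
    also have "\<dots> = pXY xs ys" by (simp add: pXY_def joint[symmetric] pmf_bind pmf_pair)
    finally show ?thesis .
  qed
  have meanAB: "expect \<mu> (\<lambda>ws. 1 - A n ws * B n ws) \<le> \<delta>"
  proof -
    have "expect \<mu> (\<lambda>ws. 1 - A n ws * B n ws) \<le> expect \<mu> (\<lambda>ws.
        expect (memoryless PX ws) (\<lambda>xs. of_bool (\<not> ?TX n ws xs)) +
        expect (memoryless PY ws) (\<lambda>ys. of_bool (\<not> ?TY n ws ys)))"
    proof (rule expect_mono_finite[OF fin\<mu>])
      fix ws assume "ws \<in> set_pmf \<mu>"
      then have l: "length ws = n" by (rule len\<mu>)
      have "0 \<le> (1 - A n ws) * (1 - B n ws)" using A01[OF l] B01[OF l] by simp
      then have "1 - A n ws * B n ws \<le> (1 - A n ws) + (1 - B n ws)" by (simp add: algebra_simps)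
      then show "1 - A n ws * B n ws \<le> expect (memoryless PX ws) (\<lambda>xs. of_bool (\<not> ?TX n ws xs)) +
        expect (memoryless PY ws) (\<lambda>ys. of_bool (\<not> ?TY n ws ys))"
        unfolding AE[OF l] BE[OF l] by simp
    qed
    also have "\<dots> \<le> tail n"
      unfolding tail_def D1_def D2_def \<mu>_def
      by (subst expect_add_finite[OF fin\<mu>[unfolded \<mu>_def]]) (intro add_mono atypical_mean fin \<epsilon> finite)
    finally show ?thesis using tail by simp
  qed
  define C :: "(nat \<times> 'x list + ('x list \<times> 'y list + unit)) set"
    where "C = ({1..N} \<times> LX) <+> ((LX \<times> LY) <+> {()})"
  \<comment> \<open>Each constraint is scaled to mean at most 1. Where \<open>pX xs\<close> or
    \<open>pXY xs ys\<close> is 0 the quotient is 0 by convention, and the numerator vanishes too by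
    \<open>bound1\<close> and \<open>bound2\<close>.\<close>
  define Z where "Z c ws = (case c of Inl (k, xs) \<Rightarrow> a n ws xs * B n ws / pX xs
      | Inr (Inl (xs, ys)) \<Rightarrow> a n ws xs * b n ws ys / pXY xs ys | Inr (Inr _) \<Rightarrow> (1 - A n ws * B n ws) / \<delta>)"
    for c :: "nat \<times> 'x list + ('x list \<times> 'y list + unit)" and ws
  \<comment> \<open>The encoder's law must be a probability for each key separately, so those
    constraints use one key's codewords; the output law and the mass are averaged over all
    keys.\<close>
  define J where "J c = (case c of Inl (k, xs) \<Rightarrow> Pair k ` {..<M} | Inr _ \<Rightarrow> {1..N} \<times> {..<M})"
    for c :: "nat \<times> 'x list + ('x list \<times> 'y list + unit)"
  define Bd where "Bd c = (case c of Inl _ \<Rightarrow> exp (real n * (R + \<gamma>)) | Inr (Inl _) \<Rightarrow> exp (real n * (R + R0 + \<gamma>)) | Inr (Inr _) \<Rightarrow> 1 / \<delta>)"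
    for c :: "nat \<times> 'x list + ('x list \<times> 'y list + unit)"
  have C_cases: "(\<exists>k xs. c = Inl (k, xs) \<and> k \<in> {1..N} \<and> xs \<in> LX) \<or> (\<exists>xs ys. c = Inr (Inl (xs, ys)) \<and> xs \<in> LX \<and> ys \<in> LY) \<or> c = Inr (Inr ())"
    if "c \<in> C" for c using that by (auto simp: C_def)
  have "\<exists>\<omega>. (\<forall>i. \<omega> i \<in> set_pmf \<mu>) \<and> (\<forall>c\<in>C. (\<Sum>i\<in>J c. Z c (\<omega> i)) \<le> (1 + \<delta>) * real (card (J c)))"
  proof (rule random_codebook[where I = "{1..N} \<times> {..<M}" and B = Bd])
    show "finite C" using finL by (simp add: C_def)
    show "J c \<subseteq> {1..N} \<times> {..<M}" if "c \<in> C" for c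
      using C_cases[OF that] by (auto simp: J_def)
    show "0 < Bd c" if "c \<in> C" for c
      using C_cases[OF that] \<delta> by (auto simp: Bd_def)
    show "0 \<le> Z c ws \<and> Z c ws \<le> Bd c" if c: "c \<in> C" and ws: "ws \<in> set_pmf \<mu>" for c ws
    proof -
      note AB = A01[OF len\<mu>[OF ws]] B01[OF len\<mu>[OF ws]]
      consider k xs where "c = Inl (k, xs)" | xs ys where "c = Inr (Inl (xs, ys))" | "c = Inr (Inr ())"
        using C_cases[OF c] by blast
      then show ?thesis
      proof cases
        case 1
        have "a n ws xs * B n ws \<le> a n ws xs" using AB a0 by (intro mult_left_le) auto
        also have "\<dots> \<le> exp (real n * (R + \<gamma>)) * pX xs" unfolding pX_def by (rule bound1)
        finally have "a n ws xs * B n ws / pX xs \<le> exp (real n * (R + \<gamma>))"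
          by (cases "pX xs = 0") (auto simp: pX_def pos_divide_le_eq less_le)
        then show ?thesis using 1 AB a0 by (simp add: Z_def Bd_def pX_def)
      next
        case 2
        have "a n ws xs * b n ws ys \<le> exp (real n * (R + R0 + \<gamma>)) * pXY xs ys"
          unfolding pXY_def using n by (rule bound2)
        then have "a n ws xs * b n ws ys / pXY xs ys \<le> exp (real n * (R + R0 + \<gamma>))"
          using pXY0[of xs ys] by (cases "pXY xs ys = 0") (auto simp: pos_divide_le_eq less_le)
        then show ?thesis using 2 a0 b0 pXY0 by (simp add: Z_def Bd_def)
      next
        case 3
        then show ?thesis using AB \<delta> by (simp add: Z_def Bd_def divide_right_mono mult_le_one)
      qed
    qed
    show "expect \<mu> (Z c) \<le> 1" if c: "c \<in> C" for c
      using C_cases[OF c]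
    proof (elim disjE exE conjE)
      fix k xs assume c: "c = Inl (k, xs)" "xs \<in> LX"
      have "expect \<mu> (Z c) = expect \<mu> (\<lambda>ws. a n ws xs * B n ws) / pX xs" by (simp add: c Z_def[abs_def])
      also have "\<dots> \<le> 1" using meanX[of xs] c(2) by (simp add: divide_le_eq_1 pX_def LX_def less_le)
      finally show ?thesis .
    next
      fix xs ys assume c: "c = Inr (Inl (xs, ys))" "xs \<in> LX" "ys \<in> LY"
      have "expect \<mu> (Z c) = expect \<mu> (\<lambda>ws. a n ws xs * b n ws ys) / pXY xs ys" by (simp add: c Z_def[abs_def])
      also have "\<dots> \<le> 1" using meanXY[of xs ys] c(2,3) pXY0[of xs ys] by (simp add: divide_le_eq_1 LX_def LY_def less_le)
      finally show ?thesis .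
    next
      assume c: "c = Inr (Inr ())"
      have "expect \<mu> (Z c) = expect \<mu> (\<lambda>ws. 1 - A n ws * B n ws) / \<delta>" by (simp add: c Z_def[abs_def])
      also have "\<dots> \<le> 1" using meanAB \<delta> by simp
      finally show ?thesis .
    qed
    show "(\<Sum>c\<in>C. exp (- chernoff \<delta> * real (card (J c)) / Bd c)) < 1"
    proof -
      let ?E = "\<lambda>c. exp (- chernoff \<delta> * real (card (J c)) / Bd c)"
      have split: "(\<Sum>c\<in>C. ?E c) = (\<Sum>v\<in>{1..N} \<times> LX. ?E (Inl v)) + ((\<Sum>v\<in>LX \<times> LY. ?E (Inr (Inl v))) + ?E (Inr (Inr ())))"
        unfolding C_def using finL by (simp add: sum.Plus)
      have cM: "real (card (J (Inl (k, xs)))) = real M" for k xs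
        by (simp add: J_def card_image inj_on_def)
      have cMN: "real (card (J (Inr v))) = real N * real M" for v by (simp add: J_def)
      have e1: "exp (real n * \<gamma>) \<le> real M / exp (real n * (R + \<gamma>))"
      proof -
        have "exp (real n * \<gamma>) * exp (real n * (R + \<gamma>)) = exp (real n * (R + 2 * \<gamma>))"
          by (simp add: mult_exp_exp algebra_simps)
        then show ?thesis using M(1) by (simp add: pos_le_divide_eq)
      qed
      have NM: "exp (real n * (R + R0 + 2 * \<gamma>)) \<le> real N * real M"
      proof -
        have "exp (real n * (R + R0 + 2 * \<gamma>)) = exp (real n * R0) * exp (real n * (R + 2 * \<gamma>))"
          by (simp add: mult_exp_exp algebra_simps)
        also have "\<dots> \<le> real N * real M" using N(1) M(1) by (intro mult_mono) auto
        finally show ?thesis .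
      qed
      have e2: "exp (real n * \<gamma>) \<le> real N * real M / exp (real n * (R + R0 + \<gamma>))"
      proof -
        have "exp (real n * \<gamma>) * exp (real n * (R + R0 + \<gamma>)) = exp (real n * (R + R0 + 2 * \<gamma>))"
          by (simp add: mult_exp_exp algebra_simps)
        then show ?thesis using NM by (simp add: pos_le_divide_eq)
      qed
      have e3: "exp (real n * \<gamma>) \<le> real N * real M"
      proof -
        have "real n * \<gamma> \<le> real n * (R + R0 + 2 * \<gamma>)" using R \<gamma> by (intro mult_left_mono) auto
        then have "exp (real n * \<gamma>) \<le> exp (real n * (R + R0 + 2 * \<gamma>))" by simp
        then show ?thesis using NM by linarith
      qed
      have "(\<Sum>v\<in>{1..N} \<times> LX. ?E (Inl v)) \<le> (\<Sum>v\<in>{1..N} \<times> LX. exp (- \<kappa> * exp (real n * \<gamma>)))"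
      proof (rule sum_mono)
        fix v :: "nat \<times> 'x list"
        obtain k xs where v: "v = (k, xs)" by force
        show "?E (Inl v) \<le> exp (- \<kappa> * exp (real n * \<gamma>))"
          using mult_left_mono[OF e1, of \<kappa>] \<kappa> unfolding v cM by (simp add: Bd_def \<kappa>_def)
      qed
      also have "\<dots> = real N * exp (real n * lx) * exp (- \<kappa> * exp (real n * \<gamma>))"
        by (simp add: card_cartesian_product cardL)
      also have "\<dots> \<le> exp (real n * (R0 + lx + 1)) * exp (- \<kappa> * exp (real n * \<gamma>))"
      proof (rule mult_right_mono)
        have "2 \<le> exp (1 :: real)" using exp_ge_add_one_self[of 1] by simp
        also have "\<dots> \<le> exp (real n)" using n by simp
        finally have "2 * exp (real n * R0) \<le> exp (real n) * exp (real n * R0)"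
          by (intro mult_right_mono) simp_all
        with N(2) have "real N \<le> exp (real n) * exp (real n * R0)" by (rule order_trans)
        then have "real N * exp (real n * lx) \<le> exp (real n) * exp (real n * R0) * exp (real n * lx)"
          by (intro mult_right_mono) auto
        also have "\<dots> = exp (real n * (R0 + lx + 1))" by (simp add: mult_exp_exp algebra_simps)
        finally show "real N * exp (real n * lx) \<le> exp (real n * (R0 + lx + 1))" .
      qed simp
      also have "\<dots> < 1 / 3" using ex1 by (simp add: mult_exp_exp)
      finally have s1: "(\<Sum>v\<in>{1..N} \<times> LX. ?E (Inl v)) < 1 / 3" .
      have "(\<Sum>v\<in>LX \<times> LY. ?E (Inr (Inl v))) \<le> (\<Sum>v\<in>LX \<times> LY. exp (- \<kappa> * exp (real n * \<gamma>)))"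
      proof (rule sum_mono)
        fix v
        show "?E (Inr (Inl v)) \<le> exp (- \<kappa> * exp (real n * \<gamma>))"
          using mult_left_mono[OF e2, of \<kappa>] \<kappa> unfolding cMN by (simp add: Bd_def \<kappa>_def)
      qed
      also have "\<dots> = exp (real n * lx) * exp (real n * ly) * exp (- \<kappa> * exp (real n * \<gamma>))"
        by (simp add: card_cartesian_product cardL)
      also have "\<dots> < 1 / 3" using ex2 by (simp add: mult_exp_exp algebra_simps)
      finally have s2: "(\<Sum>v\<in>LX \<times> LY. ?E (Inr (Inl v))) < 1 / 3" .
      have "?E (Inr (Inr ())) \<le> exp (- (\<kappa> * \<delta>) * exp (real n * \<gamma>))"
        using mult_left_mono[OF e3, of "\<kappa> * \<delta>"] \<kappa> \<delta> unfolding cMN by (simp add: Bd_def \<kappa>_def mult_ac)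
      also have "\<dots> < 1 / 3" using ex3 by simp
      finally have s3: "?E (Inr (Inr ())) < 1 / 3" .
      show ?thesis unfolding split using s1 s2 s3 by linarith
    qed
  qed (use fin\<mu> \<delta> in auto)
  then obtain \<omega> where \<omega>: "\<And>i. \<omega> i \<in> set_pmf \<mu>"
    and con: "\<And>c. c \<in> C \<Longrightarrow> (\<Sum>i\<in>J c. Z c (\<omega> i)) \<le> (1 + \<delta>) * real (card (J c))" by blast
  define cw where "cw m k = \<omega> (k, m)" for m k :: nat
  \<comment> \<open>Scaling by \<open>1 / (1 + \<delta>)\<close> undoes the excess
    \<open>1 + \<delta>\<close> allowed by the random codebook.\<close>
  define \<theta> where "\<theta> = 1 / (1 + \<delta>)"
  have \<theta>: "0 < \<theta>" "\<theta> * (1 + \<delta>) = 1" using \<delta> by (simp_all add: \<theta>_def)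
  have "(ln (real N) / real n, R + e) \<in> exact_rates \<pi> n"
  proof (rule exact_code[where a = "a n" and b = "b n" and cw = cw and M = M and \<theta> = \<theta> and \<rho> = "2 * \<delta>"])
    show "1 \<le> n" "1 \<le> N" "1 \<le> M" "0 \<le> \<theta>" using n N M \<theta> by auto
    show "0 \<le> a n w xs" for w xs by (rule a0)
    show "0 \<le> b n w ys" for w ys by (rule b0)
    show "b n w ys = 0" if "length ys \<noteq> n" for w ys using that by (simp add: b_def)
    show "\<theta> * (\<Sum>m<M. a n (cw m k) xs * (\<Sum>ys | length ys = n. b n (cw m k) ys))
      \<le> real M * pmf (replicate_pmf n (map_pmf fst \<pi>)) xs" if k: "k \<in> {1..N}" and xs: "length xs = n" for k xs
    proof (cases "pX xs = 0")
      case True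
      then have "a n ws xs = 0" for ws using bound1[of n ws xs] a0[of n ws xs] by (simp add: pX_def)
      then show ?thesis by simp
    next
      case False
      then have p: "0 < pX xs" by (simp add: pX_def less_le)
      have "Inl (k, xs) \<in> C" using k xs by (auto simp: C_def LX_def)
      from con[OF this] have "(\<Sum>m<M. a n (cw m k) xs * B n (cw m k)) / pX xs \<le> (1 + \<delta>) * real M"
        by (simp add: J_def Z_def sum.reindex inj_on_def card_image cw_def sum_divide_distrib)
      then have "(\<Sum>m<M. a n (cw m k) xs * B n (cw m k)) \<le> (1 + \<delta>) * real M * pX xs"
        using p by (simp add: pos_divide_le_eq)
      then have "\<theta> * (\<Sum>m<M. a n (cw m k) xs * B n (cw m k)) \<le> \<theta> * ((1 + \<delta>) * real M * pX xs)"
        using \<theta> by (intro mult_left_mono) auto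
      also have "\<dots> = (\<theta> * (1 + \<delta>)) * (real M * pX xs)" by (simp only: mult_ac)
      finally show ?thesis by (simp add: \<theta>(2) B_def pX_def \<pi>X_def)
    qed
    show "\<theta> * (\<Sum>k\<in>{1..N}. \<Sum>m<M. a n (cw m k) xs * b n (cw m k) ys)
      \<le> real M * real N * (\<Prod>i<n. pmf \<pi> (xs ! i, ys ! i))" if xs: "length xs = n" "length ys = n" for xs ys
    proof (cases "pXY xs ys = 0")
      case True
      then have z: "a n ws xs * b n ws ys = 0" for ws
        using bound2[OF n, of ws xs ys] mult_nonneg_nonneg[OF a0 b0, of n ws xs n ws ys] unfolding pXY_def[symmetric] by simp
      show ?thesis unfolding z by (simp add: prod_nonneg)
    next
      case False
      then have p: "0 < pXY xs ys" using pXY0[of xs ys] by (simp add: less_le)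
      have "Inr (Inl (xs, ys)) \<in> C" using xs by (auto simp: C_def LX_def LY_def)
      from con[OF this] have "(\<Sum>k\<in>{1..N}. \<Sum>m<M. a n (cw m k) xs * b n (cw m k) ys) / pXY xs ys \<le> (1 + \<delta>) * (real N * real M)"
        by (simp add: J_def Z_def cw_def sum_divide_distrib sum.cartesian_product card_cartesian_product case_prod_unfold)
      then have "(\<Sum>k\<in>{1..N}. \<Sum>m<M. a n (cw m k) xs * b n (cw m k) ys) \<le> (1 + \<delta>) * (real N * real M) * pXY xs ys"
        using p by (simp only: pos_divide_le_eq)
      then have "\<theta> * (\<Sum>k\<in>{1..N}. \<Sum>m<M. a n (cw m k) xs * b n (cw m k) ys) \<le> \<theta> * ((1 + \<delta>) * (real N * real M) * pXY xs ys)"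
        using \<theta> by (intro mult_left_mono) auto
      also have "\<dots> = (\<theta> * (1 + \<delta>)) * (real M * real N * pXY xs ys)" by (simp only: mult_ac)
      finally show ?thesis by (simp only: \<theta>(2) pXY_def mult_1)
    qed
    show "(1 - 2 * \<delta>) * (real M * real N) \<le> \<theta> * (\<Sum>k\<in>{1..N}. \<Sum>m<M. (\<Sum>xs | length xs = n. a n (cw m k) xs) *
        (\<Sum>ys | length ys = n. b n (cw m k) ys))"
    proof -
      define S where "S = (\<Sum>k\<in>{1..N}. \<Sum>m<M. A n (cw m k) * B n (cw m k))"
      have "Inr (Inr ()) \<in> C" unfolding C_def by blast
      from con[OF this] have "(\<Sum>k\<in>{1..N}. \<Sum>m<M. 1 - A n (cw m k) * B n (cw m k)) / \<delta> \<le> (1 + \<delta>) * (real N * real M)"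
        by (simp add: J_def Z_def cw_def sum_divide_distrib sum.cartesian_product card_cartesian_product case_prod_unfold)
      then have "real N * real M - S \<le> \<delta> * (1 + \<delta>) * (real N * real M)"
        using \<delta> by (simp add: S_def sum_subtractf pos_divide_le_eq mult_ac)
      then have "(1 - \<delta> * (1 + \<delta>)) * (real M * real N) \<le> S" by (simp add: algebra_simps)
      then have "\<theta> * ((1 - \<delta> * (1 + \<delta>)) * (real M * real N)) \<le> \<theta> * S" using \<theta> by (intro mult_left_mono) auto
      moreover have "(1 - 2 * \<delta>) * (real M * real N) \<le> \<theta> * ((1 - \<delta> * (1 + \<delta>)) * (real M * real N))"
      proof -
        \<comment> \<open>Origin of \<open>\<rho> = 2 * \<delta>\<close>: one \<delta> is lost by
          scaling with \<theta>, the other to atypical words.\<close>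
        have "\<theta> * (1 - \<delta> * (1 + \<delta>)) = \<theta> - \<delta> * (\<theta> * (1 + \<delta>))" by (simp add: algebra_simps)
        moreover have "1 - \<delta> \<le> \<theta>"
          unfolding \<theta>_def using \<delta> by (subst pos_le_divide_eq) (auto simp: algebra_simps)
        ultimately have "1 - 2 * \<delta> \<le> \<theta> * (1 - \<delta> * (1 + \<delta>))" using \<theta>(2) by simp
        then have "(1 - 2 * \<delta>) * (real M * real N) \<le> \<theta> * (1 - \<delta> * (1 + \<delta>)) * (real M * real N)"
          by (intro mult_right_mono) auto
        then show ?thesis by (simp only: mult.assoc)
      qed
      ultimately show ?thesis unfolding S_def A_def B_def by linarith
    qed
    show "ln 2 + ln (real M) + 2 * \<delta> * (real n * ln (real CARD('x))) \<le> real n * (R + e)"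
    proof -
      have "2 * \<delta> * (real n * lx) \<le> real n * e / 4"
        using mult_left_mono[OF \<delta>lx, of "real n"] by (simp add: mult_ac)
      moreover have "ln (real M) \<le> ln 2 + real n * R + real n * e / 4"
        using M(5) by (simp add: \<gamma>_def distrib_left)
      moreover have "0 < ln (2 :: real)" by simp
      ultimately show ?thesis using n_ln unfolding lx_def[symmetric] distrib_left by linarith
    qed
  qed
  moreover have "\<bar>ln (real N) / real n - R0\<bar> \<le> e"
  proof -
    have "ln (real N) / real n - R0 = (ln (real N) - real n * R0) / real n" using n by (simp add: field_simps)
    moreover have "0 \<le> ln (real N) - real n * R0" "ln (real N) - real n * R0 \<le> ln 2" using N(4,5) by auto
    moreover have "ln 2 / real n \<le> e" using n_ln n by (simp add: pos_divide_le_eq mult.commute) (smt (verit) ln_gt_zero)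
    ultimately show ?thesis using n by (smt (verit) abs_of_nonneg divide_nonneg_nonneg divide_right_mono of_nat_0_le_iff)
  qed
  ultimately show ?thesis using n by blast
qed

text \<open>Since the mixture equals \<pi>, each pair \<open>PX w\<close>, \<open>PY w\<close> of
  positive weight is supported inside \<pi>, so \<Phi> is finite there and the extended sum is a
  real expectation. The closure absorbs the slack left by \<open>achievability\<close>.\<close>

lemma R_region_subset_R_exact: "R_region \<pi> \<subseteq> R_exact \<pi>"
proof (rule subsetI)
  fix r assume "r \<in> R_region \<pi>"
  obtain R0 R where r: "r = (R0, R)" by force
  from \<open>r \<in> R_region \<pi>\<close> obtain PW :: "nat pmf" and PX PY where R: "0 \<le> R0" "0 \<le> R" and fin: "finite (set_pmf PW)"
    and J: "map_pmf (\<lambda>(w, x, y). (x, y)) (do {w \<leftarrow> PW; x \<leftarrow> PX w; y \<leftarrow> PY w; return_pmf (w, x, y)}) = \<pi>"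
    and I: "mutual_info (map_pmf (\<lambda>(w, x, y). (w, x)) (do {w \<leftarrow> PW; x \<leftarrow> PX w; y \<leftarrow> PY w; return_pmf (w, x, y)})) \<le> R"
    and F: "(\<Sum>w\<in>set_pmf PW. ereal (pmf PW w) * Phi (log_cost \<pi>) (PX w) (PY w)) \<le> ereal (R + R0)"
    unfolding r R_region_def Let_def mem_Collect_eq case_prod_conv by blast
  have joint: "bind_pmf PW (\<lambda>w. pair_pmf (PX w) (PY w)) = \<pi>"
    using J by (simp add: map_pmf_def pair_pmf_def bind_assoc_pmf bind_return_pmf)
  have supp: "set_pmf (PX w) \<times> set_pmf (PY w) \<subseteq> set_pmf \<pi>" if "w \<in> set_pmf PW" for w
    using that by (auto simp: joint[symmetric])
  have I': "ent (map_pmf fst \<pi>) - expect PW (\<lambda>w. ent (PX w)) \<le> R"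
  proof -
    have "map_pmf (\<lambda>(w, x, y). (w, x)) (do {w \<leftarrow> PW; x \<leftarrow> PX w; y \<leftarrow> PY w; return_pmf (w, x, y)})
      = joint_law PW PX"
      by (simp add: map_pmf_def bind_assoc_pmf bind_return_pmf)
    moreover have "map_pmf snd (joint_law PW PX) = map_pmf fst \<pi>"
      by (simp add: joint[symmetric] map_bind_pmf map_pmf_comp map_fst_pair_pmf)
    ultimately show ?thesis using I mutual_info_bind[OF fin, of PX] by simp
  qed
  have F': "expect PW (\<lambda>w. transport_sup (cost \<pi>) (PX w) (PY w) - ent (PX w) - ent (PY w)) \<le> R + R0"
    using F fin by (simp add: Phi_finite[OF supp] expect_finite cong: sum.cong)
  show "r \<in> R_exact \<pi>"
    unfolding R_exact_def closure_approachable
  proof (intro allI impI)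
    fix e :: real assume e: "0 < e"
    then obtain n r0 where n: "n \<ge> 1" "(r0, R + e / 3) \<in> exact_rates \<pi> n" "\<bar>r0 - R0\<bar> \<le> e / 3"
      using achievability[OF fin joint I' F' R(2,1), of "e / 3"] by auto
    have "dist (r0, R + e / 3) r \<le> dist r0 R0 + dist (R + e / 3) R"
      unfolding r dist_Pair_Pair by (rule sqrt_sum_squares_le_sum) auto
    also have "\<dots> < e" using n(3) e by (simp add: dist_real_def)
    finally show "\<exists>y\<in>\<Union>n\<in>{1..}. exact_rates \<pi> n. dist y r < e"
      using n by (intro bexI[of _ "(r0, R + e / 3)"]) auto
  qed
qed

theorem theorem4:
  fixes \<pi> :: "('x::finite \<times> 'y::finite) pmf"
  shows "R_exact \<pi> = R_region \<pi>"
  using R_exact_subset_R_region R_region_subset_R_exact by blast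

end
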